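(* Let $\mathfrak{g}=\varprojlim_\alpha \mathfrak{g}_\alpha$ be a profinite pronilpotent (graded) Lie algebra over a field of characteristic zero. Let $\widehat{S}(\mathfrak{g})=\prod_{n\ge 0}\mathfrak{g}^{\widehat{\otimes} n}/\mathbb{S}_n$ be its completed symmetric algebra, and let $\widehat{\mathcal{U}}(\mathfrak{g})=\widehat{T}(\mathfrak{g})/\overline{J(\mathfrak{g})}$ be its completed universal enveloping algebra, equipped with the quotient topology induced by $\widehat{T}(\mathfrak{g})$. Then the map $$\Phi^{\Sigma}:\widehat{S}(\mathfrak{g})\to\widehat{\mathcal{U}}(\mathfrak{g}),$$ sending a family $([w_n])_{n\ge 0}$ of classes $[w_n]\in \mathfrak{g}^{\widehat{\otimes} n}/\mathbb{S}_n$ to the class in $\widehat{\mathcal{U}}(\mathfrak{g})$ of the element $\left(\sum_{\sigma\in\mathbb{S}_n}\sigma\cdot w_n\right)_{n\ge 0}\in\widehat{T}(\mathfrak{g})$, is a linear homeomorphism.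
   Context: Conventions. The ground field $k$ has characteristic zero. All vector spaces, algebras and Lie algebras are graded (by $\mathbb{Z}$ or $\mathbb{Z}/2$), and all constructions (limits, products, closures, maps) are taken in the graded sense. The Koszul sign rule is used throughout, in particular for the action of the symmetric group $\mathbb{S}_n$ on $n$-fold tensor products; $|x|$ denotes the degree of $x$. The closure of a subset $W$ is denoted $\overline{W}$. A profinite vector space is a vector space $V=\varprojlim_\alpha V_\alpha$ that is an inverse limit of finite-dimensional vector spaces $V_\alpha$ (the inverse system is part of the data and the projections $V\to V_\alpha$ are assumed surjective). It carries the inverse limit topology (each $V_\alpha$ discrete): the kernels of the projections $V\to V_\alpha$ form a basis of neighborhoods of zero. Morphisms are continuous linear maps. Products carry the product topology. The completed tensor product is $V\widehat{\otimes}W:=\varprojlim_{\alpha,\beta}V_\alpha\otimes W_\beta$; it contains $V\otimes W$ as a dense subspace. The completed tensor algebra is $\widehat{T}(V):=\prod_{n\ge0}V^{\widehat{\otimes}n}$ (with $V^{\widehat{\otimes}0}=k$); it contains the usual tensor algebra $T(V)=\bigoplus_{n\ge0}V^{\otimes n}$ as a dense subspace, and the multiplication of $T(V)$ extends uniquely to a continuous multiplication $\widehat{T}(V)\widehat{\otimes}\widehat{T}(V)\to\widehat{T}(V)$. The $\mathbb{S}_n$-action on $V^{\otimes n}$ extends continuously to $V^{\widehat{\otimes}n}$, and $V^{\widehat{\otimes}n}/\mathbb{S}_n$ denotes the space of coinvariants, i.e. the quotient of $V^{\widehat{\otimes}n}$ by the closed subspace which is the kernel of $w\mapsto\sum_{\sigma\in\mathbb{S}_n}\sigma\cdot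 w$; it is a profinite vector space, $V^{\widehat{\otimes}n}/\mathbb{S}_n=\varprojlim_\alpha V_\alpha^{\otimes n}/\mathbb{S}_n$. The completed symmetric algebra is $\widehat{S}(V):=\prod_{n\ge0}V^{\widehat{\otimes}n}/\mathbb{S}_n$. A profinite pronilpotent Lie algebra is a Lie algebra $\mathfrak{g}=\varprojlim_\alpha\mathfrak{g}_\alpha$ that is an inverse limit, in the category of Lie algebras, of a system of finite-dimensional nilpotent Lie algebras $\mathfrak{g}_\alpha$; it is in particular a profinite vector space. A Lie algebra is nilpotent if for some $p$ all Lie monomials of degree at least $p$ in it vanish. For a Lie algebra $\mathfrak{g}$, $J(\mathfrak{g})\subset T(\mathfrak{g})$ is the two-sided ideal of $T(\mathfrak{g})$ generated by the relations $x\otimes y=(-1)^{|x||y|}y\otimes x+[x,y]$ for $x,y\in\mathfrak{g}$. For $\mathfrak{g}$ profinite pronilpotent, $\overline{J(\mathfrak{g})}$ is the closure of $J(\mathfrak{g})$ in $\widehat{T}(\mathfrak{g})$, and $\widehat{\mathcal{U}}(\mathfrak{g}):=\widehat{T}(\mathfrak{g})/\overline{J(\mathfrak{g})}$. *)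

theory Defs
  imports
    "HOL-Analysis.Analysis"
    "HOL-Library.Function_Algebras"
    "HOL-Library.Set_Algebras"
    "HOL-Library.Z2"
    "HOL-Combinatorics.Permutations"
begin

section \<open>Gradings and signs\<close>

text \<open>
  The class pins the type of degrees down to \<open>\<int>\<close> or \<open>\<int>/2\<close>, up to isomorphism; the parity of a
  degree \<open>i\<close> is then \<open>\<not> 2 dvd i\<close> in both cases.

  A graded vector space is a family \<open>V i\<close> of subspaces, one for each degree, of an ambient vector
  space whose scalar multiplication is \<open>s\<close>. No relation between \<open>V i\<close> and \<open>V j\<close> for \<open>i \<noteq> j\<close> is
  required: homogeneous elements are always carried together with their degree. Graded
  constructions (limits, products, closures, maps) are formed separately in each degree.
\<close>

class grading_index = comm_ring_1 +
  assumes degree_of_int: "\<exists>n. (x::'a) = of_int n"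
    and degree_kernel:
      "(\<forall>n. (of_int n :: 'a) = 0 \<longrightarrow> n = 0) \<or> (\<forall>n. (of_int n :: 'a) = 0 \<longleftrightarrow> even n)"

instance int :: grading_index
  by standard auto

instance bit :: grading_index
proof
  fix x :: bit
  show "\<exists>n. x = of_int n"
    by (cases x) (auto intro: exI[of _ 0] exI[of _ 1])
  have two: "(2::bit) * y = 0" for y
    by (cases y) simp_all
  have "(of_int n :: bit) = 0 \<longleftrightarrow> even n" for n
  proof (cases "even n")
    case True
    then obtain m where "n = 2 * m" by (rule evenE)
    then have "(of_int n :: bit) = 2 * of_int m" by (simp only: of_int_mult of_int_numeral)
    with True show ?thesis by (simp only: two simp_thms)
  next
    case False
    then obtain m where "n = 2 * m + 1" by (rule oddE)
    then have "(of_int n :: bit) = 2 * of_int m + 1"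
      by (simp only: of_int_mult of_int_numeral of_int_add of_int_1)
    with False show ?thesis by (simp only: two add_0 one_neq_zero simp_thms)
  qed
  then show "(\<forall>n. (of_int n :: bit) = 0 \<longrightarrow> n = 0) \<or> (\<forall>n. (of_int n :: bit) = 0 \<longleftrightarrow> even n)"
    by blast
qed

lemma degree_parity: "(2::'d::grading_index) dvd of_int n \<longleftrightarrow> even n"
proof
  assume "(2::'d) dvd of_int n"
  then obtain y :: 'd where y: "of_int n = 2 * y" by (elim dvdE)
  obtain m where "y = of_int m" using degree_of_int by blast
  with y have "(of_int (n - 2 * m) :: 'd) = 0" by simp
  then have "n - 2 * m = 0 \<or> even (n - 2 * m)"
    using degree_kernel[where 'a = 'd] by blast
  then show "even n" by presburger
next
  assume "even n"
  then obtain m where "n = 2 * m" by blast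
  then show "(2::'d) dvd of_int n" by simp
qed

definition ksign :: "'d::grading_index \<Rightarrow> 'd \<Rightarrow> 'k::field" where
  "ksign i j = (if \<not> 2 dvd i \<and> \<not> 2 dvd j then - 1 else 1)"

text \<open>The sign \<open>\<epsilon>\<close> in \<open>\<sigma> \<cdot> (x\<^sub>0 \<otimes> \<dots> \<otimes> x\<^sub>m) = \<epsilon> (x\<^bsub>\<sigma>\<inverse>(0)\<^esub> \<otimes> \<dots> \<otimes> x\<^bsub>\<sigma>\<inverse>(m)\<^esub>)\<close>, where \<open>ds\<close> lists
  the degrees of the factors: one factor for each pair whose order is reversed.\<close>

definition koszul_sign :: "(nat \<Rightarrow> nat) \<Rightarrow> 'd::grading_index list \<Rightarrow> 'k::field" where
  "koszul_sign \<sigma> ds =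
     (\<Prod>(p, q) \<in> {(p, q). p < q \<and> q < length ds \<and> \<sigma> q < \<sigma> p}. ksign (ds ! p) (ds ! q))"

section \<open>Linear algebra in function spaces\<close>

definition pscale :: "('k \<Rightarrow> 'v \<Rightarrow> 'v) \<Rightarrow> 'k \<Rightarrow> ('i \<Rightarrow> 'v) \<Rightarrow> ('i \<Rightarrow> 'v)" where
  "pscale s c f = (\<lambda>i. s c (f i))"

lemma vector_space_pscale:
  assumes "vector_space s"
  shows "vector_space (pscale s)"
proof -
  interpret vector_space s by fact
  show ?thesis
    by unfold_locales (auto simp: pscale_def fun_eq_iff scale_right_distrib scale_left_distrib)
qed

lemma vector_space_mult: "vector_space ((*) :: 'k::field \<Rightarrow> 'k \<Rightarrow> 'k)"
  by unfold_locales (auto simp: algebra_simps)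

definition graded_vector_space ::
  "('k::field \<Rightarrow> 'v::ab_group_add \<Rightarrow> 'v) \<Rightarrow> ('d \<Rightarrow> 'v set) \<Rightarrow> bool" where
  "graded_vector_space s V \<longleftrightarrow> vector_space s \<and> (\<forall>i. module.subspace s (V i))"

definition finite_dim_graded ::
  "('k::field \<Rightarrow> 'v::ab_group_add \<Rightarrow> 'v) \<Rightarrow> ('d \<Rightarrow> 'v set) \<Rightarrow> bool" where
  "finite_dim_graded s V \<longleftrightarrow>
     finite {i. V i \<noteq> {0}} \<and> (\<forall>i. \<exists>B. finite B \<and> V i \<subseteq> module.span s B)"

definition inverse_limit ::
  "('i \<Rightarrow> 'i \<Rightarrow> bool) \<Rightarrow> ('i \<Rightarrow> 'x set) \<Rightarrow> ('i \<Rightarrow> 'i \<Rightarrow> 'x \<Rightarrow> 'x) \<Rightarrow> ('i \<Rightarrow> 'x) set" where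
  "inverse_limit le X f =
     {x. (\<forall>i. x i \<in> X i) \<and> (\<forall>i j. le i j \<longrightarrow> f i j (x j) = x i)}"

text \<open>The inverse limit topology: the subspace topology of a product of discrete spaces.\<close>

definition inverse_limit_topology :: "('i \<Rightarrow> 'x) set \<Rightarrow> ('i \<Rightarrow> 'x) topology" where
  "inverse_limit_topology L = subtopology (product_topology (\<lambda>_. discrete_topology UNIV) UNIV) L"

definition quotient_topology :: "'x topology \<Rightarrow> ('x \<Rightarrow> 'y) \<Rightarrow> 'y topology" where
  "quotient_topology X q =
     topology (\<lambda>U. U \<subseteq> q ` topspace X \<and> openin X {x \<in> topspace X. q x \<in> U})"

lemma openin_quotient_topology:
  "openin (quotient_topology X q) U \<longleftrightarrow>
     U \<subseteq> q ` topspace X \<and> openin X {x \<in> topspace X. q x \<in> U}"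
proof -
  let ?P = "\<lambda>U. U \<subseteq> q ` topspace X \<and> openin X {x \<in> topspace X. q x \<in> U}"
  have "istopology ?P"
    unfolding istopology_def
  proof (intro conjI allI impI)
    fix S T assume "?P S" "?P T"
    moreover have "{x \<in> topspace X. q x \<in> S \<inter> T} =
        {x \<in> topspace X. q x \<in> S} \<inter> {x \<in> topspace X. q x \<in> T}" by blast
    ultimately show "S \<inter> T \<subseteq> q ` topspace X" "openin X {x \<in> topspace X. q x \<in> S \<inter> T}"
      by (auto intro: openin_Int)
  next
    fix K assume K: "\<forall>S\<in>K. ?P S"
    moreover have "{x \<in> topspace X. q x \<in> \<Union>K} = (\<Union>S\<in>K. {x \<in> topspace X. q x \<in> S})" by blast
    ultimately show "\<Union>K \<subseteq> q ` topspace X" "openin X {x \<in> topspace X. q x \<in> \<Union>K}"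
      by auto
  qed
  then show ?thesis
    unfolding quotient_topology_def by (simp add: topology_inverse')
qed

lemma quotient_map_quotient_topology: "quotient_map X (quotient_topology X q) q"
proof -
  have "{x \<in> topspace X. q x \<in> q ` topspace X} = topspace X" by blast
  then have "openin (quotient_topology X q) (q ` topspace X)"
    by (simp add: openin_quotient_topology)
  then have "q ` topspace X \<subseteq> topspace (quotient_topology X q)"
    by (rule openin_subset)
  moreover have "topspace (quotient_topology X q) \<subseteq> q ` topspace X"
    using openin_topspace[of "quotient_topology X q"] by (simp only: openin_quotient_topology)
  ultimately show ?thesis
    by (auto simp: quotient_map_def openin_quotient_topology)
qed

text \<open>
  Elements of a quotient space \<open>V/K\<close> are the cosets \<open>v +o K\<close>. Their sum is the setwise sum of
  \<^theory>\<open>HOL-Library.Set_Algebras\<close>. The summand \<open>K\<close> in the scalar multiple only matters for \<open>c = 0\<close>.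
\<close>

definition coset_scale ::
  "('k \<Rightarrow> 'x \<Rightarrow> 'x) \<Rightarrow> 'x::plus set \<Rightarrow> 'k \<Rightarrow> 'x set \<Rightarrow> 'x set" where
  "coset_scale s K c A = s c ` A + K"

section \<open>Tensor products\<close>

text \<open>
  A word \<open>[(i\<^sub>1, x\<^sub>1), \<dots>, (i\<^sub>n, x\<^sub>n)]\<close> lists vectors together with their degrees. For a set \<open>W\<close> of words
  such as \<open>words [V\<^sub>1, \<dots>, V\<^sub>n]\<close>, the functions that are multilinear on \<open>W\<close> are the tuples of multilinear
  maps on the products \<open>V\<^sub>1 i\<^sub>1 \<times> \<dots> \<times> V\<^sub>n i\<^sub>n\<close>, one for each sequence of degrees. The library has no
  tensor products; \<open>x\<^sub>1 \<otimes> \<dots> \<otimes> x\<^sub>n\<close> is realised as the evaluation functional \<open>\<phi> \<mapsto> \<phi> [(i\<^sub>1, x\<^sub>1), \<dots>]\<close> on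
  scalar-valued multilinear functions \<open>\<phi>\<close>, and the tensor product as the span of these functionals.
  That this is the tensor product is the universal property \<open>tensor_universal\<close> below. The functionals
  are set to zero at functions that are not multilinear on \<open>W\<close>.
\<close>

type_synonym ('d, 'v) word = "('d \<times> 'v) list"
type_synonym ('d, 'v, 'k) tensor = "(('d, 'v) word \<Rightarrow> 'k) \<Rightarrow> 'k"

definition words :: "('d \<Rightarrow> 'v set) list \<Rightarrow> ('d, 'v) word set" where
  "words Vs = {w. list_all2 (\<lambda>(i, x) V. x \<in> V i) w Vs}"

definition all_words :: "('d \<Rightarrow> 'v set) \<Rightarrow> ('d, 'v) word set" where
  "all_words V = (\<Union>n. words (replicate n V))"

definition word_degree :: "('d::comm_monoid_add, 'v) word \<Rightarrow> 'd" where
  "word_degree w = sum_list (map fst w)"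

definition multilinear_on ::
  "('k \<Rightarrow> 'v::plus \<Rightarrow> 'v) \<Rightarrow> ('k \<Rightarrow> 'w::plus \<Rightarrow> 'w) \<Rightarrow> ('d, 'v) word set \<Rightarrow>
     (('d, 'v) word \<Rightarrow> 'w) \<Rightarrow> bool" where
  "multilinear_on s s' W \<phi> \<longleftrightarrow>
     (\<forall>u v i x y. u @ (i, x) # v \<in> W \<longrightarrow> u @ (i, y) # v \<in> W \<longrightarrow>
        \<phi> (u @ (i, x + y) # v) = \<phi> (u @ (i, x) # v) + \<phi> (u @ (i, y) # v)) \<and>
     (\<forall>u v i x c. u @ (i, x) # v \<in> W \<longrightarrow> \<phi> (u @ (i, s c x) # v) = s' c (\<phi> (u @ (i, x) # v)))"

abbreviation multilinear_form ::
  "('k::field \<Rightarrow> 'v::plus \<Rightarrow> 'v) \<Rightarrow> ('d, 'v) word set \<Rightarrow> (('d, 'v) word \<Rightarrow> 'k) \<Rightarrow> bool" where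
  "multilinear_form s \<equiv> multilinear_on s (*)"

definition pure_tensor ::
  "('k::field \<Rightarrow> 'v::plus \<Rightarrow> 'v) \<Rightarrow> ('d, 'v) word set \<Rightarrow> ('d, 'v) word \<Rightarrow> ('d, 'v, 'k) tensor" where
  "pure_tensor s W w = (\<lambda>\<phi>. if multilinear_form s W \<phi> then \<phi> w else 0)"

abbreviation tensor_scale :: "'k::field \<Rightarrow> ('d, 'v, 'k) tensor \<Rightarrow> ('d, 'v, 'k) tensor" where
  "tensor_scale \<equiv> pscale (*)"

text \<open>\<open>tensor_space s (words [V\<^sub>1, \<dots>, V\<^sub>n])\<close> is \<open>V\<^sub>1 \<otimes> \<dots> \<otimes> V\<^sub>n\<close>, and \<open>tensor_space s (all_words V)\<close> is
  \<open>T(V) = \<Oplus>\<^sub>n V\<^sup>\<otimes>\<^sup>n\<close>; both contain all degrees.\<close>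

definition tensor_space ::
  "('k::field \<Rightarrow> 'v::plus \<Rightarrow> 'v) \<Rightarrow> ('d, 'v) word set \<Rightarrow> ('d, 'v, 'k) tensor set" where
  "tensor_space s W = module.span tensor_scale (pure_tensor s W ` W)"

definition tensor_space_deg ::
  "('k::field \<Rightarrow> 'v::plus \<Rightarrow> 'v) \<Rightarrow> ('d::comm_monoid_add, 'v) word set \<Rightarrow> 'd \<Rightarrow>
     ('d, 'v, 'k) tensor set" where
  "tensor_space_deg s W d =
     module.span tensor_scale (pure_tensor s W ` {w \<in> W. word_degree w = d})"

text \<open>The linear map of tensor spaces induced by an operation \<open>F\<close> on multilinear forms in the opposite
  direction; \<open>W\<close> is the set of words of the target.\<close>

definition dual_map ::
  "('k::field \<Rightarrow> 'v::plus \<Rightarrow> 'v) \<Rightarrow> ('d, 'v) word set \<Rightarrow>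
     ((('d, 'v) word \<Rightarrow> 'k) \<Rightarrow> (('d, 'u) word \<Rightarrow> 'k)) \<Rightarrow> ('d, 'u, 'k) tensor \<Rightarrow> ('d, 'v, 'k) tensor"
  where "dual_map s W F t = (\<lambda>\<phi>. if multilinear_form s W \<phi> then t (F \<phi>) else 0)"

text \<open>Multiplication of \<open>T(V)\<close>, the bilinear extension of concatenation (see \<open>tensor_mult_pure\<close>).\<close>

definition tensor_mult ::
  "('k::field \<Rightarrow> 'v::plus \<Rightarrow> 'v) \<Rightarrow> ('d, 'v) word set \<Rightarrow>
     ('d, 'v, 'k) tensor \<Rightarrow> ('d, 'v, 'k) tensor \<Rightarrow> ('d, 'v, 'k) tensor" where
  "tensor_mult s W a b = dual_map s W (\<lambda>\<phi> u. b (\<lambda>v. \<phi> (u @ v))) a"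

definition map_word :: "('d \<Rightarrow> 'u \<Rightarrow> 'v) list \<Rightarrow> ('d, 'u) word \<Rightarrow> ('d, 'v) word" where
  "map_word fs w = map2 (\<lambda>f (i, x). (i, f i x)) fs w"

lemma tensor_universal:
  fixes s :: "'k::field \<Rightarrow> 'v::ab_group_add \<Rightarrow> 'v" and s' :: "'k \<Rightarrow> 'w::ab_group_add \<Rightarrow> 'w"
    and W :: "('d, 'v) word set"
  assumes "vector_space s'" and \<psi>: "multilinear_on s s' W \<psi>"
  shows "\<exists>L. module_hom tensor_scale s' L \<and> (\<forall>w\<in>W. L (pure_tensor s W w) = \<psi> w)"
proof -
  interpret T: vector_space "tensor_scale :: 'k \<Rightarrow> ('d, 'v, 'k) tensor \<Rightarrow> _"
    by (intro vector_space_pscale vector_space_mult)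
  interpret K: vector_space "(*) :: 'k \<Rightarrow> 'k \<Rightarrow> 'k" by (rule vector_space_mult)
  interpret V': vector_space s' by fact
  interpret TV: vector_space_pair "tensor_scale :: 'k \<Rightarrow> ('d, 'v, 'k) tensor \<Rightarrow> _" s' ..
  interpret VK: vector_space_pair s' "(*) :: 'k \<Rightarrow> 'k \<Rightarrow> 'k" ..
  obtain B where B: "B \<subseteq> pure_tensor s W ` W" "T.independent B" "pure_tensor s W ` W \<subseteq> T.span B"
    by (rule T.maximal_independent_subset)
  define r where "r b = (SOME w. w \<in> W \<and> pure_tensor s W w = b)" for b
  have r: "r b \<in> W \<and> pure_tensor s W (r b) = b" if "b \<in> B" for b
    unfolding r_def using B(1) that by (intro someI_ex[of "\<lambda>w. w \<in> W \<and> pure_tensor s W w = b"]) auto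
  obtain L where L: "Vector_Spaces.linear tensor_scale s' L" "\<forall>b\<in>B. L b = \<psi> (r b)"
    using TV.linear_independent_extend[OF B(2), of "\<lambda>b. \<psi> (r b)"] by blast
  interpret L: Vector_Spaces.linear tensor_scale s' L by (rule L(1))
  have "L (pure_tensor s W w) = \<psi> w" if w: "w \<in> W" for w
  proof (rule ccontr)
    assume ne: "L (pure_tensor s W w) \<noteq> \<psi> w"
    from B(3) w have "pure_tensor s W w \<in> T.span B" by blast
    then obtain S c where S: "finite S" "S \<subseteq> B"
      "pure_tensor s W w = (\<Sum>b\<in>S. tensor_scale (c b) b)"
      unfolding T.span_explicit by blast
    have "V'.independent {L (pure_tensor s W w) - \<psi> w}" using ne by simp
    from VK.linear_independent_extend[OF this, of "\<lambda>_. 1"]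
    obtain l where l: "Vector_Spaces.linear s' (*) l" "l (L (pure_tensor s W w) - \<psi> w) = 1"
      by auto
    interpret l: Vector_Spaces.linear s' "(*)" l by (rule l(1))
    have m: "multilinear_form s W (\<lambda>w. l (\<psi> w))"
      using \<psi> unfolding multilinear_on_def by (auto simp: l.add l.scale)
    have "l (\<psi> w) = pure_tensor s W w (\<lambda>w. l (\<psi> w))"
      using m by (simp add: pure_tensor_def)
    also have "\<dots> = (\<Sum>b\<in>S. c b * b (\<lambda>w. l (\<psi> w)))"
      unfolding S(3) using S(1) by (induction S rule: finite_induct) (auto simp: pscale_def)
    also have "\<dots> = (\<Sum>b\<in>S. c b * l (\<psi> (r b)))"
    proof (rule sum.cong[OF refl])
      fix b assume "b \<in> S"
      then have "b \<in> B" using S(2) by blast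
      have "b (\<lambda>w. l (\<psi> w)) = pure_tensor s W (r b) (\<lambda>w. l (\<psi> w))"
        using r[OF \<open>b \<in> B\<close>] by simp
      also have "\<dots> = l (\<psi> (r b))"
        using m by (simp add: pure_tensor_def)
      finally have "b (\<lambda>w. l (\<psi> w)) = l (\<psi> (r b))" .
      then show "c b * b (\<lambda>w. l (\<psi> w)) = c b * l (\<psi> (r b))" by simp
    qed
    also have "\<dots> = l (L (pure_tensor s W w))"
      using S(2) L(2) by (simp add: S(3) L.sum L.scale l.sum l.scale subset_iff)
    finally show False using l(2) by (simp add: l.diff)
  qed
  moreover have "module_hom tensor_scale s' L" by unfold_locales
  ultimately show ?thesis by blast
qed

lemma all_words_eq: "all_words V = {w. \<forall>(i, x) \<in> set w. x \<in> V i}"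
  unfolding all_words_def words_def by (auto simp: list_all2_conv_all_nth set_conv_nth) force

lemma tensor_mult_pure:
  assumes V: "graded_vector_space s V" and uv: "u \<in> all_words V" "v \<in> all_words V"
  shows "tensor_mult s (all_words V) (pure_tensor s (all_words V) u) (pure_tensor s (all_words V) v)
       = pure_tensor s (all_words V) (u @ v)"
proof
  fix \<phi>
  interpret vector_space s using V by (simp add: graded_vector_space_def)
  let ?W = "all_words V"
  have app: "u @ v \<in> ?W \<longleftrightarrow> u \<in> ?W \<and> v \<in> ?W" "(i, x) # v \<in> ?W \<longleftrightarrow> x \<in> V i \<and> v \<in> ?W" for u v i x
    by (auto simp: all_words_eq)
  let ?f = "\<lambda>u'. pure_tensor s ?W v (\<lambda>v'. \<phi> (u' @ v'))"
  show "tensor_mult s ?W (pure_tensor s ?W u) (pure_tensor s ?W v) \<phi> = pure_tensor s ?W (u @ v) \<phi>"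
  proof (cases "multilinear_form s ?W \<phi>")
    case True
    have add: "\<phi> (a @ (i, x + y) # b) = \<phi> (a @ (i, x) # b) + \<phi> (a @ (i, y) # b)"
      if "a @ (i, x) # b \<in> ?W" "a @ (i, y) # b \<in> ?W" for a b i x y
      using True that unfolding multilinear_on_def by blast
    have sc: "\<phi> (a @ (i, s c x) # b) = c * \<phi> (a @ (i, x) # b)"
      if "a @ (i, x) # b \<in> ?W" for a b i c x
      using True that unfolding multilinear_on_def by blast
    have "multilinear_form s ?W (\<lambda>v'. \<phi> (u' @ v'))" if u': "u' \<in> ?W" for u'
      unfolding multilinear_on_def
    proof (intro conjI allI impI)
      fix a b i x y assume "a @ (i, x) # b \<in> ?W" "a @ (i, y) # b \<in> ?W"
      with u' show "\<phi> (u' @ a @ (i, x + y) # b) = \<phi> (u' @ a @ (i, x) # b) + \<phi> (u' @ a @ (i, y) # b)"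
        using add[of "u' @ a" i x b y] by (simp add: app)
    next
      fix a b i x c assume "a @ (i, x) # b \<in> ?W"
      with u' show "\<phi> (u' @ a @ (i, s c x) # b) = c * \<phi> (u' @ a @ (i, x) # b)"
        using sc[of "u' @ a" i x b c] by (simp add: app)
    qed
    then have 1: "?f u' = \<phi> (u' @ v)" if "u' \<in> ?W" for u'
      using that by (simp add: pure_tensor_def)
    have closed: "a @ (i, x + y) # b \<in> ?W" "a @ (i, s c x) # b \<in> ?W"
      if "a @ (i, x) # b \<in> ?W" "a @ (i, y) # b \<in> ?W" for a b i c x y
      using that V by (simp_all add: app graded_vector_space_def subspace_add subspace_scale)
    have "multilinear_form s ?W ?f"
      unfolding multilinear_on_def
    proof (intro conjI allI impI)
      fix a b i x y assume w: "a @ (i, x) # b \<in> ?W" "a @ (i, y) # b \<in> ?W"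
      show "?f (a @ (i, x + y) # b) = ?f (a @ (i, x) # b) + ?f (a @ (i, y) # b)"
        unfolding 1[OF closed(1)[OF w]] 1[OF w(1)] 1[OF w(2)]
        using add[of a i x "b @ v" y] w uv by (simp add: app)
    next
      fix a b i x c assume w: "a @ (i, x) # b \<in> ?W"
      show "?f (a @ (i, s c x) # b) = c * ?f (a @ (i, x) # b)"
        unfolding 1[OF closed(2)[OF w w]] 1[OF w]
        using sc[of a i x "b @ v" c] w uv by (simp add: app)
    qed
    then show ?thesis
      using True 1[OF uv(1)] by (simp add: tensor_mult_def dual_map_def pure_tensor_def)
  qed (simp add: tensor_mult_def dual_map_def pure_tensor_def)
qed

section \<open>Profinite pronilpotent graded Lie algebras\<close>

locale graded_lie_algebra =
  fixes s :: "'k::field_char_0 \<Rightarrow> 'v::ab_group_add \<Rightarrow> 'v"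
    and V :: "'d::grading_index \<Rightarrow> 'v set"
    and br :: "'d \<Rightarrow> 'd \<Rightarrow> 'v \<Rightarrow> 'v \<Rightarrow> 'v"
  assumes graded: "graded_vector_space s V"
    and br_closed: "\<lbrakk>x \<in> V i; y \<in> V j\<rbrakk> \<Longrightarrow> br i j x y \<in> V (i + j)"
    and br_add_left:
      "\<lbrakk>x \<in> V i; x' \<in> V i; y \<in> V j\<rbrakk> \<Longrightarrow> br i j (x + x') y = br i j x y + br i j x' y"
    and br_add_right:
      "\<lbrakk>x \<in> V i; y \<in> V j; y' \<in> V j\<rbrakk> \<Longrightarrow> br i j x (y + y') = br i j x y + br i j x y'"
    and br_scale_left: "\<lbrakk>x \<in> V i; y \<in> V j\<rbrakk> \<Longrightarrow> br i j (s c x) y = s c (br i j x y)"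
    and br_scale_right: "\<lbrakk>x \<in> V i; y \<in> V j\<rbrakk> \<Longrightarrow> br i j x (s c y) = s c (br i j x y)"
    and br_antisym: "\<lbrakk>x \<in> V i; y \<in> V j\<rbrakk> \<Longrightarrow> br i j x y = - s (ksign i j) (br j i y x)"
    and jacobi: "\<lbrakk>x \<in> V i; y \<in> V j; z \<in> V k\<rbrakk> \<Longrightarrow>
      br i (j + k) x (br j k y z) =
        br (i + j) k (br i j x y) z + s (ksign i j) (br j (i + k) y (br i k x z))"

text \<open>\<open>lie_monomial V br n i x\<close>: \<open>x\<close> is the value of a Lie monomial of degree \<open>n\<close>, that is, an \<open>n\<close>-fold
  iterated bracket of homogeneous elements with some bracketing; \<open>i\<close> is its degree in the grading.\<close>

inductive lie_monomial ::
  "('d::plus \<Rightarrow> 'v set) \<Rightarrow> ('d \<Rightarrow> 'd \<Rightarrow> 'v \<Rightarrow> 'v \<Rightarrow> 'v) \<Rightarrow> nat \<Rightarrow> 'd \<Rightarrow> 'v \<Rightarrow> bool"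
  for V br where
  "x \<in> V i \<Longrightarrow> lie_monomial V br 1 i x"
| "\<lbrakk>lie_monomial V br m i x; lie_monomial V br n j y\<rbrakk>
     \<Longrightarrow> lie_monomial V br (m + n) (i + j) (br i j x y)"

definition nilpotent_lie ::
  "('d::plus \<Rightarrow> 'v::zero set) \<Rightarrow> ('d \<Rightarrow> 'd \<Rightarrow> 'v \<Rightarrow> 'v \<Rightarrow> 'v) \<Rightarrow> bool" where
  "nilpotent_lie V br \<longleftrightarrow> (\<exists>p. \<forall>n\<ge>p. \<forall>i x. lie_monomial V br n i x \<longrightarrow> x = 0)"

text \<open>The degree \<open>i\<close> part of \<open>\<gg> = lim \<gg>\<^sub>\<alpha>\<close>, consisting of families \<open>x\<close> with \<open>x \<alpha> \<in> \<gg>\<^sub>\<alpha>\<close>.\<close>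

definition lie_limit ::
  "('a::preorder \<Rightarrow> 'd \<Rightarrow> 'v set) \<Rightarrow> ('a \<Rightarrow> 'a \<Rightarrow> 'd \<Rightarrow> 'v \<Rightarrow> 'v) \<Rightarrow> 'd \<Rightarrow> ('a \<Rightarrow> 'v) set" where
  "lie_limit G tr i = inverse_limit (\<le>) (\<lambda>\<alpha>. G \<alpha> i) (\<lambda>\<alpha> \<beta>. tr \<alpha> \<beta> i)"

definition lie_limit_bracket ::
  "('a \<Rightarrow> 'd \<Rightarrow> 'd \<Rightarrow> 'v \<Rightarrow> 'v \<Rightarrow> 'v) \<Rightarrow> 'd \<Rightarrow> 'd \<Rightarrow> ('a \<Rightarrow> 'v) \<Rightarrow> ('a \<Rightarrow> 'v) \<Rightarrow> ('a \<Rightarrow> 'v)" where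
  "lie_limit_bracket br i j x y = (\<lambda>\<alpha>. br \<alpha> i j (x \<alpha>) (y \<alpha>))"

text \<open>\<open>tr \<alpha> \<beta> i\<close>, for \<open>\<alpha> \<le> \<beta>\<close>, is the degree \<open>i\<close> part of the transition map from \<open>\<gg>\<^sub>\<beta>\<close> to \<open>\<gg>\<^sub>\<alpha>\<close>.
  The index type is nonempty and directed.\<close>

locale profinite_pronilpotent_lie_algebra =
  fixes s :: "'k::field_char_0 \<Rightarrow> 'v::ab_group_add \<Rightarrow> 'v"
    and G :: "'a::preorder \<Rightarrow> 'd::grading_index \<Rightarrow> 'v set"
    and br :: "'a \<Rightarrow> 'd \<Rightarrow> 'd \<Rightarrow> 'v \<Rightarrow> 'v \<Rightarrow> 'v"
    and tr :: "'a \<Rightarrow> 'a \<Rightarrow> 'd \<Rightarrow> 'v \<Rightarrow> 'v"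
  assumes directed: "\<exists>\<gamma>::'a. \<alpha> \<le> \<gamma> \<and> \<beta> \<le> \<gamma>"
    and lie: "graded_lie_algebra s (G \<alpha>) (br \<alpha>)"
    and finite_dim: "finite_dim_graded s (G \<alpha>)"
    and nilpotent: "nilpotent_lie (G \<alpha>) (br \<alpha>)"
    and tr_closed: "\<lbrakk>\<alpha> \<le> \<beta>; x \<in> G \<beta> i\<rbrakk> \<Longrightarrow> tr \<alpha> \<beta> i x \<in> G \<alpha> i"
    and tr_add:
      "\<lbrakk>\<alpha> \<le> \<beta>; x \<in> G \<beta> i; y \<in> G \<beta> i\<rbrakk> \<Longrightarrow> tr \<alpha> \<beta> i (x + y) = tr \<alpha> \<beta> i x + tr \<alpha> \<beta> i y"
    and tr_scale: "\<lbrakk>\<alpha> \<le> \<beta>; x \<in> G \<beta> i\<rbrakk> \<Longrightarrow> tr \<alpha> \<beta> i (s c x) = s c (tr \<alpha> \<beta> i x)"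
    and tr_bracket: "\<lbrakk>\<alpha> \<le> \<beta>; x \<in> G \<beta> i; y \<in> G \<beta> j\<rbrakk> \<Longrightarrow>
      tr \<alpha> \<beta> (i + j) (br \<beta> i j x y) = br \<alpha> i j (tr \<alpha> \<beta> i x) (tr \<alpha> \<beta> j y)"
    and tr_id: "x \<in> G \<alpha> i \<Longrightarrow> tr \<alpha> \<alpha> i x = x"
    and tr_comp: "\<lbrakk>\<alpha> \<le> \<beta>; \<beta> \<le> \<gamma>; x \<in> G \<gamma> i\<rbrakk> \<Longrightarrow> tr \<alpha> \<beta> i (tr \<beta> \<gamma> i x) = tr \<alpha> \<gamma> i x"
    and proj_surj: "(\<lambda>x. x \<alpha>) ` lie_limit G tr i = G \<alpha> i"

section \<open>Completed tensor and symmetric algebras\<close>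

text \<open>
  The degree \<open>d\<close> part of \<open>\<gg>\<^sup>\<otimes>\<^sup>n\<close>, completed: the limit of \<open>\<gg>\<^bsub>\<alpha>\<^sub>1\<^esub> \<otimes> \<dots> \<otimes> \<gg>\<^bsub>\<alpha>\<^sub>n\<^esub>\<close> over all lists
  \<open>[\<alpha>\<^sub>1, \<dots>, \<alpha>\<^sub>n]\<close>. Families are extended by zero to lists of other lengths.
\<close>

definition ctensor_power ::
  "('k::field_char_0 \<Rightarrow> 'v::ab_group_add \<Rightarrow> 'v) \<Rightarrow> ('a::preorder \<Rightarrow> 'd::grading_index \<Rightarrow> 'v set) \<Rightarrow>
     ('a \<Rightarrow> 'a \<Rightarrow> 'd \<Rightarrow> 'v \<Rightarrow> 'v) \<Rightarrow> nat \<Rightarrow> 'd \<Rightarrow> ('a list \<Rightarrow> ('d, 'v, 'k) tensor) set" where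
  "ctensor_power s G tr n d =
     inverse_limit (list_all2 (\<le>))
       (\<lambda>\<alpha>s. if length \<alpha>s = n then tensor_space_deg s (words (map G \<alpha>s)) d else {0})
       (\<lambda>\<alpha>s \<beta>s. dual_map s (words (map G \<alpha>s)) (\<lambda>\<phi> w. \<phi> (map_word (map2 tr \<alpha>s \<beta>s) w)))"

definition ctensor_power_topology where
  "ctensor_power_topology s G tr n d = inverse_limit_topology (ctensor_power s G tr n d)"

definition ctensor_algebra where
  "ctensor_algebra s G tr d = (\<Pi>\<^sub>E n\<in>UNIV. ctensor_power s G tr n d)"

definition ctensor_algebra_topology where
  "ctensor_algebra_topology s G tr d =
     product_topology (\<lambda>n. ctensor_power_topology s G tr n d) UNIV"

abbreviation cpower_scale ::
  "'k::field \<Rightarrow> ('a list \<Rightarrow> ('d, 'v, 'k) tensor) \<Rightarrow> ('a list \<Rightarrow> ('d, 'v, 'k) tensor)" where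
  "cpower_scale \<equiv> pscale tensor_scale"

abbreviation calgebra_scale ::
  "'k::field \<Rightarrow> (nat \<Rightarrow> 'a list \<Rightarrow> ('d, 'v, 'k) tensor) \<Rightarrow>
     (nat \<Rightarrow> 'a list \<Rightarrow> ('d, 'v, 'k) tensor)" where
  "calgebra_scale \<equiv> pscale cpower_scale"

text \<open>The component at \<open>\<alpha>s\<close> of \<open>\<sigma> \<cdot> t\<close> is obtained from the component of \<open>t\<close> at the permuted list of
  indices, via \<open>x\<^sub>0 \<otimes> \<dots> \<otimes> x\<^sub>m \<mapsto> \<epsilon> (x\<^bsub>\<sigma>\<inverse>(0)\<^esub> \<otimes> \<dots> \<otimes> x\<^bsub>\<sigma>\<inverse>(m)\<^esub>)\<close>. Recall that
  \<open>permute_list f xs ! j = xs ! f j\<close>.\<close>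

definition perm_act ::
  "('k::field_char_0 \<Rightarrow> 'v::ab_group_add \<Rightarrow> 'v) \<Rightarrow> ('a \<Rightarrow> 'd::grading_index \<Rightarrow> 'v set) \<Rightarrow>
     nat \<Rightarrow> (nat \<Rightarrow> nat) \<Rightarrow> ('a list \<Rightarrow> ('d, 'v, 'k) tensor) \<Rightarrow> ('a list \<Rightarrow> ('d, 'v, 'k) tensor)" where
  "perm_act s G n \<sigma> t = (\<lambda>\<alpha>s.
     if length \<alpha>s = n then
       dual_map s (words (map G \<alpha>s))
         (\<lambda>\<phi> w. koszul_sign \<sigma> (map fst w) * \<phi> (permute_list (inv \<sigma>) w))
         (t (permute_list \<sigma> \<alpha>s))
     else 0)"

definition symmetrize where
  "symmetrize s G n t = (\<Sum>\<sigma> | \<sigma> permutes {..<n}. perm_act s G n \<sigma> t)"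

definition sym_kernel where
  "sym_kernel s G tr n d = {t \<in> ctensor_power s G tr n d. symmetrize s G n t = 0}"

definition csym_power where
  "csym_power s G tr n d = (\<lambda>t. t +o sym_kernel s G tr n d) ` ctensor_power s G tr n d"

definition csym_power_topology where
  "csym_power_topology s G tr n d =
     quotient_topology (ctensor_power_topology s G tr n d) (\<lambda>t. t +o sym_kernel s G tr n d)"

definition csym_algebra where
  "csym_algebra s G tr d = (\<Pi>\<^sub>E n\<in>UNIV. csym_power s G tr n d)"

definition csym_algebra_topology where
  "csym_algebra_topology s G tr d =
     product_topology (\<lambda>n. csym_power_topology s G tr n d) UNIV"

section \<open>The completed universal enveloping algebra\<close>

text \<open>The ideal \<open>J(\<gg>)\<close> in the uncompleted tensor algebra \<open>T(\<gg>)\<close>, with all degrees taken together.\<close>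

definition two_sided_ideal ::
  "('k::field \<Rightarrow> 'v::plus \<Rightarrow> 'v) \<Rightarrow> ('d \<Rightarrow> 'v set) \<Rightarrow> ('d, 'v, 'k) tensor set \<Rightarrow> bool" where
  "two_sided_ideal s V I \<longleftrightarrow>
     module.subspace tensor_scale I \<and> I \<subseteq> tensor_space s (all_words V) \<and>
     (\<forall>a \<in> tensor_space s (all_words V). \<forall>b \<in> I.
        tensor_mult s (all_words V) a b \<in> I \<and> tensor_mult s (all_words V) b a \<in> I)"

definition lie_relators ::
  "('k::field \<Rightarrow> 'v::plus \<Rightarrow> 'v) \<Rightarrow> ('d::grading_index \<Rightarrow> 'v set) \<Rightarrow>
     ('d \<Rightarrow> 'd \<Rightarrow> 'v \<Rightarrow> 'v \<Rightarrow> 'v) \<Rightarrow> ('d, 'v, 'k) tensor set" where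
  "lie_relators s V br =
     {pure_tensor s (all_words V) [(i, x), (j, y)]
        - tensor_scale (ksign i j) (pure_tensor s (all_words V) [(j, y), (i, x)])
        - pure_tensor s (all_words V) [(i + j, br i j x y)] | i j x y. x \<in> V i \<and> y \<in> V j}"

definition env_ideal ::
  "('k::field \<Rightarrow> 'v::plus \<Rightarrow> 'v) \<Rightarrow> ('d::grading_index \<Rightarrow> 'v set) \<Rightarrow>
     ('d \<Rightarrow> 'd \<Rightarrow> 'v \<Rightarrow> 'v \<Rightarrow> 'v) \<Rightarrow> ('d, 'v, 'k) tensor set" where
  "env_ideal s V br = two_sided_ideal s V hull lie_relators s V br"

text \<open>The inclusion of \<open>T(\<gg>)\<close> into the completed tensor algebra: the component at
  \<open>n\<close> and \<open>[\<alpha>\<^sub>1, \<dots>, \<alpha>\<^sub>n]\<close> of \<open>x\<^sub>1 \<otimes> \<dots> \<otimes> x\<^sub>m\<close> is \<open>x\<^sub>1 \<alpha>\<^sub>1 \<otimes> \<dots> \<otimes> x\<^sub>n \<alpha>\<^sub>n\<close> if \<open>m = n\<close>, and zero otherwise.\<close>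

definition tensor_incl ::
  "('k::field_char_0 \<Rightarrow> 'v::ab_group_add \<Rightarrow> 'v) \<Rightarrow> ('a \<Rightarrow> 'd::grading_index \<Rightarrow> 'v set) \<Rightarrow>
     ('d, 'a \<Rightarrow> 'v, 'k) tensor \<Rightarrow> (nat \<Rightarrow> 'a list \<Rightarrow> ('d, 'v, 'k) tensor)" where
  "tensor_incl s G t = (\<lambda>n \<alpha>s.
     if length \<alpha>s = n then
       dual_map s (words (map G \<alpha>s))
         (\<lambda>\<phi> w. if length w = n then \<phi> (map_word (map (\<lambda>\<alpha> i x. x \<alpha>) \<alpha>s) w) else 0) t
     else 0)"

text \<open>The closure of \<open>J(\<gg>)\<close> in degree \<open>d\<close>. As \<open>J(\<gg>)\<close> is generated by homogeneous elements, its degree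
  \<open>d\<close> part is the intersection with the degree \<open>d\<close> part of \<open>T(\<gg>)\<close>.\<close>

definition env_ideal_closure where
  "env_ideal_closure s G br tr d =
     ctensor_algebra_topology s G tr d closure_of
       (tensor_incl s G `
         (env_ideal (pscale s) (lie_limit G tr) (lie_limit_bracket br)
            \<inter> tensor_space_deg (pscale s) (all_words (lie_limit G tr)) d))"

definition cenv_topology where
  "cenv_topology s G br tr d =
     quotient_topology (ctensor_algebra_topology s G tr d) (\<lambda>t. t +o env_ideal_closure s G br tr d)"

text \<open>The map \<open>\<Phi>\<^sup>\<Sigma>\<close> in degree \<open>d\<close>, on a family of classes. Independence of the chosen
  representatives is not built into the definition.\<close>

definition Phi_Sigma where
  "Phi_Sigma s G br tr d A =
     (\<lambda>n. symmetrize s G n (SOME w. w \<in> A n)) +o env_ideal_closure s G br tr d"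

end

theory Submission
  imports Defs
begin

text \<open>
  The theorem is a Poincare--Birkhoff--Witt theorem: in every degree, the symmetrized tensors form a
  topological complement of the closed ideal \<open>J\<close> in the completed tensor algebra. The proof constructs
  a continuous linear map \<open>P\<close> on the completed tensor algebra (\<open>retract\<close>) that vanishes on the closed ideal and
  fixes every symmetrized tensor. Moreover each \<open>x\<close> differs from the family \<open>\<Sum>\<^sub>\<sigma> \<sigma> \<cdot> (P x)\<^sub>n / n!\<close> by an
  element of the closed ideal (\<open>diff_sym_part_in_env_closure\<close>). It follows that sending the class of \<open>x\<close> to
  the classes of \<open>(P x)\<^sub>n / n!\<close> is a continuous inverse of \<open>\<Phi>\<^sup>\<Sigma>\<close>.

  The map \<open>P\<close> comes from a dual form of the classical theorem. For a graded Lie algebra, every multilinear function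
  \<open>\<phi>\<close> on words, with values in any vector space, agrees after symmetrization with exactly one function \<open>\<psi>\<close>
  that factors through the enveloping algebra, that is,
  \<open>\<psi> (\<dots> x y \<dots>) = \<plusminus> \<psi> (\<dots> y x \<dots>) + \<psi> (\<dots> [x, y] \<dots>)\<close> (\<open>enveloping_form_exists\<close>, \<open>enveloping_form_unique\<close>).
  Existence is proved by induction on the length of words. Once \<open>\<psi>\<close> is known on shorter words, the relation
  says that \<open>\<psi>\<close> on words of length \<open>n\<close> is fixed by \<open>n - 1\<close> affine operators, one for each pair of neighbouring
  letters. Antisymmetry of the bracket, the relation for shorter words and the Jacobi identity say
  that these operators satisfy the Coxeter relations of \<open>\<SS>\<^sub>n\<close>, and in characteristic zero a
  common fixed point is obtained by averaging (\<open>coxeter_fixed_point\<close>). No basis of the Lie algebra is chosen,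
  so the construction is natural in the Lie algebra.

  Nilpotency makes \<open>P\<close> continuous. If \<open>\<phi>\<close> vanishes on words of more than \<open>m\<close> letters, then the relation reduces
  the value of \<open>\<psi>\<close> on a long word to words of at most \<open>m\<close> iterated brackets of large total degree, one of which is zero;
  hence \<open>\<psi>\<close> vanishes on all long words (\<open>enveloping_form_vanishes\<close>). The component of \<open>P\<close> in
  \<open>\<gg>\<^bsub>\<alpha>\<^sub>1\<^esub> \<otimes> \<dots> \<otimes> \<gg>\<^bsub>\<alpha>\<^sub>m\<^esub>\<close> is \<open>\<psi>\<close> for the projection \<open>\<phi>\<close> from tensors over \<open>\<gg>\<^sub>\<beta>\<close>, where \<open>\<beta>\<close> is an upper bound
  of the \<open>\<alpha>\<^sub>i\<close>, so it depends on finitely many coordinates. Uniqueness of \<open>\<psi>\<close> shows that it is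
  independent of \<open>\<beta>\<close> and compatible with the transition maps. Finally, \<open>T(\<gg>)\<close> is spanned by symmetrized tensors and
  \<open>J(\<gg>)\<close> (\<open>limit.tensor_space_deg_decomposition\<close>), and it is dense (\<open>incl_dense\<close>), which gives the
  decomposition of the completed tensor algebra.
\<close>

section \<open>Koszul signs and symmetrization\<close>

lemma dvd_2_add_iff:
  "(2::'d::grading_index) dvd i + j \<longleftrightarrow> (2 dvd i \<longleftrightarrow> 2 dvd j)"
proof -
  obtain m n where mn: "i = of_int m" "j = of_int n"
    using degree_of_int by metis
  have "(2::'d) dvd of_int (m + n) \<longleftrightarrow> (2 dvd (of_int m::'d) \<longleftrightarrow> 2 dvd (of_int n::'d))"
    unfolding degree_parity by presburger
  then show ?thesis by (simp add: mn)
qed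

lemma ksign_commute: "ksign i j = ksign j i"
  by (auto simp: ksign_def)

lemma ksign_square [simp]: "ksign i j * ksign i j = (1::'k::field)"
  by (auto simp: ksign_def)

lemma ksign_add_left: "ksign (i + j) k = (ksign i k * ksign j k :: 'k::field)"
  by (auto simp: ksign_def dvd_2_add_iff)

lemma ksign_add_right: "ksign k (i + j) = (ksign k i * ksign k j :: 'k::field)"
  by (auto simp: ksign_def dvd_2_add_iff)

text \<open>
  A pair of positions is reversed by \<open>\<sigma> \<circ> \<tau>\<close> exactly if it is reversed by \<open>\<tau>\<close> or its image under \<open>\<tau>\<close> is reversed by \<open>\<sigma>\<close>,
  but not both; if both happen, the sign of the pair occurs twice and cancels.
\<close>

lemma koszul_sign_compose:
  assumes \<sigma>: "\<sigma> permutes {..<length ds}" and \<tau>: "\<tau> permutes {..<length ds}"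
  shows "(koszul_sign (\<sigma> \<circ> \<tau>) ds :: 'k::field)
    = koszul_sign \<sigma> (permute_list (inv \<tau>) ds) * koszul_sign \<tau> ds"
proof -
  define n where "n = length ds"
  define P where "P = {(p, q). p < q \<and> q < n}"
  define g :: "(nat \<Rightarrow> nat) \<Rightarrow> 'a list \<Rightarrow> nat \<times> nat \<Rightarrow> 'k" where
    "g \<rho> es = (\<lambda>(p, q). if (p < q) = (\<rho> p < \<rho> q) then 1 else ksign (es ! p) (es ! q))" for \<rho> es
  have "P \<subseteq> {..<n} \<times> {..<n}" by (auto simp: P_def)
  then have fin: "finite P" by (rule finite_subset) simp
  have sign: "koszul_sign \<rho> es = prod (g \<rho> es) P" if "\<rho> permutes {..<n}" "length es = n" for \<rho> es
  proof -
    have "koszul_sign \<rho> es = (\<Prod>(p, q)\<in>{x \<in> P. \<rho> (snd x) < \<rho> (fst x)}. ksign (es ! p) (es ! q))"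
      unfolding koszul_sign_def that(2) P_def by (intro prod.cong) auto
    also have "\<dots> = (\<Prod>x\<in>P. if \<rho> (snd x) < \<rho> (fst x) then (case x of (p, q) \<Rightarrow> ksign (es ! p) (es ! q)) else 1)"
      using fin by (simp add: prod.inter_filter)
    also have "\<dots> = prod (g \<rho> es) P"
    proof (intro prod.cong refl)
      fix x assume "x \<in> P"
      then obtain p q where x: "x = (p, q)" "p < q" by (auto simp: P_def)
      with permutes_inj[OF that(1)] have "\<rho> p \<noteq> \<rho> q" by (auto dest: injD)
      with x show "(if \<rho> (snd x) < \<rho> (fst x) then (case x of (p, q) \<Rightarrow> ksign (es ! p) (es ! q)) else 1) = g \<rho> es x"
        by (auto simp: g_def)
    qed
    finally show ?thesis .
  qed
  have \<sigma>': "\<sigma> permutes {..<n}" and \<tau>': "\<tau> permutes {..<n}" using \<sigma> \<tau> by (simp_all add: n_def)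
  let ?b = "\<lambda>(p, q). (min (\<tau> p) (\<tau> q), max (\<tau> p) (\<tau> q))"
  let ?es = "permute_list (inv \<tau>) ds"
  have inj: "\<tau> p = \<tau> q \<longleftrightarrow> p = q" for p q using permutes_inj[OF \<tau>'] by (auto dest: injD)
  have lt: "\<tau> p < n \<longleftrightarrow> p < n" for p using permutes_in_image[OF \<tau>', of p] by simp
  have img: "?b ` P \<subseteq> P"
  proof safe
    fix p q assume "(p, q) \<in> P"
    then have "p < q" "q < n" by (auto simp: P_def)
    then show "(min (\<tau> p) (\<tau> q), max (\<tau> p) (\<tau> q)) \<in> P"
      using inj[of p q] lt[of p] lt[of q] by (auto simp: P_def)
  qed
  have "inj_on ?b P"
    by (rule inj_onI) (auto simp: P_def min_def max_def inj split: if_splits)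
  then have bij: "bij_betw ?b P P"
    using img fin by (simp add: bij_betw_def endo_inj_surj)
  have nth: "?es ! \<tau> p = ds ! p" if "p < n" for p
    using that lt[of p] permutes_inv[OF \<tau>] by (simp add: permute_list_nth n_def permutes_inverses[OF \<tau>'])
  have "koszul_sign \<sigma> ?es = prod (g \<sigma> ?es) P"
    by (rule sign[OF \<sigma>']) (simp add: n_def)
  also have "\<dots> = (\<Prod>x\<in>P. g \<sigma> ?es (?b x))"
    by (rule prod.reindex_bij_betw[OF bij, symmetric])
  finally have "koszul_sign \<sigma> ?es * koszul_sign \<tau> ds = (\<Prod>x\<in>P. g \<sigma> ?es (?b x) * g \<tau> ds x)"
    using sign[OF \<tau>', of ds] by (simp add: n_def prod.distrib)
  also have "\<dots> = prod (g (\<sigma> \<circ> \<tau>) ds) P"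
  proof (intro prod.cong refl)
    fix x assume "x \<in> P"
    then obtain p q where x: "x = (p, q)" "p < q" "q < n" by (auto simp: P_def)
    have "\<sigma> (\<tau> p) \<noteq> \<sigma> (\<tau> q)" using x permutes_inj[OF \<sigma>'] by (auto dest!: injD simp: inj)
    with x show "g \<sigma> ?es (?b x) * g \<tau> ds x = g (\<sigma> \<circ> \<tau>) ds x"
      by (auto simp: g_def nth min_def max_def ksign_commute[of "ds ! q"])
  qed
  also have "\<dots> = koszul_sign (\<sigma> \<circ> \<tau>) ds"
    by (rule sign[symmetric]) (auto simp: n_def intro: permutes_compose \<sigma> \<tau>)
  finally show ?thesis by simp
qed

lemma koszul_sign_transpose:
  assumes "Suc i < length ds"
  shows "koszul_sign (Transposition.transpose i (Suc i)) ds = ksign (ds ! i) (ds ! Suc i)"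
proof -
  have "{(p, q). p < q \<and> q < length ds \<and>
      Transposition.transpose i (Suc i) q < Transposition.transpose i (Suc i) p} = {(i, Suc i)}"
    using assms by (auto simp: Transposition.transpose_def split: if_splits)
  then show ?thesis by (simp add: koszul_sign_def)
qed

lemma permute_list_transpose_adjacent:
  "permute_list (Transposition.transpose (length u) (Suc (length u))) (u @ a # b # v) = u @ b # a # v"
proof (rule nth_equalityI)
  fix j assume "j < length (permute_list (Transposition.transpose (length u) (Suc (length u))) (u @ a # b # v))"
  moreover have "Transposition.transpose (length u) (Suc (length u)) permutes {..<length (u @ a # b # v)}"
    by (rule permutes_swap_id) auto
  ultimately show "permute_list (Transposition.transpose (length u) (Suc (length u))) (u @ a # b # v) ! j = (u @ b # a # v) ! j"
    by (auto simp: permute_list_nth Transposition.transpose_def nth_append nth_Cons split: nat.splits)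
qed simp

text \<open>
  Adjacent transpositions generate the symmetric group. The new factor is on the right, so that it acts on
  words first.
\<close>

lemma permutes_adjacent_induct [consumes 1, case_names id swap]:
  assumes "\<sigma> permutes {..<n::nat}"
    and id: "P id"
    and swap: "\<And>\<sigma> i. \<sigma> permutes {..<n} \<Longrightarrow> Suc i < n \<Longrightarrow> P \<sigma> \<Longrightarrow> P (\<sigma> \<circ> Transposition.transpose i (Suc i))"
  shows "P \<sigma>"
proof -
  have seq: "P (\<sigma> \<circ> apply_adj_transps xs)"
    if "\<forall>x\<in>set xs. Suc x < n" "\<sigma> permutes {..<n}" "P \<sigma>" for \<sigma> xs
    using that
  proof (induction xs arbitrary: \<sigma>)
    case (Cons x xs)
    let ?t = "Transposition.transpose x (Suc x)"
    have "?t permutes {..<n}" using Cons.prems by (intro permutes_swap_id) auto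
    then have "\<sigma> \<circ> ?t permutes {..<n}" using Cons.prems by (intro permutes_compose)
    then have "P ((\<sigma> \<circ> ?t) \<circ> apply_adj_transps xs)"
      using Cons.prems by (intro Cons.IH swap[of \<sigma> x]) (auto simp del: o_apply)
    then show ?case by (simp only: apply_adj_transps_Cons o_assoc Suc_eq_plus1)
  qed (simp only: apply_adj_transps_Nil comp_id)
  have transp: "P (\<sigma> \<circ> Transposition.transpose a b)"
    if "a < b" "b < n" "\<sigma> permutes {..<n}" "P \<sigma>" for \<sigma> a b
    using seq[of "adj_transp_seq a b" \<sigma>] that by (simp add: adj_transp_seq_correct set_adj_transp_seq)
  from finite_lessThan assms(1) show ?thesis
  proof (induction rule: permutes_rev_induct)
    case (swap a b p)
    then show ?case
      using transp[of a b p] transp[of b a p] unfolding lessThan_iff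
      by (metis linorder_neqE_nat transpose_commute)
  qed (rule id)
qed

definition word_symmetrize ::
  "('k::field \<Rightarrow> 'e \<Rightarrow> 'e::comm_monoid_add) \<Rightarrow> (('d::grading_index, 'v) word \<Rightarrow> 'e) \<Rightarrow> ('d, 'v) word \<Rightarrow> 'e"
  where "word_symmetrize sE f w = (\<Sum>\<sigma> | \<sigma> permutes {..<length w}.
     sE (koszul_sign \<sigma> (map fst w)) (f (permute_list (inv \<sigma>) w)))"

lemma permute_list_inv_compose:
  assumes \<sigma>: "\<sigma> permutes {..<length w}" and \<tau>: "\<tau> permutes {..<length w}"
  shows "permute_list (inv (\<sigma> \<circ> \<tau>)) w = permute_list (inv \<sigma>) (permute_list (inv \<tau>) w)"
proof -
  have "inv (\<sigma> \<circ> \<tau>) = inv \<tau> \<circ> inv \<sigma>"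
    using assms by (intro o_inv_distrib permutes_bij)
  then show ?thesis
    using permute_list_compose[OF permutes_inv[OF \<sigma>], of "inv \<tau>"] by simp
qed

lemma word_sign_compose:
  assumes \<sigma>: "\<sigma> permutes {..<length w}" and \<tau>: "\<tau> permutes {..<length w}"
  shows "(koszul_sign (\<sigma> \<circ> \<tau>) (map fst w) :: 'k::field)
    = koszul_sign \<sigma> (map fst (permute_list (inv \<tau>) w)) * koszul_sign \<tau> (map fst w)"
  using koszul_sign_compose[of \<sigma> "map fst w" \<tau>] assms
  by (simp add: permute_list_map permutes_inv)

lemma bij_compose_left:
  assumes "\<tau> permutes S" shows "bij_betw ((\<circ>) \<tau>) {\<sigma>. \<sigma> permutes S} {\<sigma>. \<sigma> permutes S}"
  by (rule bij_betw_byWitness[where f' = "(\<circ>) (inv \<tau>)"])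
     (use assms in \<open>auto simp: o_assoc permutes_inv_o intro: permutes_compose permutes_inv\<close>)

lemma bij_compose_right:
  assumes "\<tau> permutes S" shows "bij_betw (\<lambda>\<sigma>. \<sigma> \<circ> \<tau>) {\<sigma>. \<sigma> permutes S} {\<sigma>. \<sigma> permutes S}"
  by (rule bij_betw_byWitness[where f' = "\<lambda>\<sigma>. \<sigma> \<circ> inv \<tau>"])
     (use assms in \<open>auto simp: o_assoc[symmetric] permutes_inv_o intro: permutes_compose permutes_inv\<close>)

lemma card_permutations_lessThan: "card {\<sigma>. \<sigma> permutes {..<n::nat}} = fact n"
  by (simp add: card_permutations)

context vector_space
begin

text \<open>
  Symmetrizing absorbs the signed action of a permutation: the action only reindexes the sum. The
  hypothesis is restricted to the rearrangements of one word, because it can be verified only for words with letters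
  in the given subspaces.
\<close>

lemma word_symmetrize_act:
  assumes \<tau>: "\<tau> permutes {..<length w}"
    and f: "\<And>\<sigma>. \<sigma> permutes {..<length w} \<Longrightarrow>
      g (permute_list (inv \<sigma>) w) = scale (koszul_sign \<tau> (map fst (permute_list (inv \<sigma>) w)))
        (f (permute_list (inv \<tau>) (permute_list (inv \<sigma>) w)))"
  shows "word_symmetrize scale g w = word_symmetrize scale f w"
proof -
  have "word_symmetrize scale f w = (\<Sum>\<sigma> | \<sigma> permutes {..<length w}.
      scale (koszul_sign (\<tau> \<circ> \<sigma>) (map fst w)) (f (permute_list (inv (\<tau> \<circ> \<sigma>)) w)))"
    unfolding word_symmetrize_def
    by (rule sum.reindex_bij_betw[OF bij_compose_left[OF \<tau>], symmetric])
  also have "\<dots> = word_symmetrize scale g w"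
    unfolding word_symmetrize_def
    by (intro sum.cong refl)
       (simp add: f word_sign_compose[OF \<tau>] permute_list_inv_compose[OF \<tau>] mult.commute)
  finally show ?thesis by simp
qed

lemma word_symmetrize_permuted:
  assumes \<tau>: "\<tau> permutes {..<length w}"
  shows "scale (koszul_sign \<tau> (map fst w)) (word_symmetrize scale f (permute_list (inv \<tau>) w))
    = word_symmetrize scale f w"
proof -
  have "word_symmetrize scale f w = (\<Sum>\<sigma> | \<sigma> permutes {..<length w}.
      scale (koszul_sign (\<sigma> \<circ> \<tau>) (map fst w)) (f (permute_list (inv (\<sigma> \<circ> \<tau>)) w)))"
    unfolding word_symmetrize_def
    by (rule sum.reindex_bij_betw[OF bij_compose_right[OF \<tau>], symmetric])
  also have "\<dots> = (\<Sum>\<sigma> | \<sigma> permutes {..<length w}. scale (koszul_sign \<tau> (map fst w))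
      (scale (koszul_sign \<sigma> (map fst (permute_list (inv \<tau>) w))) (f (permute_list (inv \<sigma>) (permute_list (inv \<tau>) w)))))"
    by (intro sum.cong refl) (simp add: word_sign_compose[OF _ \<tau>] permute_list_inv_compose[OF _ \<tau>] mult.commute)
  finally show ?thesis
    by (simp add: word_symmetrize_def scale_sum_right)
qed

lemma word_symmetrize_cong:
  assumes "\<And>\<sigma>. \<sigma> permutes {..<length w} \<Longrightarrow> f (permute_list (inv \<sigma>) w) = g (permute_list (inv \<sigma>) w)"
  shows "word_symmetrize scale f w = word_symmetrize scale g w"
  unfolding word_symmetrize_def using assms by (intro sum.cong refl) auto

lemma word_symmetrize_twice:
  "word_symmetrize scale (word_symmetrize scale f) w
     = scale (of_nat (fact (length w))) (word_symmetrize scale f w)"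
proof -
  have "word_symmetrize scale (word_symmetrize scale f) w
      = (\<Sum>\<sigma> | \<sigma> permutes {..<length w}. word_symmetrize scale f w)"
    by (subst (1) word_symmetrize_def) (intro sum.cong refl, simp add: word_symmetrize_permuted)
  also have "\<dots> = scale (of_nat (card {\<sigma>. \<sigma> permutes {..<length w}})) (word_symmetrize scale f w)"
    by (rule sum_constant_scale)
  finally show ?thesis by (simp add: card_permutations_lessThan)
qed

text \<open>
  A function that changes only by elements of \<open>U\<close> under adjacent transpositions changes only by elements of \<open>U\<close>
  under all permutations, so its symmetrization is \<open>n!\<close> times the function modulo \<open>U\<close>. This is applied when \<open>U\<close> already contains the values on shorter words.
\<close>

lemma word_symmetrize_mod:
  assumes U: "subspace U"
    and D: "\<And>u a b v. u @ a # b # v \<in> D \<Longrightarrow> length (u @ a # b # v) = n \<Longrightarrow>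
      u @ b # a # v \<in> D \<and>
      f (u @ a # b # v) - scale (ksign (fst a) (fst b)) (f (u @ b # a # v)) \<in> U"
    and w: "w \<in> D" "length w = n"
  shows "scale (of_nat (fact n)) (f w) - word_symmetrize scale f w \<in> U"
proof -
  have inv: "permute_list (inv \<sigma>) w \<in> D \<and>
      f w - scale (koszul_sign \<sigma> (map fst w)) (f (permute_list (inv \<sigma>) w)) \<in> U"
    if "\<sigma> permutes {..<n}" "w \<in> D" "length w = n" for \<sigma> w
    using that
  proof (induction arbitrary: w rule: permutes_adjacent_induct)
    case id
    have "scale (koszul_sign id (map fst w)) x = x" for x
      by (simp add: koszul_sign_def case_prod_beta) (subst prod.neutral, auto)
    then show ?case using id U by (simp add: subspace_0 del: id_apply)
  next
    case (swap \<sigma> i)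
    let ?t = "Transposition.transpose i (Suc i)"
    let ?w = "permute_list (inv ?t) w"
    have t: "?t permutes {..<length w}" using swap by (intro permutes_swap_id) auto
    define u where "u = take i w"
    define v where "v = drop (Suc (Suc i)) w"
    have split: "w = u @ w ! i # w ! Suc i # v"
      using swap by (simp add: u_def v_def Cons_nth_drop_Suc)
    have lu: "length u = i" using swap by (simp add: u_def)
    have w': "?w = u @ w ! Suc i # w ! i # v"
      using permute_list_transpose_adjacent[of u "w ! i" "w ! Suc i" v] lu split by simp
    have D': "u @ w ! Suc i # w ! i # v \<in> D"
      and fU: "f (u @ w ! i # w ! Suc i # v)
        - scale (ksign (fst (w ! i)) (fst (w ! Suc i))) (f (u @ w ! Suc i # w ! i # v)) \<in> U"
      using D[of u "w ! i" "w ! Suc i" v] swap.prems split by auto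
    have sgn: "koszul_sign ?t (map fst w) = ksign (fst (w ! i)) (fst (w ! Suc i))"
      using swap koszul_sign_transpose[of i "map fst w"] by simp
    have 1: "f w - scale (koszul_sign ?t (map fst w)) (f ?w) \<in> U"
      unfolding sgn w' using fU split by simp
    have w'D: "?w \<in> D" "length ?w = n"
      using D' swap.prems by (simp only: w', simp only: length_permute_list)
    have IH: "permute_list (inv \<sigma>) ?w \<in> D"
      "f ?w - scale (koszul_sign \<sigma> (map fst ?w)) (f (permute_list (inv \<sigma>) ?w)) \<in> U"
      using swap.IH[OF w'D] by blast+
    have s: "\<sigma> permutes {..<length w}" using swap by simp
    have decomp: "f w - scale (koszul_sign (\<sigma> \<circ> ?t) (map fst w)) (f (permute_list (inv (\<sigma> \<circ> ?t)) w))
      = (f w - scale (koszul_sign ?t (map fst w)) (f ?w))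
        + scale (koszul_sign ?t (map fst w)) (f ?w - scale (koszul_sign \<sigma> (map fst ?w)) (f (permute_list (inv \<sigma>) ?w)))"
      by (simp add: word_sign_compose[OF s t] permute_list_inv_compose[OF s t] scale_right_diff_distrib mult.commute)
    show ?case
      unfolding decomp
      by (intro conjI subspace_add[OF U] subspace_scale[OF U] 1 IH(2))
         (simp only: permute_list_inv_compose[OF s t] IH(1))
  qed
  have "scale (of_nat (fact n)) (f w) = (\<Sum>\<sigma> | \<sigma> permutes {..<n}. f w)"
    by (simp only: sum_constant_scale card_permutations_lessThan)
  then have "scale (of_nat (fact n)) (f w) - word_symmetrize scale f w
    = (\<Sum>\<sigma> | \<sigma> permutes {..<n}. f w - scale (koszul_sign \<sigma> (map fst w)) (f (permute_list (inv \<sigma>) w)))"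
    using w(2) by (simp add: word_symmetrize_def sum_subtractf)
  also have "\<dots> \<in> U"
    using inv w by (intro subspace_sum[OF U]) auto
  finally show ?thesis .
qed

end

lemma (in vector_space) word_symmetrize_add:
  "word_symmetrize scale (\<lambda>w. f w + g w) w = word_symmetrize scale f w + word_symmetrize scale g w"
  by (simp add: word_symmetrize_def scale_right_distrib sum.distrib)

lemma (in vector_space) word_symmetrize_scale:
  "word_symmetrize scale (\<lambda>w. scale c (f w)) w = scale c (word_symmetrize scale f w)"
  by (simp add: word_symmetrize_def scale_sum_right mult.commute)

lemma (in vector_space) word_symmetrize_sum:
  "word_symmetrize scale (\<lambda>w. \<Sum>j\<in>J. f j w) w = (\<Sum>j\<in>J. word_symmetrize scale (f j) w)"
  by (simp add: word_symmetrize_def scale_sum_right sum.swap[of _ J])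

lemma permute_list_replicate:
  assumes "\<sigma> permutes {..<n}" shows "permute_list \<sigma> (replicate n a) = replicate n a"
  by (rule nth_equalityI) (use permutes_in_image[OF assms] assms in \<open>auto simp: permute_list_nth\<close>)

lemma permute_list_inv_cancel:
  assumes "\<sigma> permutes {..<length xs}"
  shows "permute_list (inv \<sigma>) (permute_list \<sigma> xs) = xs"
  using permute_list_compose[of "inv \<sigma>" xs \<sigma>] assms
  by (simp add: permutes_inv permutes_inv_o flip: permute_list_compose)

section \<open>Common fixed points of affine Coxeter operators\<close>

text \<open>
  Affine operators with the Coxeter relations generate an affine action of the symmetric group, whose fixed
  points are found by averaging over an orbit. To avoid the presentation of the symmetric group by generators and relations, the
  average is taken in stages: a fixed point \<open>f\<close> of \<open>A\<^sub>0, \<dots>, A\<^bsub>k-1\<^esub>\<close> is replaced by the mean of the points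
  \<open>A\<^sub>j \<cdots> A\<^sub>k f\<close> for \<open>j \<le> k + 1\<close>, which correspond to the cosets of one symmetric group in the next.
  The map \<open>M N\<close> stands for the mean of \<open>N\<close> points, and the set \<open>C\<close> collects properties that the fixed
  point inherits from \<open>f0\<close>.
\<close>

lemma coxeter_fixed_point:
  fixes A :: "nat \<Rightarrow> 'f \<Rightarrow> 'f" and M :: "nat \<Rightarrow> (nat \<Rightarrow> 'f) \<Rightarrow> 'f"
  assumes nonempty: "f0 \<in> C"
    and A_closed: "\<And>i f. i < m \<Longrightarrow> f \<in> C \<Longrightarrow> A i f \<in> C"
    and M_closed: "\<And>N g. 0 < N \<Longrightarrow> (\<And>j. j < N \<Longrightarrow> g j \<in> C) \<Longrightarrow> M N g \<in> C"
    and M_reindex: "\<And>N g h \<pi>. \<pi> permutes {..<N} \<Longrightarrow> (\<And>j. j < N \<Longrightarrow> g j = h (\<pi> j)) \<Longrightarrow> M N g = M N h"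
    and A_mean: "\<And>i N g. i < m \<Longrightarrow> 0 < N \<Longrightarrow> (\<And>j. j < N \<Longrightarrow> g j \<in> C) \<Longrightarrow> A i (M N g) = M N (\<lambda>j. A i (g j))"
    and involution: "\<And>i f. i < m \<Longrightarrow> f \<in> C \<Longrightarrow> A i (A i f) = f"
    and commute: "\<And>i j f. i + 2 \<le> j \<Longrightarrow> j < m \<Longrightarrow> f \<in> C \<Longrightarrow> A i (A j f) = A j (A i f)"
    and braid: "\<And>i f. Suc i < m \<Longrightarrow> f \<in> C \<Longrightarrow> A i (A (Suc i) (A i f)) = A (Suc i) (A i (A (Suc i) f))"
  shows "\<exists>f\<in>C. \<forall>i<m. A i f = f"
proof -
  have "k \<le> m \<Longrightarrow> \<exists>f\<in>C. \<forall>i<k. A i f = f" for k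
  proof (induction k)
    case 0
    then show ?case using nonempty by auto
  next
    case (Suc k)
    then obtain f where f: "f \<in> C" "\<And>i. i < k \<Longrightarrow> A i f = f" by auto
    define T where "T j = foldr A [j..<Suc k] f" for j
    have T_Suc: "T (Suc k) = f" by (simp add: T_def)
    have T: "T j = A j (T (Suc j))" if "j \<le> k" for j
      unfolding T_def using that upt_conv_Cons[of j "Suc k"] by simp
    have TC: "T j \<in> C" if "j \<le> Suc k" for j
      using that by (induction rule: inc_induct) (use T_Suc T f Suc.prems A_closed in auto)
    have above: "A i (T j) = T j" if "j \<le> Suc k" "Suc i < j" for i j
      using that
    proof (induction rule: inc_induct)
      case base
      then show ?case using f T_Suc by simp
    next
      case (step j)
      have "A i (A j (T (Suc j))) = A j (A i (T (Suc j)))"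
        using step Suc.prems TC by (intro commute) auto
      then show ?case using step T[of j] by simp
    qed
    have below: "A i (T j) = T j" if "j < i" "i \<le> k" for i j
    proof -
      from \<open>j < i\<close> have "j \<le> i - 1" by simp
      then show ?thesis
      proof (induction rule: inc_induct)
        case base
        let ?h = "i - 1"
        have i: "i = Suc ?h" using that by simp
        \<comment> \<open>The braid relation turns \<open>A i A ?h A i\<close> into \<open>A ?h A i A ?h\<close>, and \<open>A ?h\<close> fixes \<open>T (Suc i)\<close>.\<close>
      have h: "T ?h = A ?h (A i (T (Suc i)))" using T[of ?h] T[of i] that i by simp
        have "A i (A ?h (A i (T (Suc i)))) = A ?h (A i (A ?h (T (Suc i))))"
          using braid[of ?h "T (Suc i)"] that Suc.prems TC i by simp
        also have "A ?h (T (Suc i)) = T (Suc i)" using that i by (intro above) auto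
        finally show ?case using h by simp
      next
        case (step j)
        have "A j (A i (T (Suc j))) = A i (A j (T (Suc j)))"
          using step that Suc.prems TC by (intro commute) auto
        then show ?case using step that T[of j] by simp
      qed
    qed
    \<comment> \<open>Applying \<open>A i\<close> permutes the points of the mean.\<close>
  have perm: "A i (T j) = T (Transposition.transpose i (Suc i) j)" if "i \<le> k" "j \<le> Suc k" for i j
    proof -
      consider "j = i" | "j = Suc i" | "j < i" | "Suc i < j" by linarith
      then show ?thesis
      proof cases
        case 1
        then show ?thesis using T[of i] involution[of i "T (Suc i)"] that Suc.prems TC by simp
      next
        case 2
        then show ?thesis using T[of i] that by simp
      qed (use above below that in \<open>auto simp: Transposition.transpose_def\<close>)
    qed
    have "M (Suc (Suc k)) T \<in> C" by (intro M_closed TC) auto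
    moreover have "A i (M (Suc (Suc k)) T) = M (Suc (Suc k)) T" if "i < Suc k" for i
    proof -
      have "A i (M (Suc (Suc k)) T) = M (Suc (Suc k)) (\<lambda>j. A i (T j))"
        using that Suc.prems TC by (intro A_mean) auto
      also have "\<dots> = M (Suc (Suc k)) T"
        using that by (intro M_reindex[of "Transposition.transpose i (Suc i)"] perm permutes_swap_id) auto
      finally show ?thesis .
    qed
    ultimately show ?case by blast
  qed
  then show ?thesis by blast
qed

section \<open>Forms on the enveloping algebra of a graded Lie algebra\<close>

lemma all_words_Nil [simp]: "[] \<in> all_words V"
  and all_words_Cons [simp]: "a # w \<in> all_words V \<longleftrightarrow> snd a \<in> V (fst a) \<and> w \<in> all_words V"
  and all_words_append [simp]: "u @ v \<in> all_words V \<longleftrightarrow> u \<in> all_words V \<and> v \<in> all_words V"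
  by (auto simp: all_words_eq)

lemma all_words_permute_list:
  assumes "\<sigma> permutes {..<length w}" "w \<in> all_words V"
  shows "permute_list \<sigma> w \<in> all_words V"
  using assms by (simp add: all_words_eq)

text \<open>
  For a multilinear \<open>\<psi>\<close> on all words of a Lie algebra, this says that the linear map on the tensor algebra given by
  \<open>\<psi>\<close> vanishes on \<open>J\<close>. The set \<open>D\<close> of words is a parameter, as the relation is established for longer and longer words.
\<close>

definition enveloping_relation ::
  "('k::field \<Rightarrow> 'e::ab_group_add \<Rightarrow> 'e) \<Rightarrow> ('d::grading_index \<Rightarrow> 'd \<Rightarrow> 'v \<Rightarrow> 'v \<Rightarrow> 'v) \<Rightarrow> ('d, 'v) word set \<Rightarrow>
     (('d, 'v) word \<Rightarrow> 'e) \<Rightarrow> bool" where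
  "enveloping_relation sE br D \<psi> \<longleftrightarrow> (\<forall>u i x j y v. u @ (i, x) # (j, y) # v \<in> D \<longrightarrow>
     \<psi> (u @ (i, x) # (j, y) # v) =
       sE (ksign i j) (\<psi> (u @ (j, y) # (i, x) # v)) + \<psi> (u @ (i + j, br i j x y) # v))"

lemma enveloping_relationD:
  "enveloping_relation sE br D \<psi> \<Longrightarrow> u @ (i, x) # (j, y) # v \<in> D \<Longrightarrow>
     \<psi> (u @ (i, x) # (j, y) # v) =
       sE (ksign i j) (\<psi> (u @ (j, y) # (i, x) # v)) + \<psi> (u @ (i + j, br i j x y) # v)"
  by (simp add: enveloping_relation_def)

text \<open>
  Modulo \<open>U\<close> and modulo the value on a contracted word, which is in \<open>U\<close> by induction on the length, the value
  of \<open>\<psi>\<close> is invariant under the signed exchange of neighbours. So \<open>n! \<psi> w\<close> is the symmetrization up to \<open>U\<close>.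
  This one induction is used for uniqueness (\<open>U\<close> zero), for vanishing on long words (\<open>D\<close> the
  words of iterated brackets of fixed total degree), for values in tensors of a given degree, and for the decomposition of the
  tensor algebra, where the relation holds only modulo \<open>U\<close>.
\<close>

lemma enveloping_form_in_subspace:
  fixes sE :: "'k::field_char_0 \<Rightarrow> 'e::ab_group_add \<Rightarrow> 'e"
    and D :: "('d::grading_index, 'v) word set"
  assumes E: "vector_space sE" and U: "module.subspace sE U"
    and swap: "\<And>u i x j y v. u @ (i, x) # (j, y) # v \<in> D \<Longrightarrow> u @ (j, y) # (i, x) # v \<in> D"
    and contract: "\<And>u i x j y v. u @ (i, x) # (j, y) # v \<in> D \<Longrightarrow> u @ (i + j, br i j x y) # v \<in> D"
    and rel: "\<And>u i x j y v. u @ (i, x) # (j, y) # v \<in> D \<Longrightarrow>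
      \<psi> (u @ (i, x) # (j, y) # v)
        - (sE (ksign i j) (\<psi> (u @ (j, y) # (i, x) # v)) + \<psi> (u @ (i + j, br i j x y) # v)) \<in> U"
    and sym: "\<And>w. w \<in> D \<Longrightarrow> word_symmetrize sE \<psi> w \<in> U"
    and w: "w \<in> D"
  shows "\<psi> w \<in> U"
proof -
  interpret E: vector_space sE by fact
  from w show ?thesis
  proof (induction "length w" arbitrary: w rule: less_induct)
    case less
    let ?n = "length w"
    have "sE (of_nat (fact ?n)) (\<psi> w) - word_symmetrize sE \<psi> w \<in> U"
    proof (rule E.word_symmetrize_mod[OF U])
      fix u a b v assume D: "u @ a # b # v \<in> D" and n: "length (u @ a # b # v) = ?n"
      obtain i x j y where ab: "a = (i, x)" "b = (j, y)" by fastforce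
      have "\<psi> (u @ (i + j, br i j x y) # v) \<in> U"
        using n contract[OF D[unfolded ab]] by (intro less.hyps) (auto simp: ab)
      from E.subspace_add[OF U rel[OF D[unfolded ab]] this]
      show "u @ b # a # v \<in> D \<and> \<psi> (u @ a # b # v) - sE (ksign (fst a) (fst b)) (\<psi> (u @ b # a # v)) \<in> U"
        using swap[OF D[unfolded ab]] by (simp add: ab)
    qed (use less.prems in auto)
    from E.subspace_add[OF U this sym[OF less.prems]]
    have "sE (of_nat (fact ?n)) (\<psi> w) \<in> U" by simp
    from E.subspace_scale[OF U this, of "inverse (of_nat (fact ?n))"]
    show ?case by (simp del: of_nat_fact)
  qed
qed

lemma multilinear_on_add:
  "multilinear_on s s' W \<phi> \<Longrightarrow> u @ (i, x) # v \<in> W \<Longrightarrow> u @ (i, y) # v \<in> W \<Longrightarrow>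
     \<phi> (u @ (i, x + y) # v) = \<phi> (u @ (i, x) # v) + \<phi> (u @ (i, y) # v)"
  and multilinear_on_scale:
  "multilinear_on s s' W \<phi> \<Longrightarrow> u @ (i, x) # v \<in> W \<Longrightarrow>
     \<phi> (u @ (i, s c x) # v) = s' c (\<phi> (u @ (i, x) # v))"
  unfolding multilinear_on_def by blast+

definition swap_letters :: "nat \<Rightarrow> 'x list \<Rightarrow> 'x list" where
  "swap_letters i w = take i w @ w ! Suc i # w ! i # drop (Suc (Suc i)) w"

definition contract_letters ::
  "('d::plus \<Rightarrow> 'd \<Rightarrow> 'v \<Rightarrow> 'v \<Rightarrow> 'v) \<Rightarrow> nat \<Rightarrow> ('d, 'v) word \<Rightarrow> ('d, 'v) word" where
  "contract_letters br i w = take i w @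
     (fst (w ! i) + fst (w ! Suc i), br (fst (w ! i)) (fst (w ! Suc i)) (snd (w ! i)) (snd (w ! Suc i)))
       # drop (Suc (Suc i)) w"

lemma swap_letters_split:
  "length u = i \<Longrightarrow> swap_letters i (u @ a # b # v) = u @ b # a # v"
  by (auto simp: swap_letters_def nth_append)

lemma contract_letters_split:
  "length u = i \<Longrightarrow> contract_letters br i (u @ a # b # v) = u @ (fst a + fst b, br (fst a) (fst b) (snd a) (snd b)) # v"
  by (auto simp: contract_letters_def nth_append)

lemma split_adjacent:
  assumes "Suc i < length w"
  obtains u a b v where "w = u @ a # b # v" "length u = i"
proof
  show "w = take i w @ w ! i # w ! Suc i # drop (Suc (Suc i)) w"
    using assms by (simp add: Cons_nth_drop_Suc)
qed (use assms in simp)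

lemma swap_letters_eq_permute_list:
  assumes "Suc i < length w"
  shows "swap_letters i w = permute_list (inv (Transposition.transpose i (Suc i))) w"
proof -
  obtain u a b v where "w = u @ a # b # v" "length u = i" using assms by (rule split_adjacent)
  then show ?thesis using permute_list_transpose_adjacent[of u a b v] swap_letters_split[of u i a b v] by simp
qed

text \<open>
  The two sides of the braid relation, evaluated on a word with letters \<open>x y z\<close>. Here \<open>a\<close>, \<open>b\<close>, \<open>c\<close> are the signs of
  the pairs \<open>xy\<close>, \<open>xz\<close>, \<open>yz\<close>; \<open>p\<close>, \<open>q\<close>, \<open>r\<close> are the values of \<open>\<psi>\<close> with one bracket, and \<open>t\<close>, \<open>t'\<close> are those with two.
\<close>

lemma (in vector_space) braid_identity:
  assumes "a * a = 1"
  shows "scale a (scale b (scale c f + p) + (scale (a * c) q + t)) + (scale (b * c) r + t') =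
    scale c (scale b (scale a f + r) + q) + (scale (a * b) p + (t' + scale a t))"
proof -
  have "a * (a * x) = x" for x using assms by (simp flip: mult.assoc)
  then have twice: "scale a (scale a x) = x" for x using assms by simp
  have "scale a (scale (a * c) q) = scale c q"
    by (simp only: twice scale_scale[symmetric])
  then show ?thesis
    by (simp add: scale_right_distrib mult.commute mult.left_commute add.commute add.left_commute)
qed

context graded_lie_algebra
begin

sublocale vector_space s
  using graded by (simp add: graded_vector_space_def)

lemma V_subspace: "subspace (V i)"
  using graded by (simp add: graded_vector_space_def)

text \<open>
  The extensions of \<open>\<psi>\<close> to words of length \<open>n\<close> that satisfy the enveloping relation are the functions \<open>f\<close> fixed by
  these operators for all \<open>i\<close>. On other words the operators are the identity, so that the Coxeter relations hold for
  all functions.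
\<close>

definition rewrite_at ::
  "('k \<Rightarrow> 'e::ab_group_add \<Rightarrow> 'e) \<Rightarrow> nat \<Rightarrow> (('d, 'v) word \<Rightarrow> 'e) \<Rightarrow> nat \<Rightarrow> (('d, 'v) word \<Rightarrow> 'e) \<Rightarrow> ('d, 'v) word \<Rightarrow> 'e"
  where "rewrite_at sE n \<psi> i f w =
    (if w \<in> all_words V \<and> length w = n \<and> Suc i < n
     then sE (ksign (fst (w ! i)) (fst (w ! Suc i))) (f (swap_letters i w)) + \<psi> (contract_letters br i w)
     else f w)"

lemma rewrite_at_split:
  assumes "u @ (i, x) # (j, y) # v \<in> all_words V" "length (u @ (i, x) # (j, y) # v) = n" "length u = p"
  shows "rewrite_at sE n \<psi> p f (u @ (i, x) # (j, y) # v) =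
    sE (ksign i j) (f (u @ (j, y) # (i, x) # v)) + \<psi> (u @ (i + j, br i j x y) # v)"
  using assms by (auto simp: rewrite_at_def swap_letters_split contract_letters_split nth_append)

lemma rewrite_at_outside:
  "\<not> (w \<in> all_words V \<and> length w = n \<and> Suc p < n) \<Longrightarrow> rewrite_at sE n \<psi> p f w = f w"
  by (auto simp: rewrite_at_def)

context
  fixes sE :: "'k \<Rightarrow> 'e::ab_group_add \<Rightarrow> 'e" and n :: nat and \<psi> :: "('d, 'v) word \<Rightarrow> 'e"
  assumes E: "vector_space sE"
    and mult: "multilinear_on s sE {w \<in> all_words V. length w < n} \<psi>"
    and rel: "enveloping_relation sE br {w \<in> all_words V. length w < n} \<psi>"
begin

interpretation E: vector_space sE by (rule E)

lemma bracket_swap: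
  assumes "u @ (i, x) # (j, y) # v \<in> all_words V" "length (u @ (i, x) # (j, y) # v) = n"
  shows "sE (ksign i j) (\<psi> (u @ (j + i, br j i y x) # v)) = - \<psi> (u @ (i + j, br i j x y) # v)"
proof -
  have xy: "x \<in> V i" "y \<in> V j" "u \<in> all_words V" "v \<in> all_words V" using assms by auto
  let ?b = "br j i y x"
  have b: "?b \<in> V (i + j)" using br_closed[OF xy(2,1)] by (simp add: add.commute)
  have "\<psi> (u @ (i + j, br i j x y) # v) = \<psi> (u @ (i + j, s (- ksign i j) ?b) # v)"
    using br_antisym[OF xy(1,2)] by simp
  also have "\<dots> = sE (- ksign i j) (\<psi> (u @ (i + j, ?b) # v))"
    using assms xy b by (intro multilinear_on_scale[OF mult]) auto
  finally show ?thesis by (simp add: add.commute)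
qed

text \<open>
  By antisymmetry of the bracket the two contracted words cancel.
\<close>

lemma rewrite_at_involution: "rewrite_at sE n \<psi> p (rewrite_at sE n \<psi> p f) = f"
proof
  fix w
  show "rewrite_at sE n \<psi> p (rewrite_at sE n \<psi> p f) w = f w"
  proof (cases "w \<in> all_words V \<and> length w = n \<and> Suc p < n")
    case True
    then obtain u a b v where w': "w = u @ a # b # v" "length u = p" by (metis split_adjacent)
    obtain i x j y where "a = (i, x)" "b = (j, y)" by fastforce
    note w = w'[unfolded this]
    have W: "u @ (i, x) # (j, y) # v \<in> all_words V" "u @ (j, y) # (i, x) # v \<in> all_words V"
      "length (u @ (i, x) # (j, y) # v) = n" "length (u @ (j, y) # (i, x) # v) = n"
      using True w by auto
    show ?thesis
      unfolding w(1) rewrite_at_split[OF W(1,3) w(2)] rewrite_at_split[OF W(2,4) w(2)]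
      using bracket_swap[OF W(1,3)] by (simp add: E.scale_right_distrib ksign_commute[of j i])
  qed (simp add: rewrite_at_outside)
qed

text \<open>
  The two sides differ by the enveloping relation on words with one bracket, where it is known since these are shorter.
\<close>

lemma rewrite_at_commute:
  assumes "p + 2 \<le> q"
  shows "rewrite_at sE n \<psi> p (rewrite_at sE n \<psi> q f) = rewrite_at sE n \<psi> q (rewrite_at sE n \<psi> p f)"
proof
  fix w
  show "rewrite_at sE n \<psi> p (rewrite_at sE n \<psi> q f) w = rewrite_at sE n \<psi> q (rewrite_at sE n \<psi> p f) w"
  proof (cases "w \<in> all_words V \<and> length w = n \<and> Suc q < n")
    case True
    then obtain u' c d v where w1: "w = u' @ c # d # v" "length u' = q" by (metis split_adjacent)
    moreover from w1(2) assms have "Suc p < length u'" by simp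
    then obtain u a b t where "u' = u @ a # b # t" "length u = p" by (rule split_adjacent)
    moreover obtain i x j y k z l r where "a = (i, x)" "b = (j, y)" "c = (k, z)" "d = (l, r)" by fastforce
    ultimately have w: "w = u @ (i, x) # (j, y) # t @ (k, z) # (l, r) # v" and p: "length u = p"
      and q: "length (u @ a' # b' # t) = q" for a' b' by auto
    have W: "u \<in> all_words V" "x \<in> V i" "y \<in> V j" "t \<in> all_words V" "z \<in> V k" "r \<in> V l" "v \<in> all_words V"
      using True by (auto simp: w)
    have cl: "br i j x y \<in> V (i + j)" "br k l z r \<in> V (k + l)"
      using W by (intro br_closed; simp)+
    have n: "length u + length t + length v + 4 = n" using True by (simp add: w)
    have P: "rewrite_at sE n \<psi> p g (u @ (i, x) # (j, y) # t @ c' # d' # v) =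
        sE (ksign i j) (g (u @ (j, y) # (i, x) # t @ c' # d' # v)) + \<psi> (u @ (i + j, br i j x y) # t @ c' # d' # v)"
      if "t @ c' # d' # v \<in> all_words V" for g c' d'
      by (rule rewrite_at_split) (use that W n p in simp_all)
    have Q: "rewrite_at sE n \<psi> q g (u @ a' # b' # t @ (k, z) # (l, r) # v) =
        sE (ksign k l) (g (u @ a' # b' # t @ (l, r) # (k, z) # v)) + \<psi> (u @ a' # b' # t @ (k + l, br k l z r) # v)"
      if "u @ a' # b' # t \<in> all_words V" for g a' b'
    proof -
      have 1: "(u @ a' # b' # t) @ (k, z) # (l, r) # v \<in> all_words V" using that W by simp
      have 2: "length ((u @ a' # b' # t) @ (k, z) # (l, r) # v) = n" using n by simp
      show ?thesis using rewrite_at_split[OF 1 2 q] by simp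
    qed
    have R1: "\<psi> (u @ (i, x) # (j, y) # t @ (k + l, br k l z r) # v) =
        sE (ksign i j) (\<psi> (u @ (j, y) # (i, x) # t @ (k + l, br k l z r) # v))
          + \<psi> (u @ (i + j, br i j x y) # t @ (k + l, br k l z r) # v)"
      by (rule enveloping_relationD[OF rel]) (use W cl n in simp)
    have R2: "\<psi> (u @ (i + j, br i j x y) # t @ (k, z) # (l, r) # v) =
        sE (ksign k l) (\<psi> (u @ (i + j, br i j x y) # t @ (l, r) # (k, z) # v))
          + \<psi> (u @ (i + j, br i j x y) # t @ (k + l, br k l z r) # v)"
    proof -
      have "(u @ (i + j, br i j x y) # t) @ (k, z) # (l, r) # v \<in> {w \<in> all_words V. length w < n}"
        using W cl n by simp
      from enveloping_relationD[OF rel this] show ?thesis by simp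
    qed
    show ?thesis
      unfolding w using W
      by (simp add: P Q) (simp add: R1 R2 E.scale_right_distrib mult.commute add_ac)
  next
    case q: False
    show ?thesis
    proof (cases "w \<in> all_words V \<and> length w = n \<and> Suc p < n")
      case True
      then obtain u a b v where w': "w = u @ a # b # v" "length u = p" by (metis split_adjacent)
      obtain i x j y where "a = (i, x)" "b = (j, y)" by fastforce
      note w = w'[unfolded this]
      have W: "u @ (i, x) # (j, y) # v \<in> all_words V" "length (u @ (i, x) # (j, y) # v) = n"
        using True w by auto
      have "rewrite_at sE n \<psi> q g w = g w" "rewrite_at sE n \<psi> q g (u @ (j, y) # (i, x) # v) = g (u @ (j, y) # (i, x) # v)" for g
        using q True W(2) by (auto intro!: rewrite_at_outside)
      then show ?thesis
        unfolding w(1) by (simp only: rewrite_at_split[OF W w(2)])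
    next
      case False
      then have "rewrite_at sE n \<psi> p g w = g w" "rewrite_at sE n \<psi> q g w = g w" for g
        using q by (auto intro!: rewrite_at_outside)
      then show ?thesis by (simp only:)
    qed
  qed
qed

text \<open>
  After using the enveloping relation on words with one bracket, the two sides differ by the Jacobi
  identity inside words with two brackets.
\<close>

lemma rewrite_at_braid:
  assumes p: "Suc (Suc p) < n"
  shows "rewrite_at sE n \<psi> p (rewrite_at sE n \<psi> (Suc p) (rewrite_at sE n \<psi> p f)) =
    rewrite_at sE n \<psi> (Suc p) (rewrite_at sE n \<psi> p (rewrite_at sE n \<psi> (Suc p) f))"
proof
  fix w
  let ?A = "rewrite_at sE n \<psi> p" and ?B = "rewrite_at sE n \<psi> (Suc p)"
  show "?A (?B (?A f)) w = ?B (?A (?B f)) w"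
  proof (cases "w \<in> all_words V \<and> length w = n")
    case True
    then obtain u' b c v where w1: "w = u' @ b # c # v" "length u' = Suc p"
      using p by (metis split_adjacent)
    moreover obtain u a where "u' = u @ [a]" "length u = p" using w1(2) by (metis length_Suc_conv_rev)
    moreover obtain i x j y k z where "a = (i, x)" "b = (j, y)" "c = (k, z)" by fastforce
    ultimately have w: "w = u @ (i, x) # (j, y) # (k, z) # v" and lu: "length u = p" by auto
    have W: "u \<in> all_words V" "x \<in> V i" "y \<in> V j" "z \<in> V k" "v \<in> all_words V"
      using True by (auto simp: w)
    have n: "length u + length v + 3 = n" using True by (simp add: w)
    have cl: "br i j x y \<in> V (i + j)" "br j k y z \<in> V (j + k)" "br i k x z \<in> V (i + k)"
      using W br_closed by auto
    have P: "?A g (u @ (i, x) # (j, y) # (k, z) # v) =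
        sE (ksign i j) (g (u @ (j, y) # (i, x) # (k, z) # v)) + \<psi> (u @ (i + j, br i j x y) # (k, z) # v)"
      if "x \<in> V i" "y \<in> V j" "z \<in> V k" for g i x j y k z
      using that W n lu by (intro rewrite_at_split) auto
    have Q: "?B g (u @ (i, x) # (j, y) # (k, z) # v) =
        sE (ksign j k) (g (u @ (i, x) # (k, z) # (j, y) # v)) + \<psi> (u @ (i, x) # (j + k, br j k y z) # v)"
      if "x \<in> V i" "y \<in> V j" "z \<in> V k" for g i x j y k z
      using rewrite_at_split[of "u @ [(i, x)]" j y k z v n "Suc p"] that W n lu by auto
    have R: "\<psi> (u @ (i, x) # (j, y) # v) =
        sE (ksign i j) (\<psi> (u @ (j, y) # (i, x) # v)) + \<psi> (u @ (i + j, br i j x y) # v)"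
      if "x \<in> V i" "y \<in> V j" for i x j y
      using that W n by (intro enveloping_relationD[OF rel]) auto
    let ?T = "\<lambda>i x. \<psi> (u @ (i, x) # v)"
    have deg: "i + j + k = i + (j + k)" "j + (i + k) = i + (j + k)" by (simp_all add: add_ac)
    have mem: "br (i + j) k (br i j x y) z \<in> V (i + (j + k))" "br j (i + k) y (br i k x z) \<in> V (i + (j + k))"
      using br_closed[OF cl(1) W(4)] br_closed[OF W(3) cl(3)] by (simp_all only: deg)
    have "?T (i + (j + k)) (br i (j + k) x (br j k y z)) =
        ?T (i + (j + k)) (br (i + j) k (br i j x y) z + s (ksign i j) (br j (i + k) y (br i k x z)))"
      by (simp only: jacobi[OF W(2-4)])
    also have "\<dots> = ?T (i + (j + k)) (br (i + j) k (br i j x y) z)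
        + ?T (i + (j + k)) (s (ksign i j) (br j (i + k) y (br i k x z)))"
      using W n mem by (intro multilinear_on_add[OF mult]) (auto intro: subspace_scale[OF V_subspace])
    also have "?T (i + (j + k)) (s (ksign i j) (br j (i + k) y (br i k x z)))
        = sE (ksign i j) (?T (i + (j + k)) (br j (i + k) y (br i k x z)))"
      using W n mem by (intro multilinear_on_scale[OF mult]) auto
    finally have J: "?T (i + (j + k)) (br i (j + k) x (br j k y z)) =
        ?T (i + j + k) (br (i + j) k (br i j x y) z) + sE (ksign i j) (?T (j + (i + k)) (br j (i + k) y (br i k x z)))"
      by (simp only: deg)
    have "?A (?B (?A f)) w = sE (ksign i j)
        (sE (ksign i k) (sE (ksign j k) (f (u @ (k, z) # (j, y) # (i, x) # v)) + \<psi> (u @ (j + k, br j k y z) # (i, x) # v))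
          + \<psi> (u @ (j, y) # (i + k, br i k x z) # v)) + \<psi> (u @ (i + j, br i j x y) # (k, z) # v)"
      unfolding w using W by (simp add: P Q)
    also have "\<dots> = sE (ksign j k)
        (sE (ksign i k) (sE (ksign i j) (f (u @ (k, z) # (j, y) # (i, x) # v)) + \<psi> (u @ (k, z) # (i + j, br i j x y) # v))
          + \<psi> (u @ (i + k, br i k x z) # (j, y) # v)) + \<psi> (u @ (i, x) # (j + k, br j k y z) # v)"
      unfolding R[OF cl(1) W(4)] R[OF W(3) cl(3)] R[OF W(2) cl(2)] J ksign_add_left ksign_add_right ksign_commute[of j i]
      by (rule E.braid_identity) simp
    also have "\<dots> = ?B (?A (?B f)) w"
      unfolding w using W by (simp add: P Q)
    finally show ?thesis .
  next case False then have *: "rewrite_at sE n \<psi> p f w = f w" for p f by (auto simp: rewrite_at_outside) show ?thesis unfolding * ..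
 qed
qed

end

end

context graded_lie_algebra
begin

context
  fixes sE :: "'k \<Rightarrow> 'e::ab_group_add \<Rightarrow> 'e" and n :: nat and \<psi> :: "('d, 'v) word \<Rightarrow> 'e"
  assumes E: "vector_space sE"
    and mult: "multilinear_on s sE {w \<in> all_words V. length w < n} \<psi>"
    and rel: "enveloping_relation sE br {w \<in> all_words V. length w < n} \<psi>"
begin

interpretation E: vector_space sE by (rule E)

text \<open>
  By antisymmetry, the contracted term changes sign under the signed exchange, so its symmetrization is its own
  negative.
\<close>

lemma rewrite_at_symmetrize:
  assumes w: "w \<in> all_words V" "length w = n"
  shows "word_symmetrize sE (rewrite_at sE n \<psi> p f) w = word_symmetrize sE f w"
proof (cases "Suc p < n")
  case True
  let ?t = "Transposition.transpose p (Suc p)"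
  let ?K = "\<lambda>w. \<psi> (contract_letters br p w)"
  let ?B = "\<lambda>w. sE (ksign (fst (w ! p)) (fst (w ! Suc p))) (f (swap_letters p w))"
  have t: "?t permutes {..<length w}" using True w by (intro permutes_swap_id) auto
  have perm: "permute_list (inv \<sigma>) w \<in> all_words V" "length (permute_list (inv \<sigma>) w) = n"
    if "\<sigma> permutes {..<length w}" for \<sigma>
    using that w by (auto intro: all_words_permute_list permutes_inv)
  have sgn: "koszul_sign ?t (map fst w') = (ksign (fst (w' ! p)) (fst (w' ! Suc p)) :: 'k)" if "length w' = n" for w' :: "('d, 'v) word"
    using koszul_sign_transpose[of p "map fst w'"] that True by simp
  have "word_symmetrize sE (rewrite_at sE n \<psi> p f) w = word_symmetrize sE (\<lambda>w. ?B w + ?K w) w"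
    by (rule E.word_symmetrize_cong) (use perm True in \<open>simp add: rewrite_at_def\<close>)
  also have "\<dots> = word_symmetrize sE ?B w + word_symmetrize sE ?K w"
    by (rule E.word_symmetrize_add)
  also have "word_symmetrize sE ?B w = word_symmetrize sE f w"
    by (rule E.word_symmetrize_act[OF t])
       (use perm sgn True in \<open>simp add: swap_letters_eq_permute_list\<close>)
  also have "word_symmetrize sE ?K w = 0"
  proof -
    have anti: "?K w' = sE (koszul_sign ?t (map fst w')) (- ?K (permute_list (inv ?t) w'))"
      if w': "w' \<in> all_words V" "length w' = n" for w'
    proof -
      obtain u a b v where split: "w' = u @ a # b # v" "length u = p"
        using True w'(2) by (metis split_adjacent)
      obtain i x j y where ab: "a = (i, x)" "b = (j, y)" by fastforce
      note w'' = w'[unfolded split ab]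
      have 1: "permute_list (inv ?t) w' = u @ (j, y) # (i, x) # v"
        using swap_letters_eq_permute_list[of p w'] swap_letters_split[of u p a b v] True w'(2) split
        by (simp add: ab)
      have 2: "koszul_sign ?t (map fst w') = (ksign i j :: 'k)"
        using sgn[OF w'(2)] split by (auto simp: ab nth_append)
      have 3: "?K w' = \<psi> (u @ (i + j, br i j x y) # v)"
        "?K (u @ (j, y) # (i, x) # v) = \<psi> (u @ (j + i, br j i y x) # v)"
        using split by (simp_all add: ab contract_letters_split)
      show ?thesis
        unfolding 1 2 3 E.scale_minus_right bracket_swap[OF E mult rel w''] by simp
    qed
    have "word_symmetrize sE ?K w = word_symmetrize sE (\<lambda>w. - ?K w) w"
      by (rule E.word_symmetrize_act[OF t]) (rule anti[OF perm])
    also have "\<dots> = - word_symmetrize sE ?K w"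
      using E.word_symmetrize_scale[of "-1" ?K w] by simp
    finally have "word_symmetrize sE ?K w + word_symmetrize sE ?K w = 0" by (simp add: eq_neg_iff_add_eq_0)
    then have "sE (1 + 1) (word_symmetrize sE ?K w) = 0"
      by (simp only: E.scale_left_distrib E.scale_one)
    then show ?thesis by (simp only: E.scale_eq_0_iff one_add_one) simp
  qed
  finally show ?thesis by simp
next
  case False
  then have "rewrite_at sE n \<psi> p f = f" by (auto simp: fun_eq_iff rewrite_at_outside)
  then show ?thesis by simp
qed

lemma rewrite_at_multilinear:
  assumes f: "multilinear_on s sE {w \<in> all_words V. length w = n} f"
  shows "multilinear_on s sE {w \<in> all_words V. length w = n} (rewrite_at sE n \<psi> p f)"
proof (cases "Suc p < n")
  case True
  note add = multilinear_on_add[OF f] multilinear_on_add[OF mult]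
  note scale = multilinear_on_scale[OF f] multilinear_on_scale[OF mult]
  let ?R = "rewrite_at sE n \<psi> p f"
  have Rs: "?R (u @ (i, x) # (j, y) # v) = sE (ksign i j) (f (u @ (j, y) # (i, x) # v)) + \<psi> (u @ (i + j, br i j x y) # v)"
    if "u \<in> all_words V" "x \<in> V i" "y \<in> V j" "v \<in> all_words V" "length u = p" "Suc (Suc (length u + length v)) = n"
    for u i x j y v
    using that by (intro rewrite_at_split) auto
  have main: "(x' \<in> V i \<longrightarrow> ?R (u @ (i, x + x') # v) = ?R (u @ (i, x) # v) + ?R (u @ (i, x') # v)) \<and>
      ?R (u @ (i, s c x) # v) = sE c (?R (u @ (i, x) # v))"
    if prems: "u \<in> all_words V" "v \<in> all_words V" "x \<in> V i" "Suc (length u + length v) = n" for u v i x x' c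
  proof -
    note sub = subspace_add[OF V_subspace] subspace_scale[OF V_subspace]
    consider (here) "length u = p" | (after) "length u = Suc p" | (left) "length u < p" | (right) "length u > Suc p"
      by linarith
    then show ?thesis
    proof cases
      case here
      then obtain j y v' where v: "v = (j, y) # v'" using prems True by (cases v) auto
      have y: "y \<in> V j" "v' \<in> all_words V" using that by (auto simp: v)
      have "f (u @ (j, y) # (i, x + x') # v') = f (u @ (j, y) # (i, x) # v') + f (u @ (j, y) # (i, x') # v')" if "x' \<in> V i"
        using add(1)[of "u @ [(j, y)]" i x v' x'] \<open>x \<in> V i\<close> that y \<open>u \<in> all_words V\<close> \<open>Suc (length u + length v) = n\<close> v by auto
      moreover have "f (u @ (j, y) # (i, s c x) # v') = sE c (f (u @ (j, y) # (i, x) # v'))"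
        using scale(1)[of "u @ [(j, y)]" i x v' c] that y v by auto
      moreover have "\<psi> (u @ (i + j, br i j (x + x') y) # v') = \<psi> (u @ (i + j, br i j x y) # v') + \<psi> (u @ (i + j, br i j x' y) # v')" if "x' \<in> V i"
        using add(2)[of u "i + j" "br i j x y" v' "br i j x' y"] \<open>x \<in> V i\<close> that y \<open>u \<in> all_words V\<close> \<open>Suc (length u + length v) = n\<close> v
        by (auto simp: br_add_left br_closed)
      moreover have "\<psi> (u @ (i + j, br i j (s c x) y) # v') = sE c (\<psi> (u @ (i + j, br i j x y) # v'))"
        using scale(2)[of u "i + j" "br i j x y" v' c] that y v by (auto simp: br_scale_left br_closed)
      ultimately show ?thesis
        using that y here by (simp add: v Rs sub E.scale_right_distrib mult.commute add_ac)
    next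
      case after
      then obtain u' j y where u: "u = u' @ [(j, y)]" "length u' = p" by (cases u rule: rev_cases) auto
      have y: "y \<in> V j" "u' \<in> all_words V" using that by (auto simp: u)
      have "f (u' @ (i, x + x') # (j, y) # v) = f (u' @ (i, x) # (j, y) # v) + f (u' @ (i, x') # (j, y) # v)" if "x' \<in> V i"
        using add(1)[of u' i x "(j, y) # v" x'] \<open>x \<in> V i\<close> that y \<open>v \<in> all_words V\<close> \<open>Suc (length u + length v) = n\<close> u by auto
      moreover have "f (u' @ (i, s c x) # (j, y) # v) = sE c (f (u' @ (i, x) # (j, y) # v))"
        using scale(1)[of u' i x "(j, y) # v" c] that y u by auto
      moreover have "\<psi> (u' @ (j + i, br j i y (x + x')) # v) = \<psi> (u' @ (j + i, br j i y x) # v) + \<psi> (u' @ (j + i, br j i y x') # v)" if "x' \<in> V i"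
        using add(2)[of u' "j + i" "br j i y x" v "br j i y x'"] \<open>x \<in> V i\<close> that y \<open>v \<in> all_words V\<close> \<open>Suc (length u + length v) = n\<close> u
        by (auto simp: br_add_right br_closed)
      moreover have "\<psi> (u' @ (j + i, br j i y (s c x)) # v) = sE c (\<psi> (u' @ (j + i, br j i y x) # v))"
        using scale(2)[of u' "j + i" "br j i y x" v c] that y u by (auto simp: br_scale_right br_closed)
      ultimately show ?thesis
        using that y u(2) by (simp add: u(1) Rs sub E.scale_right_distrib mult.commute add_ac)
    next
      case left
      then obtain v1 a b v2 where v: "v = v1 @ a # b # v2" "length v1 = p - Suc (length u)"
        using prems True split_adjacent[of "p - Suc (length u)" v] by (metis Suc_diff_Suc Suc_less_SucD add_less_cancel_left add_Suc_right le_add_diff_inverse less_imp_le_nat Suc_leI add_Suc)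
      obtain j y k z where ab: "a = (j, y)" "b = (k, z)" by fastforce
      have y: "y \<in> V j" "z \<in> V k" "v1 \<in> all_words V" "v2 \<in> all_words V" using that by (auto simp: v ab)
      have R: "?R (u @ (i, x) # v) = sE (ksign j k) (f (u @ (i, x) # v1 @ (k, z) # (j, y) # v2))
          + \<psi> (u @ (i, x) # v1 @ (j + k, br j k y z) # v2)" if "x \<in> V i" for x
        using Rs[of "u @ (i, x) # v1" y j z k v2] that y v left \<open>u \<in> all_words V\<close> \<open>Suc (length u + length v) = n\<close>
        by (auto simp: ab)
      have "f (u @ (i, x + x') # v1 @ (k, z) # (j, y) # v2) = f (u @ (i, x) # v1 @ (k, z) # (j, y) # v2) + f (u @ (i, x') # v1 @ (k, z) # (j, y) # v2)" if "x' \<in> V i"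
        using add(1)[of u i x "v1 @ (k, z) # (j, y) # v2" x'] \<open>x \<in> V i\<close> that y \<open>u \<in> all_words V\<close> \<open>Suc (length u + length v) = n\<close> v by auto
      moreover have "f (u @ (i, s c x) # v1 @ (k, z) # (j, y) # v2) = sE c (f (u @ (i, x) # v1 @ (k, z) # (j, y) # v2))"
        using scale(1)[of u i x "v1 @ (k, z) # (j, y) # v2" c] that y v by auto
      moreover have "\<psi> (u @ (i, x + x') # v1 @ (j + k, br j k y z) # v2) = \<psi> (u @ (i, x) # v1 @ (j + k, br j k y z) # v2) + \<psi> (u @ (i, x') # v1 @ (j + k, br j k y z) # v2)" if "x' \<in> V i"
        using add(2)[of u i x "v1 @ (j + k, br j k y z) # v2" x'] \<open>x \<in> V i\<close> that y \<open>u \<in> all_words V\<close> \<open>Suc (length u + length v) = n\<close> v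
        by (auto simp: br_closed)
      moreover have "\<psi> (u @ (i, s c x) # v1 @ (j + k, br j k y z) # v2) = sE c (\<psi> (u @ (i, x) # v1 @ (j + k, br j k y z) # v2))"
        using scale(2)[of u i x "v1 @ (j + k, br j k y z) # v2" c] that y v by (auto simp: br_closed)
      ultimately show ?thesis
        using that by (simp add: R sub E.scale_right_distrib mult.commute add_ac)
    next
      case right
      then obtain u1 a b u2 where u: "u = u1 @ a # b # u2" "length u1 = p"
        by (metis split_adjacent)
      obtain j y k z where ab: "a = (j, y)" "b = (k, z)" by fastforce
      have y: "y \<in> V j" "z \<in> V k" "u1 \<in> all_words V" "u2 \<in> all_words V" using that by (auto simp: u ab)
      have R: "?R (u @ (i, x) # v) = sE (ksign j k) (f ((u1 @ (k, z) # (j, y) # u2) @ (i, x) # v))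
          + \<psi> ((u1 @ (j + k, br j k y z) # u2) @ (i, x) # v)" if "x \<in> V i" for x
        using Rs[of u1 y j z k "u2 @ (i, x) # v"] that y u right \<open>v \<in> all_words V\<close> \<open>Suc (length u + length v) = n\<close>
        by (auto simp: ab)
      let ?u = "u1 @ (k, z) # (j, y) # u2" and ?u' = "u1 @ (j + k, br j k y z) # u2"
      have "f (?u @ (i, x + x') # v) = f (?u @ (i, x) # v) + f (?u @ (i, x') # v)" if "x' \<in> V i"
        using add(1)[of ?u i x v x'] \<open>x \<in> V i\<close> that y \<open>v \<in> all_words V\<close> \<open>Suc (length u + length v) = n\<close> u by auto
      moreover have "f (?u @ (i, s c x) # v) = sE c (f (?u @ (i, x) # v))"
        using scale(1)[of ?u i x v c] that y u by auto
      moreover have "\<psi> (?u' @ (i, x + x') # v) = \<psi> (?u' @ (i, x) # v) + \<psi> (?u' @ (i, x') # v)" if "x' \<in> V i"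
        using add(2)[of ?u' i x v x'] \<open>x \<in> V i\<close> that y \<open>v \<in> all_words V\<close> \<open>Suc (length u + length v) = n\<close> u
        by (auto simp: br_closed)
      moreover have "\<psi> (?u' @ (i, s c x) # v) = sE c (\<psi> (?u' @ (i, x) # v))"
        using scale(2)[of ?u' i x v c] that y u by (auto simp: br_closed)
      ultimately show ?thesis
        using that by (simp add: R sub E.scale_right_distrib mult.commute add_ac)
    qed
  qed
  then show ?thesis unfolding multilinear_on_def by auto
next
  case False
  then have "rewrite_at sE n \<psi> p f = f" by (auto simp: fun_eq_iff rewrite_at_outside)
  then show ?thesis using f by simp
qed

text \<open>
  Both multilinearity and the prescribed symmetrization survive the operators and their means, so they form the
  invariant set in which the common fixed point is found.
\<close>

lemma enveloping_form_extend:
  assumes \<phi>: "multilinear_on s sE {w \<in> all_words V. length w = n} \<phi>"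
  shows "\<exists>f. multilinear_on s sE {w \<in> all_words V. length w = n} f \<and>
    (\<forall>w \<in> all_words V. length w = n \<longrightarrow> word_symmetrize sE f w = word_symmetrize sE \<phi> w) \<and>
    (\<forall>p. Suc p < n \<longrightarrow> rewrite_at sE n \<psi> p f = f)"
proof -
  let ?W = "{w \<in> all_words V. length w = n}"
  define C where "C = {f. multilinear_on s sE ?W f \<and> (\<forall>w \<in> ?W. word_symmetrize sE f w = word_symmetrize sE \<phi> w)}"
  define M where "M N g = (\<lambda>w. sE (inverse (of_nat N)) (\<Sum>j<N. g j w))"
    for N and g :: "nat \<Rightarrow> ('d, 'v) word \<Rightarrow> 'e"
  have const: "sE (inverse (of_nat N)) (\<Sum>j<N. x) = x" if "0 < N" for N :: nat and x
  proof -
    have "(\<Sum>j<N. x) = sE (of_nat N) x" using E.sum_constant_scale[of x "{..<N}"] by simp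
    then show ?thesis using that by simp
  qed
  have "\<exists>f\<in>C. \<forall>p<n - 1. rewrite_at sE n \<psi> p f = f"
  proof (rule coxeter_fixed_point[where M = M and A = "rewrite_at sE n \<psi>"])
    show "\<phi> \<in> C" using \<phi> by (simp add: C_def)
    show "rewrite_at sE n \<psi> p f \<in> C" if "f \<in> C" for p f
      using that by (simp add: C_def rewrite_at_multilinear rewrite_at_symmetrize)
    show "M N g \<in> C" if N: "0 < N" and g: "\<And>j. j < N \<Longrightarrow> g j \<in> C" for N g
    proof -
      have mul: "multilinear_on s sE ?W (g j)" if "j < N" for j using g[OF that] by (simp add: C_def)
      have "multilinear_on s sE ?W (M N g)"
        unfolding multilinear_on_def M_def
      proof (intro conjI allI impI)
        fix u v i x y assume *: "u @ (i, x) # v \<in> ?W" "u @ (i, y) # v \<in> ?W"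
        have "(\<Sum>j<N. g j (u @ (i, x + y) # v)) = (\<Sum>j<N. g j (u @ (i, x) # v) + g j (u @ (i, y) # v))"
          by (intro sum.cong refl multilinear_on_add[OF mul] *) simp
        then show "sE (inverse (of_nat N)) (\<Sum>j<N. g j (u @ (i, x + y) # v)) =
            sE (inverse (of_nat N)) (\<Sum>j<N. g j (u @ (i, x) # v)) + sE (inverse (of_nat N)) (\<Sum>j<N. g j (u @ (i, y) # v))"
          by (simp only: sum.distrib E.scale_right_distrib)
      next
        fix u v i x c assume *: "u @ (i, x) # v \<in> ?W"
        have "(\<Sum>j<N. g j (u @ (i, s c x) # v)) = (\<Sum>j<N. sE c (g j (u @ (i, x) # v)))"
          by (intro sum.cong refl multilinear_on_scale[OF mul] *) simp
        then show "sE (inverse (of_nat N)) (\<Sum>j<N. g j (u @ (i, s c x) # v)) =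
            sE c (sE (inverse (of_nat N)) (\<Sum>j<N. g j (u @ (i, x) # v)))"
          by (simp only: E.scale_sum_right[symmetric] E.scale_left_commute[of c])
      qed
      moreover have "word_symmetrize sE (M N g) w = word_symmetrize sE \<phi> w" if "w \<in> ?W" for w
      proof -
        have "word_symmetrize sE (M N g) w = sE (inverse (of_nat N)) (\<Sum>j<N. word_symmetrize sE (g j) w)"
          unfolding M_def E.word_symmetrize_scale E.word_symmetrize_sum ..
        also have "(\<Sum>j<N. word_symmetrize sE (g j) w) = (\<Sum>j<N. word_symmetrize sE \<phi> w)"
          using g that by (intro sum.cong) (auto simp: C_def)
        finally show ?thesis by (simp only: const[OF N])
      qed
      ultimately show ?thesis by (simp add: C_def)
    qed
    show "M N g = M N h" if "\<pi> permutes {..<N}" "\<And>j. j < N \<Longrightarrow> g j = h (\<pi> j)" for N g h \<pi>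
    proof
      fix w
      have "(\<Sum>j<N. g j w) = (\<Sum>j<N. h (\<pi> j) w)" using that(2) by simp
      also have "\<dots> = (\<Sum>j<N. h j w)"
        by (rule sum.permute[OF that(1), symmetric, unfolded comp_def])
      finally show "M N g w = M N h w" by (simp add: M_def)
    qed
    show "rewrite_at sE n \<psi> p (M N g) = M N (\<lambda>j. rewrite_at sE n \<psi> p (g j))" if N: "0 < N" for p N g
    proof
      fix w
      show "rewrite_at sE n \<psi> p (M N g) w = M N (\<lambda>j. rewrite_at sE n \<psi> p (g j)) w"
      proof (cases "w \<in> all_words V \<and> length w = n \<and> Suc p < n")
        case True
        let ?e = "ksign (fst (w ! p)) (fst (w ! Suc p)) :: 'k" and ?K = "\<psi> (contract_letters br p w)"
        have "M N (\<lambda>j. rewrite_at sE n \<psi> p (g j)) w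
            = sE (inverse (of_nat N)) (\<Sum>j<N. sE ?e (g j (swap_letters p w)) + ?K)"
          using True by (simp add: M_def rewrite_at_def)
        also have "\<dots> = sE ?e (sE (inverse (of_nat N)) (\<Sum>j<N. g j (swap_letters p w))) + ?K"
          unfolding sum.distrib E.scale_right_distrib const[OF N] E.scale_sum_right[symmetric]
          by (simp only: E.scale_left_commute)
        also have "\<dots> = rewrite_at sE n \<psi> p (M N g) w"
          using True by (simp add: M_def rewrite_at_def)
        finally show ?thesis by simp
      next
        case False
        show ?thesis unfolding M_def rewrite_at_outside[OF False] ..
      qed
    qed
    show "rewrite_at sE n \<psi> p (rewrite_at sE n \<psi> p f) = f" for p f
      by (rule rewrite_at_involution[OF E mult rel])
    show "rewrite_at sE n \<psi> i (rewrite_at sE n \<psi> j f) = rewrite_at sE n \<psi> j (rewrite_at sE n \<psi> i f)"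
      if "i + 2 \<le> j" for i j f
      by (rule rewrite_at_commute[OF E mult rel that])
    show "rewrite_at sE n \<psi> p (rewrite_at sE n \<psi> (Suc p) (rewrite_at sE n \<psi> p f)) =
        rewrite_at sE n \<psi> (Suc p) (rewrite_at sE n \<psi> p (rewrite_at sE n \<psi> (Suc p) f))"
      if "Suc p < n - 1" for p f
      using that by (intro rewrite_at_braid[OF E mult rel]) auto
  qed
  then show ?thesis by (auto simp: C_def)
qed

end

text \<open>
  The dual form of the Poincare--Birkhoff--Witt theorem: functionals on the enveloping algebra correspond to
  functionals on symmetric tensors.
\<close>

theorem enveloping_form_exists:
  fixes sE :: "'k \<Rightarrow> 'e::ab_group_add \<Rightarrow> 'e"
  assumes E: "vector_space sE" and \<phi>: "multilinear_on s sE (all_words V) \<phi>"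
  shows "\<exists>\<psi>. multilinear_on s sE (all_words V) \<psi> \<and> enveloping_relation sE br (all_words V) \<psi> \<and>
    (\<forall>w \<in> all_words V. word_symmetrize sE \<psi> w = word_symmetrize sE \<phi> w)"
proof -
  let ?W = "\<lambda>n. {w \<in> all_words V. length w < n}"
  define P where "P n \<psi> \<longleftrightarrow> multilinear_on s sE (?W n) \<psi> \<and> enveloping_relation sE br (?W n) \<psi> \<and>
    (\<forall>w \<in> ?W n. word_symmetrize sE \<psi> w = word_symmetrize sE \<phi> w)" for n \<psi>
  have zero: "P 0 \<phi>" by (simp add: P_def multilinear_on_def enveloping_relation_def)
  have step: "\<exists>\<psi>'. P (Suc n) \<psi>' \<and> (\<forall>w. length w < n \<longrightarrow> \<psi>' w = \<psi> w)" if "P n \<psi>" for n \<psi>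
  proof -
    have mult: "multilinear_on s sE (?W n) \<psi>" and rel: "enveloping_relation sE br (?W n) \<psi>"
      and sym: "w \<in> ?W n \<Longrightarrow> word_symmetrize sE \<psi> w = word_symmetrize sE \<phi> w" for w
      using that by (auto simp: P_def)
    have "multilinear_on s sE {w \<in> all_words V. length w = n} \<phi>"
      using \<phi> unfolding multilinear_on_def by blast
    from enveloping_form_extend[OF E mult rel this] obtain f where f: "multilinear_on s sE {w \<in> all_words V. length w = n} f"
      "\<And>w. w \<in> all_words V \<Longrightarrow> length w = n \<Longrightarrow> word_symmetrize sE f w = word_symmetrize sE \<phi> w"
      "\<And>p. Suc p < n \<Longrightarrow> rewrite_at sE n \<psi> p f = f"
      by blast
    define \<psi>' where "\<psi>' w = (if length w = n then f w else \<psi> w)" for w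
    have "multilinear_on s sE (?W (Suc n)) \<psi>'"
      unfolding multilinear_on_def
    proof (intro conjI allI impI)
      fix u v i x y assume *: "u @ (i, x) # v \<in> ?W (Suc n)" "u @ (i, y) # v \<in> ?W (Suc n)"
      show "\<psi>' (u @ (i, x + y) # v) = \<psi>' (u @ (i, x) # v) + \<psi>' (u @ (i, y) # v)"
      proof (cases "length (u @ (i, x) # v) = n")
        case True
        then show ?thesis using * multilinear_on_add[OF f(1), of u i x v y] by (simp add: \<psi>'_def)
      next
        case False
        then show ?thesis using * multilinear_on_add[OF mult, of u i x v y] by (simp add: \<psi>'_def)
      qed
    next
      fix u v i x c assume *: "u @ (i, x) # v \<in> ?W (Suc n)"
      show "\<psi>' (u @ (i, s c x) # v) = sE c (\<psi>' (u @ (i, x) # v))"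
      proof (cases "length (u @ (i, x) # v) = n")
        case True
        then show ?thesis using * multilinear_on_scale[OF f(1), of u i x v c] by (simp add: \<psi>'_def)
      next
        case False
        then show ?thesis using * multilinear_on_scale[OF mult, of u i x v c] by (simp add: \<psi>'_def)
      qed
    qed
    moreover have "enveloping_relation sE br (?W (Suc n)) \<psi>'"
      unfolding enveloping_relation_def
    proof (intro allI impI)
      fix u i x j y v assume *: "u @ (i, x) # (j, y) # v \<in> ?W (Suc n)"
      show "\<psi>' (u @ (i, x) # (j, y) # v) = sE (ksign i j) (\<psi>' (u @ (j, y) # (i, x) # v)) + \<psi>' (u @ (i + j, br i j x y) # v)"
      proof (cases "length (u @ (i, x) # (j, y) # v) = n")
        case True
        have "f (u @ (i, x) # (j, y) # v) = rewrite_at sE n \<psi> (length u) f (u @ (i, x) # (j, y) # v)"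
          using f(3)[of "length u"] True by simp
        also have "\<dots> = sE (ksign i j) (f (u @ (j, y) # (i, x) # v)) + \<psi> (u @ (i + j, br i j x y) # v)"
          using * True by (intro rewrite_at_split) auto
        finally show ?thesis using True by (auto simp: \<psi>'_def)
      next
        case False
        then have "u @ (i, x) # (j, y) # v \<in> ?W n" using * by simp
        from enveloping_relationD[OF rel this] show ?thesis using * False by (simp add: \<psi>'_def)
      qed
    qed
    moreover have "word_symmetrize sE \<psi>' w = word_symmetrize sE \<phi> w" if w: "w \<in> ?W (Suc n)" for w
    proof (cases "length w = n")
      case True
      then have "word_symmetrize sE \<psi>' w = word_symmetrize sE f w"
        by (simp add: word_symmetrize_def \<psi>'_def)
      then show ?thesis using f(2) w True by simp
    next
      case False
      then have "word_symmetrize sE \<psi>' w = word_symmetrize sE \<psi> w"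
        by (simp add: word_symmetrize_def \<psi>'_def)
      then show ?thesis using sym w False by simp
    qed
    ultimately have "P (Suc n) \<psi>'" by (simp add: P_def)
    then show ?thesis by (intro exI[of _ \<psi>']) (simp add: \<psi>'_def)
  qed
  have "\<exists>\<Psi>. \<forall>n. P n (\<Psi> n) \<and> (\<forall>w. length w < n \<longrightarrow> \<Psi> (Suc n) w = \<Psi> n w)"
  proof (rule dependent_nat_choice)
    show "\<exists>\<psi>. P 0 \<psi>" using zero by auto
  qed (rule step)
  then obtain \<Psi> where "\<forall>n. P n (\<Psi> n) \<and> (\<forall>w. length w < n \<longrightarrow> \<Psi> (Suc n) w = \<Psi> n w)" ..
  then have \<Psi>: "\<And>n. P n (\<Psi> n)" "\<And>n w. length w < n \<Longrightarrow> \<Psi> (Suc n) w = \<Psi> n w"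
    by simp_all
  \<comment> \<open>The functions \<open>\<Psi> n\<close> are correct below length \<open>n\<close>, where all later ones agree with them.\<close>
  define \<psi> where "\<psi> w = \<Psi> (Suc (length w)) w" for w
  have \<psi>: "\<psi> w = \<Psi> n w" if "length w < n" for n w
    using Suc_leI[OF that] by (induction rule: dec_induct) (simp_all add: \<psi>_def \<Psi>(2))
  have mult: "multilinear_on s sE (?W n) \<psi>" for n
    using \<Psi>(1)[of n] by (simp add: P_def multilinear_on_def \<psi>[of _ n])
  have rel: "enveloping_relation sE br (?W n) \<psi>" for n
    unfolding enveloping_relation_def
  proof (intro allI impI)
    fix u i x j y v assume w: "u @ (i, x) # (j, y) # v \<in> ?W n"
    from \<Psi>(1)[of n] have "enveloping_relation sE br (?W n) (\<Psi> n)" by (simp add: P_def)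
    from enveloping_relationD[OF this w]
    show "\<psi> (u @ (i, x) # (j, y) # v) =
        sE (ksign i j) (\<psi> (u @ (j, y) # (i, x) # v)) + \<psi> (u @ (i + j, br i j x y) # v)"
      using w by (simp add: \<psi>[of _ n])
  qed
  have "multilinear_on s sE (all_words V) \<psi>"
    unfolding multilinear_on_def
  proof (intro conjI allI impI)
    fix u v i x y assume "u @ (i, x) # v \<in> all_words V" "u @ (i, y) # v \<in> all_words V"
    then show "\<psi> (u @ (i, x + y) # v) = \<psi> (u @ (i, x) # v) + \<psi> (u @ (i, y) # v)"
      by (intro multilinear_on_add[OF mult[of "Suc (length (u @ (i, x) # v))"]]) simp_all
  next
    fix u v i x c assume "u @ (i, x) # v \<in> all_words V"
    then show "\<psi> (u @ (i, s c x) # v) = sE c (\<psi> (u @ (i, x) # v))"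
      by (intro multilinear_on_scale[OF mult[of "Suc (length (u @ (i, x) # v))"]]) simp_all
  qed
  moreover have "enveloping_relation sE br (all_words V) \<psi>"
    unfolding enveloping_relation_def
  proof (intro allI impI)
    fix u i x j y v assume "u @ (i, x) # (j, y) # v \<in> all_words V"
    then show "\<psi> (u @ (i, x) # (j, y) # v) =
        sE (ksign i j) (\<psi> (u @ (j, y) # (i, x) # v)) + \<psi> (u @ (i + j, br i j x y) # v)"
      by (intro enveloping_relationD[OF rel[of "Suc (length (u @ (i, x) # (j, y) # v))"]]) simp
  qed
  moreover have "word_symmetrize sE \<psi> w = word_symmetrize sE \<phi> w" if "w \<in> all_words V" for w
  proof -
    have "word_symmetrize sE \<psi> w = word_symmetrize sE (\<Psi> (Suc (length w))) w"
      by (simp add: word_symmetrize_def \<psi>_def)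
    then show ?thesis using \<Psi>(1)[of "Suc (length w)"] that by (simp add: P_def)
  qed
  ultimately show ?thesis by blast
qed

lemma lie_monomial_closed: "lie_monomial V br n i x \<Longrightarrow> x \<in> V i"
  by (induction rule: lie_monomial.induct) (auto intro: br_closed)

lemma multilinear_on_zero_letter:
  fixes sE :: "'k \<Rightarrow> 'e::ab_group_add \<Rightarrow> 'e"
  assumes E: "vector_space sE" and \<phi>: "multilinear_on s sE (all_words V) \<phi>"
    and w: "w \<in> all_words V" "(i, 0) \<in> set w"
  shows "\<phi> w = 0"
proof -
  interpret E: vector_space sE by fact
  obtain u v where uv: "w = u @ (i, 0) # v" using w(2) by (meson split_list)
  then show ?thesis
    using multilinear_on_scale[OF \<phi>, of u i 0 v 0] w by simp
qed

lemma enveloping_form_unique: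
  fixes sE :: "'k \<Rightarrow> 'e::ab_group_add \<Rightarrow> 'e"
  assumes E: "vector_space sE"
    and rel: "enveloping_relation sE br (all_words V) \<psi>" "enveloping_relation sE br (all_words V) \<psi>'"
    and sym: "\<And>w. w \<in> all_words V \<Longrightarrow> word_symmetrize sE \<psi> w = word_symmetrize sE \<psi>' w"
    and w: "w \<in> all_words V"
  shows "\<psi> w = \<psi>' w"
proof -
  interpret E: vector_space sE by fact
  have "\<psi> w + sE (-1) (\<psi>' w) \<in> {0}"
  proof (rule enveloping_form_in_subspace[where \<psi> = "\<lambda>w. \<psi> w + sE (-1) (\<psi>' w)" and D = "all_words V" and br = br, OF E])
    show "E.subspace {0}" by simp
    fix u i x j y v assume *: "u @ (i, x) # (j, y) # v \<in> all_words V"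
    then show "u @ (j, y) # (i, x) # v \<in> all_words V" "u @ (i + j, br i j x y) # v \<in> all_words V"
      by (auto intro: br_closed)
    show "\<psi> (u @ (i, x) # (j, y) # v) + sE (- 1) (\<psi>' (u @ (i, x) # (j, y) # v)) -
       (sE (ksign i j) (\<psi> (u @ (j, y) # (i, x) # v) + sE (- 1) (\<psi>' (u @ (j, y) # (i, x) # v))) +
        (\<psi> (u @ (i + j, br i j x y) # v) + sE (- 1) (\<psi>' (u @ (i + j, br i j x y) # v)))) \<in> {0}"
      unfolding enveloping_relationD[OF rel(1) *] enveloping_relationD[OF rel(2) *]
      by (simp add: E.scale_right_diff_distrib)
  next
    show "word_symmetrize sE (\<lambda>w. \<psi> w + sE (- 1) (\<psi>' w)) w \<in> {0}" if "w \<in> all_words V" for w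
      using sym[OF that] by (simp only: E.word_symmetrize_add E.word_symmetrize_scale) simp
  qed (rule w)
  then show ?thesis by simp
qed

text \<open>
  Weight a letter by its degree as an iterated bracket. The relation never changes the total weight of a word. In a word of total
  weight above \<open>m p\<close>, where brackets of degree \<open>p\<close> vanish, either there are more than \<open>m\<close> letters and \<open>\<phi>\<close> is zero, or
  some letter is zero. Hence the symmetrizations of \<open>\<phi>\<close> and \<open>\<psi>\<close> are zero on such words, and therefore \<open>\<psi>\<close> is zero on them.
\<close>

lemma enveloping_form_vanishes:
  fixes sE :: "'k \<Rightarrow> 'e::ab_group_add \<Rightarrow> 'e"
  assumes nil: "nilpotent_lie V br" and E: "vector_space sE"
    and \<phi>: "multilinear_on s sE (all_words V) \<phi>"
    and bounded: "\<And>w. w \<in> all_words V \<Longrightarrow> m < length w \<Longrightarrow> \<phi> w = 0"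
    and rel: "enveloping_relation sE br (all_words V) \<psi>"
    and sym: "\<And>w. w \<in> all_words V \<Longrightarrow> word_symmetrize sE \<psi> w = word_symmetrize sE \<phi> w"
  shows "\<exists>N. \<forall>w \<in> all_words V. N \<le> length w \<longrightarrow> \<psi> w = 0"
proof -
  interpret E: vector_space sE by fact
  obtain p where p: "\<And>n i x. p \<le> n \<Longrightarrow> lie_monomial V br n i x \<Longrightarrow> x = 0"
    using nil unfolding nilpotent_lie_def by blast
  let ?mon = "\<lambda>(i, x) k. lie_monomial V br k i x"
  define D where "D N = {w. \<exists>ks. list_all2 ?mon w ks \<and> sum_list ks = N}" for N
  have D_words: "D N \<subseteq> all_words V" for N
  proof
    fix w assume "w \<in> D N"
    then obtain ks where ks: "list_all2 ?mon w ks" by (auto simp: D_def)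
    then show "w \<in> all_words V"
      by (induction rule: list_all2_induct) (auto dest: lie_monomial_closed)
  qed
  have "\<psi> w \<in> {0}" if "m * p < N" "w \<in> D N" for N w
  proof (rule enveloping_form_in_subspace[where D = "D N" and br = br, OF E])
    show "E.subspace {0}" by simp
    fix u i x j y v assume *: "u @ (i, x) # (j, y) # v \<in> D N"
    then obtain ku k l kv where ks: "list_all2 ?mon u ku" "lie_monomial V br k i x" "lie_monomial V br l j y"
      "list_all2 ?mon v kv" "sum_list ku + (k + (l + sum_list kv)) = N"
      by (auto simp: D_def list_all2_append1 list_all2_Cons1)
    have "list_all2 ?mon (u @ (j, y) # (i, x) # v) (ku @ l # k # kv)"
      using ks by (auto intro!: list_all2_appendI)
    moreover have "sum_list (ku @ l # k # kv) = N" using ks by simp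
    ultimately show "u @ (j, y) # (i, x) # v \<in> D N" unfolding D_def by blast
    have "list_all2 ?mon (u @ (i + j, br i j x y) # v) (ku @ (k + l) # kv)"
      using ks by (auto intro!: list_all2_appendI lie_monomial.intros)
    moreover have "sum_list (ku @ (k + l) # kv) = N" using ks by simp
    ultimately show "u @ (i + j, br i j x y) # v \<in> D N" unfolding D_def by blast
    have "u @ (i, x) # (j, y) # v \<in> all_words V" using * D_words by blast
    from enveloping_relationD[OF rel this]
    show "\<psi> (u @ (i, x) # (j, y) # v) -
       (sE (ksign i j) (\<psi> (u @ (j, y) # (i, x) # v)) + \<psi> (u @ (i + j, br i j x y) # v)) \<in> {0}" by simp
  next
    fix w assume w: "w \<in> D N"
    then have ww: "w \<in> all_words V" using D_words by blast
    have "\<phi> (permute_list (inv \<sigma>) w) = 0" if \<sigma>: "\<sigma> permutes {..<length w}" for \<sigma>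
    proof (cases "m < length w")
      case True
      then show ?thesis using bounded all_words_permute_list[OF permutes_inv[OF \<sigma>] ww] by simp
    next
      case False
      obtain ks where ks: "list_all2 ?mon w ks" "sum_list ks = N" using w by (auto simp: D_def)
      have "\<exists>k\<in>set ks. p \<le> k"
      proof (rule ccontr)
        assume "\<not> ?thesis"
        then have "sum_list ks \<le> length ks * p"
          by (induction ks) (auto simp: not_le)
        also have "\<dots> \<le> m * p" using False list_all2_lengthD[OF ks(1)] by simp
        finally show False using ks(2) that(1) \<open>m * p < N\<close> by simp
      qed
      then obtain q where q: "q < length ks" "p \<le> ks ! q" by (auto simp: in_set_conv_nth)
      obtain i x where ix: "w ! q = (i, x)" by fastforce
      have "lie_monomial V br (ks ! q) i x" using list_all2_nthD2[OF ks(1) q(1)] ix by simp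
      then have "x = 0" using p q by blast
      then have "(i, 0) \<in> set w" using ix q list_all2_lengthD[OF ks(1)] by (metis nth_mem)
      then have "(i, 0) \<in> set (permute_list (inv \<sigma>) w)"
        using permutes_inv[OF \<sigma>] by simp
      then show ?thesis
        using multilinear_on_zero_letter[OF E \<phi> all_words_permute_list[OF permutes_inv[OF \<sigma>] ww]] by blast
    qed
    then have "word_symmetrize sE \<phi> w = 0" by (simp add: word_symmetrize_def)
    then show "word_symmetrize sE \<psi> w \<in> {0}" using sym[OF ww] by simp
  qed (rule that(2))
  moreover have "w \<in> D (length w)" if "w \<in> all_words V" for w
  proof -
    \<comment> \<open>Every letter is an iterated bracket of degree 1, so the length of a word is a possible total weight.\<close>
    have "list_all2 ?mon w (replicate (length w) 1)"
      using that by (induction w) (auto intro!: lie_monomial.intros(1)[of _ V, unfolded One_nat_def])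
    then show ?thesis unfolding D_def by (intro CollectI exI[of _ "replicate (length w) 1"]) (simp add: sum_list_replicate)
  qed
  ultimately show ?thesis by (intro exI[of _ "Suc (m * p)"]) (simp add: Suc_le_eq)
qed

end

section \<open>Tensors as functionals on multilinear forms\<close>

lemma sum_fun_apply: "(\<Sum>a\<in>A. f a) x = (\<Sum>a\<in>A. f a x)"
  by (induction A rule: infinite_finite_induct) auto

interpretation tensor: vector_space "tensor_scale :: 'k::field \<Rightarrow> ('d, 'v, 'k) tensor \<Rightarrow> ('d, 'v, 'k) tensor"
  by (intro vector_space_pscale vector_space_mult)

lemma multilinear_form_combination:
  assumes "\<And>j. j \<in> J \<Longrightarrow> multilinear_form s W (f j)"
  shows "multilinear_form s W (\<lambda>w. \<Sum>j\<in>J. c j * f j w)"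
  unfolding multilinear_on_def
proof (intro conjI allI impI)
  fix u v i x y assume w: "u @ (i, x) # v \<in> W" "u @ (i, y) # v \<in> W"
  have "(\<Sum>j\<in>J. c j * f j (u @ (i, x + y) # v)) = (\<Sum>j\<in>J. c j * f j (u @ (i, x) # v) + c j * f j (u @ (i, y) # v))"
    by (intro sum.cong refl) (simp add: multilinear_on_add[OF assms w] distrib_left)
  then show "(\<Sum>j\<in>J. c j * f j (u @ (i, x + y) # v)) = (\<Sum>j\<in>J. c j * f j (u @ (i, x) # v)) + (\<Sum>j\<in>J. c j * f j (u @ (i, y) # v))"
    by (simp only: sum.distrib)
next
  fix u v i x a assume w: "u @ (i, x) # v \<in> W"
  have "(\<Sum>j\<in>J. c j * f j (u @ (i, s a x) # v)) = (\<Sum>j\<in>J. a * (c j * f j (u @ (i, x) # v)))"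
    by (intro sum.cong refl) (simp add: multilinear_on_scale[OF assms w] mult_ac)
  then show "(\<Sum>j\<in>J. c j * f j (u @ (i, s a x) # v)) = a * (\<Sum>j\<in>J. c j * f j (u @ (i, x) # v))"
    by (simp only: sum_distrib_left)
qed

lemma multilinear_form_zero [simp]: "multilinear_form s W (\<lambda>w. 0)"
  by (simp add: multilinear_on_def)

lemma pure_tensor_combination_apply:
  "(\<Sum>w\<in>A. tensor_scale (c w) (pure_tensor s W w)) \<phi> = (if multilinear_form s W \<phi> then \<Sum>w\<in>A. c w * \<phi> w else 0)"
  by (simp add: sum_fun_apply pscale_def pure_tensor_def)

lemma tensor_span_combination:
  assumes "t \<in> tensor.span (pure_tensor s W ` B)"
  obtains A c where "finite A" "A \<subseteq> B" "t = (\<Sum>w\<in>A. tensor_scale (c w) (pure_tensor s W w))"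
proof -
  from assms obtain T r where T: "finite T" "T \<subseteq> pure_tensor s W ` B" "t = (\<Sum>a\<in>T. tensor_scale (r a) a)"
    unfolding tensor.span_explicit by auto
  define g where "g = inv_into B (pure_tensor s W)"
  have g: "g a \<in> B" "pure_tensor s W (g a) = a" if "a \<in> T" for a
    using that T(2) unfolding g_def by (auto intro: inv_into_into f_inv_into_f)
  have "inj_on g T" by (rule inj_on_inverseI[of _ "pure_tensor s W"]) (rule g)
  then have "t = (\<Sum>w\<in>g ` T. tensor_scale (r (pure_tensor s W w)) (pure_tensor s W w))"
    unfolding T(3) by (simp add: sum.reindex g)
  with T(1) g(1) show thesis by (intro that[of "g ` T" "\<lambda>w. r (pure_tensor s W w)"]) auto
qed

text \<open>
  Tensors are used through this representation: on multilinear forms, a tensor is a finite combination of evaluations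
  at words, and it is zero elsewhere.
\<close>

lemma tensor_span_apply:
  assumes "t \<in> tensor.span (pure_tensor s W ` B)"
  obtains A c where "finite A" "A \<subseteq> B" "\<And>\<phi>. multilinear_form s W \<phi> \<Longrightarrow> t \<phi> = (\<Sum>w\<in>A. c w * \<phi> w)"
    "\<And>\<phi>. \<not> multilinear_form s W \<phi> \<Longrightarrow> t \<phi> = 0"
proof -
  obtain A c where "finite A" "A \<subseteq> B" "t = (\<Sum>w\<in>A. tensor_scale (c w) (pure_tensor s W w))"
    using assms by (rule tensor_span_combination)
  then show thesis
    by (intro that[of A c]) (auto simp: pure_tensor_combination_apply)
qed

lemma tensor_zero_form:
  "t \<in> tensor.span (pure_tensor s W ` B) \<Longrightarrow> t (\<lambda>w. 0) = 0"
  by (erule tensor_span_apply) simp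

lemma tensor_not_multilinear:
  "t \<in> tensor.span (pure_tensor s W ` B) \<Longrightarrow> \<not> multilinear_form s W \<phi> \<Longrightarrow> t \<phi> = 0"
  by (erule tensor_span_apply) simp

lemma tensor_form_cong:
  assumes "t \<in> tensor.span (pure_tensor s W ` B)" "multilinear_form s W \<phi>" "multilinear_form s W \<phi>'"
    and "\<And>w. w \<in> B \<Longrightarrow> \<phi> w = \<phi>' w"
  shows "t \<phi> = t \<phi>'"
  using assms(1)
proof (rule tensor_span_apply)
  fix A c assume *: "A \<subseteq> B" "\<And>\<phi>. multilinear_form s W \<phi> \<Longrightarrow> t \<phi> = (\<Sum>w\<in>A. c w * \<phi> w)"
  show ?thesis
    unfolding *(2)[OF assms(2)] *(2)[OF assms(3)] using *(1) assms(4) by (intro sum.cong refl) auto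
qed

lemma tensor_form_combination:
  assumes t: "t \<in> tensor.span (pure_tensor s W ` B)" and f: "\<And>j. j \<in> J \<Longrightarrow> multilinear_form s W (f j)"
  shows "t (\<lambda>w. \<Sum>j\<in>J. c j * f j w) = (\<Sum>j\<in>J. c j * t (f j))"
  using t
proof (rule tensor_span_apply)
  fix A a assume *: "A \<subseteq> B" "\<And>\<phi>. multilinear_form s W \<phi> \<Longrightarrow> t \<phi> = (\<Sum>w\<in>A. a w * \<phi> w)"
  have "t (\<lambda>w. \<Sum>j\<in>J. c j * f j w) = (\<Sum>w\<in>A. a w * (\<Sum>j\<in>J. c j * f j w))"
    by (rule *(2)[OF multilinear_form_combination[OF f]])
  also have "\<dots> = (\<Sum>j\<in>J. c j * (\<Sum>w\<in>A. a w * f j w))"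
    by (simp add: sum_distrib_left sum.swap[of _ J] mult_ac)
  also have "\<dots> = (\<Sum>j\<in>J. c j * t (f j))"
    by (intro sum.cong refl) (simp add: *(2)[OF f])
  finally show ?thesis .
qed

text \<open>
  The function \<open>\<lambda>\<phi>. t (\<lambda>w. \<Psi> w \<phi>)\<close> is the value at \<open>t\<close> of the linear extension of \<open>\<Psi>\<close>: on a pure tensor it is \<open>\<Psi> w\<close>.
\<close>

lemma tensor_bind_in_subspace:
  fixes \<Psi> :: "('d, 'u::plus) word \<Rightarrow> ('d, 'v, 'k::field) tensor"
  assumes t: "t \<in> tensor.span (pure_tensor s W ` B)" and \<Psi>: "\<And>\<phi>. multilinear_form s W (\<lambda>w. \<Psi> w \<phi>)"
    and U: "tensor.subspace U" "\<And>w. w \<in> B \<Longrightarrow> \<Psi> w \<in> U"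
  shows "(\<lambda>\<phi>. t (\<lambda>w. \<Psi> w \<phi>)) \<in> U"
  using t
proof (rule tensor_span_apply)
  fix A c assume *: "A \<subseteq> B" "\<And>\<phi>. multilinear_form s W \<phi> \<Longrightarrow> t \<phi> = (\<Sum>w\<in>A. c w * \<phi> w)"
  have "(\<lambda>\<phi>. t (\<lambda>w. \<Psi> w \<phi>)) = (\<Sum>w\<in>A. tensor_scale (c w) (\<Psi> w))"
    by (rule ext) (simp add: *(2)[OF \<Psi>] sum_fun_apply pscale_def)
  also have "\<dots> \<in> U"
    using * U by (intro tensor.subspace_sum tensor.subspace_scale) auto
  finally show ?thesis .
qed

lemma dual_map_in_span:
  assumes t: "t \<in> tensor.span (pure_tensor s W ` B)"
    and F: "\<And>\<phi>. multilinear_form s' W' \<phi> \<Longrightarrow> multilinear_form s W (F \<phi>)"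
    and B': "\<And>w. w \<in> B \<Longrightarrow> \<exists>c. \<exists>w'\<in>B'. \<forall>\<phi>. multilinear_form s' W' \<phi> \<longrightarrow> F \<phi> w = c * \<phi> w'"
  shows "dual_map s' W' F t \<in> tensor.span (pure_tensor s' W' ` B')"
proof -
  define \<Psi> where "\<Psi> w \<phi> = (if multilinear_form s' W' \<phi> then F \<phi> w else 0)" for w \<phi>
  have "dual_map s' W' F t = (\<lambda>\<phi>. t (\<lambda>w. \<Psi> w \<phi>))"
    using tensor_zero_form[OF t] by (auto simp: dual_map_def \<Psi>_def fun_eq_iff)
  also have "\<dots> \<in> tensor.span (pure_tensor s' W' ` B')"
  proof (rule tensor_bind_in_subspace[OF t])
    show "multilinear_form s W (\<lambda>w. \<Psi> w \<phi>)" for \<phi>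
      using F[of \<phi>] by (cases "multilinear_form s' W' \<phi>") (simp_all add: \<Psi>_def)
    fix w assume "w \<in> B"
    then obtain c w' where "w' \<in> B'" "\<And>\<phi>. multilinear_form s' W' \<phi> \<Longrightarrow> F \<phi> w = c * \<phi> w'"
      using B' by blast
    then have "\<Psi> w = tensor_scale c (pure_tensor s' W' w')"
      by (auto simp: \<Psi>_def fun_eq_iff pscale_def pure_tensor_def)
    then show "\<Psi> w \<in> tensor.span (pure_tensor s' W' ` B')"
      using \<open>w' \<in> B'\<close> by (simp add: tensor.span_base tensor.span_scale)
  qed (rule tensor.subspace_span)
  finally show ?thesis .
qed

lemma dual_map_add: "dual_map s W F (t + t') = dual_map s W F t + dual_map s W F t'"
  and dual_map_scale: "dual_map s W F (tensor_scale c t) = tensor_scale c (dual_map s W F t)"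
  and dual_map_zero: "dual_map s W F 0 = 0"
  by (auto simp: dual_map_def pscale_def fun_eq_iff)

lemma words_iff:
  "w \<in> words Vs \<longleftrightarrow> length w = length Vs \<and> (\<forall>k<length w. snd (w ! k) \<in> (Vs ! k) (fst (w ! k)))"
  by (auto simp: words_def list_all2_conv_all_nth case_prod_beta)

lemma words_replicate: "words (replicate n V) = {w \<in> all_words V. length w = n}"
  by (auto simp: words_iff all_words_eq case_prod_beta all_set_conv_all_nth)

text \<open>
  The sums and multiples in the definition of multilinearity must be words of \<open>W\<close> again; otherwise
  multilinearity on \<open>W\<close> would depend on values outside \<open>W\<close>.
\<close>

definition letters_closed :: "('k \<Rightarrow> 'v::plus \<Rightarrow> 'v) \<Rightarrow> ('d, 'v) word set \<Rightarrow> bool" where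
  "letters_closed s W \<longleftrightarrow>
     (\<forall>u i x y v. u @ (i, x) # v \<in> W \<longrightarrow> u @ (i, y) # v \<in> W \<longrightarrow> u @ (i, x + y) # v \<in> W) \<and>
     (\<forall>u i x v c. u @ (i, x) # v \<in> W \<longrightarrow> u @ (i, s c x) # v \<in> W)"

lemma letters_closed_all_words:
  assumes "graded_vector_space s V" shows "letters_closed s (all_words V)"
proof -
  interpret vector_space s using assms by (simp add: graded_vector_space_def)
  have "subspace (V i)" for i using assms by (simp add: graded_vector_space_def)
  then show ?thesis by (auto simp: letters_closed_def subspace_add subspace_scale)
qed

lemma letters_closed_words:
  assumes Vs: "\<And>V. V \<in> set Vs \<Longrightarrow> graded_vector_space s V" shows "letters_closed s (words Vs)"
proof -
  have split: "\<exists>Vu V Vv. Vs = Vu @ V # Vv \<and> vector_space s \<and> module.subspace s (V i) \<and> x \<in> V i \<and>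
      (\<forall>y. u @ (i, y) # v \<in> words Vs \<longleftrightarrow> y \<in> V i)"
    if w: "u @ (i, x) # v \<in> words Vs" for u i x v
  proof -
    obtain Vu V Vv where *: "Vs = Vu @ V # Vv" "list_all2 (\<lambda>(i, x) V. x \<in> V i) u Vu" "x \<in> V i"
      "list_all2 (\<lambda>(i, x) V. x \<in> V i) v Vv"
      using w by (auto simp: words_def list_all2_append1 list_all2_Cons1)
    then show ?thesis
      using Vs[of V] by (auto simp: words_def graded_vector_space_def list_all2_append list_all2_lengthD)
  qed
  show ?thesis
    unfolding letters_closed_def
  proof (intro conjI allI impI)
    fix u i x y v assume w: "u @ (i, x) # v \<in> words Vs" "u @ (i, y) # v \<in> words Vs"
    from split[OF w(1)] obtain V where V: "vector_space s" "module.subspace s (V i)" "x \<in> V i"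
      "\<And>y. u @ (i, y) # v \<in> words Vs \<longleftrightarrow> y \<in> V i" by blast
    interpret vector_space s by fact
    show "u @ (i, x + y) # v \<in> words Vs" using V w(2) subspace_add by blast
  next
    fix u i x v c assume w: "u @ (i, x) # v \<in> words Vs"
    from split[OF w] obtain V where V: "vector_space s" "module.subspace s (V i)" "x \<in> V i"
      "\<And>y. u @ (i, y) # v \<in> words Vs \<longleftrightarrow> y \<in> V i" by blast
    interpret vector_space s by fact
    show "u @ (i, s c x) # v \<in> words Vs" using V subspace_scale by blast
  qed
qed

lemma multilinear_on_cong:
  assumes W: "letters_closed s W" and eq: "\<And>w. w \<in> W \<Longrightarrow> \<phi> w = \<phi>' w" and \<phi>: "multilinear_on s s' W \<phi>"
  shows "multilinear_on s s' W \<phi>'"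
  unfolding multilinear_on_def
proof (intro conjI allI impI)
  fix u v i x y assume w: "u @ (i, x) # v \<in> W" "u @ (i, y) # v \<in> W"
  then have "u @ (i, x + y) # v \<in> W" using W unfolding letters_closed_def by blast
  from eq[OF this] multilinear_on_add[OF \<phi> w] show "\<phi>' (u @ (i, x + y) # v) = \<phi>' (u @ (i, x) # v) + \<phi>' (u @ (i, y) # v)"
    by (simp only: eq[OF w(1)] eq[OF w(2)])
next
  fix u v i x c assume w: "u @ (i, x) # v \<in> W"
  then have "u @ (i, s c x) # v \<in> W" using W unfolding letters_closed_def by blast
  from eq[OF this] multilinear_on_scale[OF \<phi> w] show "\<phi>' (u @ (i, s c x) # v) = s' c (\<phi>' (u @ (i, x) # v))"
    by (simp only: eq[OF w])
qed

lemma tensor_form_cong':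
  assumes W: "letters_closed s W" and t: "t \<in> tensor.span (pure_tensor s W ` B)" "B \<subseteq> W"
    and eq: "\<And>w. w \<in> W \<Longrightarrow> \<phi> w = \<phi>' w"
  shows "t \<phi> = t \<phi>'"
proof (cases "multilinear_form s W \<phi>")
  case True
  then show ?thesis
    using multilinear_on_cong[OF W eq] t by (intro tensor_form_cong[OF t(1)] eq) auto
next
  case False
  then have "\<not> multilinear_form s W \<phi>'"
    using multilinear_on_cong[OF W, of \<phi>' \<phi>] eq by auto
  with False show ?thesis using tensor_not_multilinear[OF t(1)] by simp
qed

text \<open>
  Replacing a letter by list update commutes with permutations and with maps applied letter by letter, whereas
  splitting a word around a letter does not.
\<close>

lemma multilinear_on_update:
  "multilinear_on s s' W \<phi> \<longleftrightarrow>
     (\<forall>w k i x y. k < length w \<longrightarrow> w[k := (i, x)] \<in> W \<longrightarrow> w[k := (i, y)] \<in> W \<longrightarrow>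
        \<phi> (w[k := (i, x + y)]) = \<phi> (w[k := (i, x)]) + \<phi> (w[k := (i, y)])) \<and>
     (\<forall>w k i x c. k < length w \<longrightarrow> w[k := (i, x)] \<in> W \<longrightarrow> \<phi> (w[k := (i, s c x)]) = s' c (\<phi> (w[k := (i, x)])))"
  (is "?L \<longleftrightarrow> ?R")
proof
  assume ?L
  then show ?R
    by (auto simp: upd_conv_take_nth_drop multilinear_on_add multilinear_on_scale)
next
  assume R: ?R
  show ?L
    unfolding multilinear_on_def
  proof (intro conjI allI impI)
    fix u v i x y assume "u @ (i, x) # v \<in> W" "u @ (i, y) # v \<in> W"
    then show "\<phi> (u @ (i, x + y) # v) = \<phi> (u @ (i, x) # v) + \<phi> (u @ (i, y) # v)"
      using conjunct1[OF R, rule_format, of "length u" "u @ (i, x) # v" i x y] by simp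
  next
    fix u v i x c assume "u @ (i, x) # v \<in> W"
    then show "\<phi> (u @ (i, s c x) # v) = s' c (\<phi> (u @ (i, x) # v))"
      using conjunct2[OF R, rule_format, of "length u" "u @ (i, x) # v" i x c] by simp
  qed
qed

lemma length_map_word [simp]: "length (map_word fs w) = min (length fs) (length w)"
  by (simp add: map_word_def)

lemma map_word_nth:
  "k < length fs \<Longrightarrow> k < length w \<Longrightarrow> map_word fs w ! k = (fst (w ! k), (fs ! k) (fst (w ! k)) (snd (w ! k)))"
  by (simp add: map_word_def case_prod_beta)

lemma map_word_update:
  assumes "length fs = length w" "k < length w"
  shows "map_word fs (w[k := (i, x)]) = (map_word fs w)[k := (i, (fs ! k) i x)]"
  by (rule nth_equalityI) (use assms in \<open>auto simp: map_word_nth nth_list_update\<close>)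

lemma map_fst_map_word: "length fs = length w \<Longrightarrow> map fst (map_word fs w) = map fst w"
  by (rule nth_equalityI) (auto simp: map_word_nth)

lemma word_degree_map_word: "length fs = length w \<Longrightarrow> word_degree (map_word fs w) = word_degree w"
  by (simp add: word_degree_def map_fst_map_word)

lemma map_word_permute_list:
  assumes \<sigma>: "\<sigma> permutes {..<length w}" and l: "length fs = length w"
  shows "map_word (permute_list \<sigma> fs) (permute_list \<sigma> w) = permute_list \<sigma> (map_word fs w)"
proof (rule nth_equalityI)
  fix k assume "k < length (map_word (permute_list \<sigma> fs) (permute_list \<sigma> w))"
  then have k: "k < length w" using l by simp
  with permutes_in_image[OF \<sigma>, of k] have "\<sigma> k < length w" by simp
  with k show "map_word (permute_list \<sigma> fs) (permute_list \<sigma> w) ! k = permute_list \<sigma> (map_word fs w) ! k"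
    using \<sigma> l by (simp add: map_word_nth permute_list_nth)
qed (use l in simp)

lemma word_degree_permute_list:
  fixes w :: "('d::comm_monoid_add, 'v) word"
  assumes "\<sigma> permutes {..<length w}"
  shows "word_degree (permute_list \<sigma> w) = word_degree w"
proof -
  have "mset (map fst (permute_list \<sigma> w)) = mset (map fst w)" using assms by simp
  then show ?thesis unfolding word_degree_def by (metis sum_mset_sum_list)
qed

lemma permute_list_update:
  assumes \<sigma>: "\<sigma> permutes {..<length w}" and k: "k < length w"
  shows "permute_list \<sigma> (w[k := z]) = (permute_list \<sigma> w)[inv \<sigma> k := z]"
proof (rule nth_equalityI)
  fix j assume "j < length (permute_list \<sigma> (w[k := z]))"
  then have j: "j < length w" by simp
  have "inv \<sigma> k = j \<longleftrightarrow> k = \<sigma> j" using permutes_inverses[OF \<sigma>] by metis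
  with j k show "permute_list \<sigma> (w[k := z]) ! j = (permute_list \<sigma> w)[inv \<sigma> k := z] ! j"
    using \<sigma> permutes_in_image[OF \<sigma>, of j] by (auto simp: permute_list_nth nth_list_update)
qed simp

lemma words_permute_list:
  assumes \<sigma>: "\<sigma> permutes {..<length Vs}" and w: "w \<in> words Vs"
  shows "permute_list \<sigma> w \<in> words (permute_list \<sigma> Vs)"
proof -
  have "length w = length Vs" using w by (simp add: words_iff)
  then show ?thesis
    using w \<sigma> permutes_in_image[OF \<sigma>] by (auto simp: words_iff permute_list_nth)
qed

lemma multilinear_on_permute_list:
  fixes \<phi> :: "('d, 'v::ab_group_add) word \<Rightarrow> 'k::field"
  assumes \<sigma>: "\<sigma> permutes {..<length Vs}" and \<phi>: "multilinear_form s (words (permute_list \<sigma> Vs)) \<phi>"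
  shows "multilinear_form s (words Vs) (\<lambda>w. c (map fst w) * \<phi> (permute_list \<sigma> w))"
  unfolding multilinear_on_update
proof (intro conjI allI impI)
  fix w k i x y assume k: "k < length w" and w: "w[k := (i, x)] \<in> words Vs" "w[k := (i, y)] \<in> words Vs"
  then have l: "length w = length Vs" by (simp add: words_iff)
  have p: "permute_list \<sigma> (w[k := (i, z)]) = (permute_list \<sigma> w)[inv \<sigma> k := (i, z)]" for z
    using \<sigma> k l by (intro permute_list_update) auto
  have ik: "inv \<sigma> k < length w" using permutes_in_image[OF permutes_inv[OF \<sigma>], of k] k l by simp
  have d: "map fst (w[k := (i, z)]) = (map fst w)[k := i]" for z by (simp add: map_update)
  show "c (map fst (w[k := (i, x + y)])) * \<phi> (permute_list \<sigma> (w[k := (i, x + y)])) =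
      c (map fst (w[k := (i, x)])) * \<phi> (permute_list \<sigma> (w[k := (i, x)])) +
      c (map fst (w[k := (i, y)])) * \<phi> (permute_list \<sigma> (w[k := (i, y)]))"
    using conjunct1[OF \<phi>[unfolded multilinear_on_update], rule_format, of "inv \<sigma> k" "permute_list \<sigma> w" i x y]
      words_permute_list[OF \<sigma> w(1)] words_permute_list[OF \<sigma> w(2)] ik
    unfolding p d by (simp add: distrib_left)
next
  fix w k i x a assume k: "k < length w" and w: "w[k := (i, x)] \<in> words Vs"
  then have l: "length w = length Vs" by (simp add: words_iff)
  have p: "permute_list \<sigma> (w[k := (i, z)]) = (permute_list \<sigma> w)[inv \<sigma> k := (i, z)]" for z
    using \<sigma> k l by (intro permute_list_update) auto
  have ik: "inv \<sigma> k < length w" using permutes_in_image[OF permutes_inv[OF \<sigma>], of k] k l by simp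
  have d: "map fst (w[k := (i, z)]) = (map fst w)[k := i]" for z by (simp add: map_update)
  show "c (map fst (w[k := (i, s a x)])) * \<phi> (permute_list \<sigma> (w[k := (i, s a x)])) =
      a * (c (map fst (w[k := (i, x)])) * \<phi> (permute_list \<sigma> (w[k := (i, x)])))"
    using conjunct2[OF \<phi>[unfolded multilinear_on_update], rule_format, of "inv \<sigma> k" "permute_list \<sigma> w" i x a]
      words_permute_list[OF \<sigma> w] ik
    unfolding p d by simp
qed

definition letter_map ::
  "('k \<Rightarrow> 'u::plus \<Rightarrow> 'u) \<Rightarrow> ('k \<Rightarrow> 'v::plus \<Rightarrow> 'v) \<Rightarrow> ('d \<Rightarrow> 'u set) \<Rightarrow> ('d \<Rightarrow> 'v set) \<Rightarrow> ('d \<Rightarrow> 'u \<Rightarrow> 'v) \<Rightarrow> bool" where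
  "letter_map s s' V V' f \<longleftrightarrow> (\<forall>i. \<forall>x\<in>V i. f i x \<in> V' i \<and> (\<forall>y\<in>V i. f i (x + y) = f i x + f i y) \<and>
     (\<forall>c. f i (s c x) = s' c (f i x)))"

lemma map_word_in_words:
  assumes "length Vs' = length fs" "\<And>k. k < length fs \<Longrightarrow> letter_map s s' (Vs ! k) (Vs' ! k) (fs ! k)"
    and "w \<in> words Vs" "length Vs = length fs"
  shows "map_word fs w \<in> words Vs'"
  using assms by (auto simp: words_iff map_word_nth letter_map_def)

lemma multilinear_on_map_word:
  fixes \<phi> :: "('d, 'v::plus) word \<Rightarrow> 'e::plus"
  assumes W: "\<And>w. w \<in> W \<Longrightarrow> length w = length fs \<Longrightarrow> w \<in> words Vs"
    and fs: "\<And>k. k < length fs \<Longrightarrow> letter_map s s' (Vs ! k) (Vs' ! k) (fs ! k)"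
    and l: "length Vs = length fs" "length Vs' = length fs"
    and \<phi>: "multilinear_on s' sE (words Vs') \<phi>"
    and z: "z + z = z" "\<And>c. sE c z = z"
  shows "multilinear_on s sE W (\<lambda>w. if length w = length fs then \<phi> (map_word fs w) else z)"
  unfolding multilinear_on_update
proof (intro conjI allI impI)
  fix w k i x y assume k: "k < length w" and w: "w[k := (i, x)] \<in> W" "w[k := (i, y)] \<in> W"
  show "(if length (w[k := (i, x + y)]) = length fs then \<phi> (map_word fs (w[k := (i, x + y)])) else z) =
      (if length (w[k := (i, x)]) = length fs then \<phi> (map_word fs (w[k := (i, x)])) else z) +
      (if length (w[k := (i, y)]) = length fs then \<phi> (map_word fs (w[k := (i, y)])) else z)"
  proof (cases "length w = length fs")
    case True
    have ws: "w[k := (i, x)] \<in> words Vs" "w[k := (i, y)] \<in> words Vs" using W[OF w(1)] W[OF w(2)] True by auto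
    then have "x \<in> (Vs ! k) i" "y \<in> (Vs ! k) i" using k by (auto simp: words_iff dest!: spec[of _ k])
    then have f: "(fs ! k) i (x + y) = (fs ! k) i x + (fs ! k) i y" using fs[of k] k True by (auto simp: letter_map_def)
    have "map_word fs (w[k := (i, x)]) \<in> words Vs'" "map_word fs (w[k := (i, y)]) \<in> words Vs'"
      using ws l by (auto intro!: map_word_in_words[of Vs' fs s s' Vs] fs)
    then show ?thesis
      using conjunct1[OF \<phi>[unfolded multilinear_on_update], rule_format, of k "map_word fs w" i "(fs ! k) i x" "(fs ! k) i y"] True k
      by (simp add: map_word_update f)
  qed (use z in simp)
next
  fix w k i x c assume k: "k < length w" and w: "w[k := (i, x)] \<in> W"
  show "(if length (w[k := (i, s c x)]) = length fs then \<phi> (map_word fs (w[k := (i, s c x)])) else z) =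
      sE c (if length (w[k := (i, x)]) = length fs then \<phi> (map_word fs (w[k := (i, x)])) else z)"
  proof (cases "length w = length fs")
    case True
    have ws: "w[k := (i, x)] \<in> words Vs" using W[OF w] True by auto
    then have "x \<in> (Vs ! k) i" using k by (auto simp: words_iff dest!: spec[of _ k])
    then have f: "(fs ! k) i (s c x) = s' c ((fs ! k) i x)" using fs[of k] k True by (auto simp: letter_map_def)
    have "map_word fs (w[k := (i, x)]) \<in> words Vs'"
      using ws l by (auto intro!: map_word_in_words[of Vs' fs s s' Vs] fs)
    then show ?thesis
      using conjunct2[OF \<phi>[unfolded multilinear_on_update], rule_format, of k "map_word fs w" i "(fs ! k) i x" c] True k
      by (simp add: map_word_update f)
  qed (use z in simp)
qed

lemma tensor_valued_multilinear:
  assumes "\<And>\<phi>. multilinear_form s W (\<lambda>w. \<Psi> w \<phi>)"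
  shows "multilinear_on s tensor_scale W \<Psi>"
  using assms unfolding multilinear_on_def by (auto simp: fun_eq_iff pscale_def)

lemma multilinear_form_pure_tensor:
  "multilinear_form s W (\<lambda>w. pure_tensor s W w \<phi>)"
  by (cases "multilinear_form s W \<phi>") (simp_all add: pure_tensor_def)

section \<open>The ideal of the enveloping algebra\<close>

text \<open>
  The description of \<open>J\<close> in this section concerns any graded space with a bracket; it will be applied to the limit
  algebra.
\<close>

locale graded_bracket =
  fixes s :: "'k::field_char_0 \<Rightarrow> 'v::ab_group_add \<Rightarrow> 'v"
    and V :: "'d::grading_index \<Rightarrow> 'v set"
    and br :: "'d \<Rightarrow> 'd \<Rightarrow> 'v \<Rightarrow> 'v \<Rightarrow> 'v"
  assumes graded: "graded_vector_space s V"
    and br_closed: "\<lbrakk>x \<in> V i; y \<in> V j\<rbrakk> \<Longrightarrow> br i j x y \<in> V (i + j)"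
begin

abbreviation pure :: "('d, 'v) word \<Rightarrow> ('d, 'v, 'k) tensor" where
  "pure \<equiv> pure_tensor s (all_words V)"

definition word_relator ::
  "('d, 'v) word \<Rightarrow> 'd \<Rightarrow> 'v \<Rightarrow> 'd \<Rightarrow> 'v \<Rightarrow> ('d, 'v) word \<Rightarrow> ('d, 'v, 'k) tensor" where
  "word_relator u i x j y v = pure (u @ (i, x) # (j, y) # v)
     - tensor_scale (ksign i j) (pure (u @ (j, y) # (i, x) # v)) - pure (u @ (i + j, br i j x y) # v)"

text \<open>
  The products of the defining relators with words on both sides. They span \<open>J\<close>.
\<close>

definition word_relators :: "('d, 'v, 'k) tensor set" where
  "word_relators = {word_relator u i x j y v | u i x j y v. u @ (i, x) # (j, y) # v \<in> all_words V}"

lemma tensor_mult_diff_left: "tensor_mult s W (a - b) c = tensor_mult s W a c - tensor_mult s W b c"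
  and tensor_mult_add_left: "tensor_mult s W (a + b) c = tensor_mult s W a c + tensor_mult s W b c"
  and tensor_mult_scale_left: "tensor_mult s W (tensor_scale e a) c = tensor_scale e (tensor_mult s W a c)"
  and tensor_mult_zero_left: "tensor_mult s W 0 c = 0"
  by (auto simp: tensor_mult_def dual_map_def fun_eq_iff pscale_def)

lemma form_shift:
  assumes "multilinear_form s (all_words V) \<phi>" "u \<in> all_words V"
  shows "multilinear_form s (all_words V) (\<lambda>v. \<phi> (u @ v))"
  unfolding multilinear_on_def
proof (intro conjI allI impI)
  fix a v i x y assume "a @ (i, x) # v \<in> all_words V" "a @ (i, y) # v \<in> all_words V"
  then show "\<phi> (u @ a @ (i, x + y) # v) = \<phi> (u @ a @ (i, x) # v) + \<phi> (u @ a @ (i, y) # v)"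
    using multilinear_on_add[OF assms(1), of "u @ a" i x v y] assms(2) by simp
next
  fix a v i x c assume "a @ (i, x) # v \<in> all_words V"
  then show "\<phi> (u @ a @ (i, s c x) # v) = c * \<phi> (u @ a @ (i, x) # v)"
    using multilinear_on_scale[OF assms(1), of "u @ a" i x v c] assms(2) by simp
qed

text \<open>
  Since \<open>b\<close> is a combination of words, the inner functional of the product is a multilinear form, and
  multiplication by a word becomes the shift of forms by this word.
\<close>

lemma tensor_mult_pure_left:
  assumes u: "u \<in> all_words V" and b: "b \<in> tensor_space s (all_words V)"
  shows "tensor_mult s (all_words V) (pure u) b =
    (\<lambda>\<phi>. if multilinear_form s (all_words V) \<phi> then b (\<lambda>v. \<phi> (u @ v)) else 0)"
proof
  fix \<phi>
  let ?W = "all_words V"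
  have closed: "letters_closed s ?W" by (rule letters_closed_all_words[OF graded])
  show "tensor_mult s ?W (pure u) b \<phi> = (if multilinear_form s ?W \<phi> then b (\<lambda>v. \<phi> (u @ v)) else 0)"
  proof (cases "multilinear_form s ?W \<phi>")
    case True
    obtain A c where A: "A \<subseteq> ?W" "\<And>\<phi>. multilinear_form s ?W \<phi> \<Longrightarrow> b \<phi> = (\<Sum>w\<in>A. c w * \<phi> w)"
      using tensor_span_apply[OF b[unfolded tensor_space_def]] by metis
    have right: "multilinear_form s ?W (\<lambda>u'. \<phi> (u' @ w))" if w: "w \<in> ?W" for w
      unfolding multilinear_on_def
    proof (intro conjI allI impI)
      fix a v i x y assume "a @ (i, x) # v \<in> ?W" "a @ (i, y) # v \<in> ?W"
      then show "\<phi> ((a @ (i, x + y) # v) @ w) = \<phi> ((a @ (i, x) # v) @ w) + \<phi> ((a @ (i, y) # v) @ w)"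
        using multilinear_on_add[OF True, of a i x "v @ w" y] w by simp
    next
      fix a v i x c assume "a @ (i, x) # v \<in> ?W"
      then show "\<phi> ((a @ (i, s c x) # v) @ w) = c * \<phi> ((a @ (i, x) # v) @ w)"
        using multilinear_on_scale[OF True, of a i x "v @ w" c] w by simp
    qed
    have "multilinear_form s ?W (\<lambda>u'. \<Sum>w\<in>A. c w * \<phi> (u' @ w))"
      using A(1) by (intro multilinear_form_combination right) auto
    then have "multilinear_form s ?W (\<lambda>u'. b (\<lambda>v. \<phi> (u' @ v)))"
      by (rule multilinear_on_cong[OF closed, rotated]) (simp add: A(2) form_shift[OF True])
    then show ?thesis
      using True by (simp add: tensor_mult_def dual_map_def pure_tensor_def)
  qed (simp add: tensor_mult_def dual_map_def)
qed

lemma pure_in_tensor_space: "w \<in> all_words V \<Longrightarrow> pure w \<in> tensor_space s (all_words V)"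
  by (simp add: tensor_space_def tensor.span_base)

lemma subspace_tensor_space: "tensor.subspace (tensor_space s (all_words V))"
  by (simp add: tensor_space_def)

lemma word_relatorsI:
  "u @ (i, x) # (j, y) # v \<in> all_words V \<Longrightarrow> word_relator u i x j y v \<in> word_relators"
  unfolding word_relators_def by blast

lemma word_relators_subset: "word_relators \<subseteq> tensor_space s (all_words V)"
  by (auto simp: word_relators_def word_relator_def br_closed
      intro!: tensor.subspace_diff[OF subspace_tensor_space] tensor.subspace_scale[OF subspace_tensor_space] pure_in_tensor_space)

lemma relator_mult_right:
  assumes "u @ (i, x) # (j, y) # v \<in> all_words V" "w \<in> all_words V"
  shows "tensor_mult s (all_words V) (word_relator u i x j y v) (pure w) = word_relator u i x j y (v @ w)"
  using assms
  by (simp add: word_relator_def tensor_mult_diff_left tensor_mult_scale_left tensor_mult_pure[OF graded] br_closed)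

lemma relator_mult_left:
  assumes r: "u @ (i, x) # (j, y) # v \<in> all_words V" and w: "w \<in> all_words V"
  shows "tensor_mult s (all_words V) (pure w) (word_relator u i x j y v) = word_relator (w @ u) i x j y v"
proof -
  have T: "word_relator u i x j y v \<in> tensor_space s (all_words V)"
    using word_relatorsI[OF r] word_relators_subset by blast
  show ?thesis
    unfolding tensor_mult_pure_left[OF w T]
    by (auto simp: fun_eq_iff word_relator_def pscale_def pure_tensor_def form_shift[OF _ w])
qed

text \<open>
  Since this ideal contains the relators, the hull that defines \<open>J\<close> is an ideal of the tensor algebra
  and not the intersection of an empty family, which would be the whole type.
\<close>

lemma two_sided_ideal_span_relators: "two_sided_ideal s V (tensor.span word_relators)"
  unfolding two_sided_ideal_def
proof (intro conjI ballI)
  let ?W = "all_words V" and ?R = "tensor.span word_relators"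
  have R: "?R \<subseteq> tensor_space s ?W"
    by (rule tensor.span_minimal[OF word_relators_subset subspace_tensor_space])
  show "tensor.subspace ?R" "?R \<subseteq> tensor_space s ?W" by (simp_all add: R)
  fix a b assume a: "a \<in> tensor_space s ?W" and b: "b \<in> ?R"
  show "tensor_mult s ?W a b \<in> ?R"
    using a unfolding tensor_space_def
  proof (induction rule: tensor.span_induct_alt)
    case base
    show ?case unfolding tensor_mult_zero_left by (rule tensor.span_zero)
  next
    case (step c p y)
    then obtain w where w: "w \<in> ?W" "p = pure w" by blast
    from b have "b \<in> tensor_space s ?W \<and> tensor_mult s ?W (pure w) b \<in> ?R"
    proof (induction rule: tensor.span_induct_alt)
      case base
      have zero: "0 \<in> tensor_space s ?W" by (rule tensor.subspace_0[OF subspace_tensor_space])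
      have "tensor_mult s ?W (pure w) 0 = 0"
        unfolding tensor_mult_pure_left[OF w(1) zero] by (auto simp: fun_eq_iff)
      then show ?case using zero by (simp only: tensor.span_zero simp_thms)
    next
      case (step c r b)
      then obtain u i x j y v where r: "r = word_relator u i x j y v" "u @ (i, x) # (j, y) # v \<in> ?W"
        by (auto simp: word_relators_def)
      have rT: "r \<in> tensor_space s ?W" using step word_relators_subset by auto
      have mem: "tensor_scale c r + b \<in> tensor_space s ?W"
        using rT step tensor.subspace_add[OF subspace_tensor_space] tensor.subspace_scale[OF subspace_tensor_space] by blast
      have "tensor_mult s ?W (pure w) (tensor_scale c r + b) =
          tensor_scale c (tensor_mult s ?W (pure w) r) + tensor_mult s ?W (pure w) b"
        using step
        unfolding tensor_mult_pure_left[OF w(1) mem] tensor_mult_pure_left[OF w(1) rT]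
        by (auto simp: tensor_mult_pure_left[OF w(1)] fun_eq_iff pscale_def)
      moreover have "tensor_mult s ?W (pure w) r \<in> word_relators"
        using r w by (auto simp: relator_mult_left word_relators_def intro!: exI)
      ultimately have "tensor_mult s ?W (pure w) (tensor_scale c r + b) \<in> ?R"
        using step by (simp only: tensor.span_add tensor.span_scale tensor.span_base)
      with mem show ?case by (rule conjI)
    qed
    then show ?case
      using step unfolding tensor_mult_add_left tensor_mult_scale_left w(2)
      by (intro tensor.span_add tensor.span_scale) simp_all
  qed
  show "tensor_mult s ?W b a \<in> ?R"
    using b
  proof (induction rule: tensor.span_induct_alt)
    case base
    show ?case unfolding tensor_mult_zero_left by (rule tensor.span_zero)
  next
    case (step c r b)
    then obtain u i x j y v where r: "r = word_relator u i x j y v" "u @ (i, x) # (j, y) # v \<in> ?W"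
      by (auto simp: word_relators_def)
    have uv: "u @ (j, y) # (i, x) # v \<in> ?W" "u @ (i + j, br i j x y) # v \<in> ?W" using r(2) by (auto intro: br_closed)
    from a[unfolded tensor_space_def] have "a \<in> tensor_space s ?W \<and> tensor_mult s ?W r a \<in> ?R"
    proof (induction rule: tensor.span_induct_alt)
      case base
      have zero: "0 \<in> tensor_space s ?W" by (rule tensor.subspace_0[OF subspace_tensor_space])
      have "tensor_mult s ?W r 0 = 0"
        unfolding r(1) word_relator_def tensor_mult_diff_left tensor_mult_scale_left
          tensor_mult_pure_left[OF r(2) zero] tensor_mult_pure_left[OF uv(1) zero] tensor_mult_pure_left[OF uv(2) zero]
        by (auto simp: fun_eq_iff pscale_def)
      then show ?case using zero by (simp only: tensor.span_zero simp_thms)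
    next
      case (step e p t)
      then obtain w where w: "w \<in> ?W" "p = pure w" by blast
      have tT: "t \<in> tensor_space s ?W" using step by blast
      have pT: "p \<in> tensor_space s ?W" using w pure_in_tensor_space by simp
      have mem: "tensor_scale e p + t \<in> tensor_space s ?W"
        using pT step tensor.subspace_add[OF subspace_tensor_space] tensor.subspace_scale[OF subspace_tensor_space] by blast
      have "tensor_mult s ?W r (tensor_scale e p + t) =
          tensor_scale e (tensor_mult s ?W r p) + tensor_mult s ?W r t"
        unfolding r(1) word_relator_def tensor_mult_diff_left tensor_mult_scale_left
          tensor_mult_pure_left[OF r(2) mem] tensor_mult_pure_left[OF uv(1) mem] tensor_mult_pure_left[OF uv(2) mem]
          tensor_mult_pure_left[OF r(2) pT] tensor_mult_pure_left[OF uv(1) pT] tensor_mult_pure_left[OF uv(2) pT]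
          tensor_mult_pure_left[OF r(2) tT] tensor_mult_pure_left[OF uv(1) tT] tensor_mult_pure_left[OF uv(2) tT]
        by (auto simp: fun_eq_iff pscale_def algebra_simps)
      moreover have "tensor_mult s ?W r p \<in> word_relators"
        using r w relator_mult_right[OF r(2) w(1)] by (auto simp: word_relators_def intro!: exI)
      ultimately have "tensor_mult s ?W r (tensor_scale e p + t) \<in> ?R"
        using step by (simp only: tensor.span_add tensor.span_scale tensor.span_base)
      with mem show ?case by (rule conjI)
    qed
    then show ?case
      using step unfolding tensor_mult_add_left tensor_mult_scale_left
      by (intro tensor.span_add tensor.span_scale) simp_all
  qed
qed

lemma env_ideal_subset: "env_ideal s V br \<subseteq> tensor.span word_relators"
  unfolding env_ideal_def
proof (rule hull_minimal)
  show "lie_relators s V br \<subseteq> tensor.span word_relators"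
  proof
    fix r assume "r \<in> lie_relators s V br"
    then obtain i x j y where "r = word_relator [] i x j y []" "x \<in> V i" "y \<in> V j"
      by (auto simp: lie_relators_def word_relator_def)
    then have "r \<in> word_relators" unfolding word_relators_def
      by (intro CollectI exI[of _ "[]"] exI) auto
    then show "r \<in> tensor.span word_relators" by (rule tensor.span_base)
  qed
qed (rule two_sided_ideal_span_relators)

lemma word_relator_in_env_ideal:
  assumes r: "u @ (i, x) # (j, y) # v \<in> all_words V"
  shows "word_relator u i x j y v \<in> env_ideal s V br"
  unfolding env_ideal_def hull_def
proof (intro InterI)
  fix I assume "I \<in> {t. two_sided_ideal s V t \<and> lie_relators s V br \<subseteq> t}"
  then have I: "two_sided_ideal s V I" and sub: "lie_relators s V br \<subseteq> I" by auto
  have uv: "u \<in> all_words V" "v \<in> all_words V" "[(i, x), (j, y)] \<in> all_words V" using r by auto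
  have "word_relator [] i x j y [] \<in> lie_relators s V br"
    using r by (auto simp: lie_relators_def word_relator_def)
  then have "word_relator [] i x j y [] \<in> I" using sub by blast
  then have "tensor_mult s (all_words V) (word_relator [] i x j y []) (pure v) \<in> I"
    using I pure_in_tensor_space[OF uv(2)] unfolding two_sided_ideal_def by blast
  then have "word_relator [] i x j y v \<in> I"
    using relator_mult_right[of "[]" i x j y "[]" v] uv by simp
  then have "tensor_mult s (all_words V) (pure u) (word_relator [] i x j y v) \<in> I"
    using I pure_in_tensor_space[OF uv(1)] unfolding two_sided_ideal_def by blast
  then show "word_relator u i x j y v \<in> I"
    using relator_mult_left[of "[]" i x j y v u] uv by simp
qed

lemma subspace_env_ideal: "tensor.subspace (env_ideal s V br)"
  unfolding env_ideal_def hull_def by (rule tensor.subspace_Inter) (auto simp: two_sided_ideal_def)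

text \<open>
  Modulo the relators a pure tensor satisfies the enveloping relation, so it is a combination of symmetrized words
  modulo \<open>J\<close>. All words in the argument have degree \<open>d\<close>, since relators are homogeneous.
\<close>

lemma tensor_space_deg_decomposition:
  "tensor_space_deg s (all_words V) d \<subseteq> tensor.span
    (word_symmetrize tensor_scale pure ` {w \<in> all_words V. word_degree w = d}
      \<union> (env_ideal s V br \<inter> tensor_space_deg s (all_words V) d))"
  (is "_ \<subseteq> tensor.span ?S")
proof -
  let ?D = "{w \<in> all_words V. word_degree w = d}"
  have "pure ` ?D \<subseteq> tensor.span ?S"
  proof
    fix t assume "t \<in> pure ` ?D"
    then obtain w where w: "w \<in> ?D" "t = pure w" by blast
    have "pure w \<in> tensor.span ?S"
    proof (rule enveloping_form_in_subspace[where D = ?D and br = br and \<psi> = pure and U = "tensor.span ?S"])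
      show "vector_space (tensor_scale :: 'k \<Rightarrow> ('d, 'v, 'k) tensor \<Rightarrow> _)"
        by (rule tensor.vector_space_axioms)
      fix u i x j y v assume D: "u @ (i, x) # (j, y) # v \<in> ?D"
      then show D': "u @ (j, y) # (i, x) # v \<in> ?D" "u @ (i + j, br i j x y) # v \<in> ?D"
        by (auto simp: word_degree_def br_closed add_ac)
      have "word_relator u i x j y v \<in> tensor_space_deg s (all_words V) d"
        unfolding word_relator_def tensor_space_deg_def
        using D D' by (intro tensor.span_diff tensor.span_scale tensor.span_base) auto
      moreover have "word_relator u i x j y v \<in> env_ideal s V br"
        using D by (intro word_relator_in_env_ideal) auto
      ultimately have "word_relator u i x j y v \<in> tensor.span ?S"
        by (intro tensor.span_base) auto
      then show "pure (u @ (i, x) # (j, y) # v) - (tensor_scale (ksign i j) (pure (u @ (j, y) # (i, x) # v)) +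
          pure (u @ (i + j, br i j x y) # v)) \<in> tensor.span ?S"
        by (simp add: word_relator_def diff_diff_eq)
    next
      show "word_symmetrize tensor_scale pure w \<in> tensor.span ?S" if "w \<in> ?D" for w
        using that by (intro tensor.span_base) auto
    qed (use w in auto)
    then show "t \<in> tensor.span ?S" using w by simp
  qed
  then have "tensor.span (pure ` ?D) \<subseteq> tensor.span ?S"
    by (rule tensor.span_minimal[OF _ tensor.subspace_span])
  then show ?thesis by (subst tensor_space_deg_def)
qed

end

section \<open>Products of inverse limits of discrete spaces\<close>

definition limit_product_topology :: "('n \<Rightarrow> ('i \<Rightarrow> 'x) set) \<Rightarrow> ('n \<Rightarrow> 'i \<Rightarrow> 'x) topology" where
  "limit_product_topology L = product_topology (\<lambda>n. inverse_limit_topology (L n)) UNIV"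

text \<open>
  In a product of inverse limits of discrete spaces, the points that agree with \<open>x\<close> on a finite set of
  coordinates form a basis of neighbourhoods of \<open>x\<close>.
\<close>

definition agree_on :: "('n \<times> 'i) set \<Rightarrow> ('n \<Rightarrow> 'i \<Rightarrow> 'x) \<Rightarrow> ('n \<Rightarrow> 'i \<Rightarrow> 'x) \<Rightarrow> bool" where
  "agree_on F x y \<longleftrightarrow> (\<forall>p\<in>F. x (fst p) (snd p) = y (fst p) (snd p))"

lemma agree_onD: "agree_on F x y \<Longrightarrow> (n, a) \<in> F \<Longrightarrow> x n a = y n a"
  by (auto simp: agree_on_def)

lemma agree_on_trans: "agree_on F x y \<Longrightarrow> agree_on F y z \<Longrightarrow> agree_on F x z"
  and agree_on_refl: "agree_on F x x"
  by (simp_all add: agree_on_def)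

lemma topspace_inverse_limit_topology [simp]: "topspace (inverse_limit_topology L) = L"
  by (simp add: inverse_limit_topology_def PiE_UNIV_domain)

lemma topspace_limit_product_topology: "topspace (limit_product_topology L) = {x. \<forall>n. x n \<in> L n}"
  by (auto simp: limit_product_topology_def PiE_UNIV_domain)

lemma openin_inverse_limit_agree:
  assumes "openin (inverse_limit_topology L) U" "x \<in> U"
  obtains A where "finite A" "\<And>y. y \<in> L \<Longrightarrow> (\<And>a. a \<in> A \<Longrightarrow> y a = x a) \<Longrightarrow> y \<in> U"
proof -
  obtain T where T: "openin (product_topology (\<lambda>_. discrete_topology UNIV) UNIV) T" "U = T \<inter> L"
    using assms(1) unfolding inverse_limit_topology_def openin_subtopology by blast
  then have "x \<in> T" using assms(2) by blast
  then obtain B where B: "finite {i \<in> UNIV. B i \<noteq> topspace (discrete_topology UNIV)}" "x \<in> Pi\<^sub>E UNIV B" "Pi\<^sub>E UNIV B \<subseteq> T"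
    using T(1) unfolding openin_product_topology_alt by blast
  show thesis
  proof (rule that[OF B(1)])
    fix y assume y: "y \<in> L" "\<And>a. a \<in> {i \<in> UNIV. B i \<noteq> topspace (discrete_topology UNIV)} \<Longrightarrow> y a = x a"
    have "y a \<in> B a" for a
      using y(2)[of a] B(2) by (cases "B a = UNIV") (auto simp: PiE_UNIV_domain)
    then have "y \<in> Pi\<^sub>E UNIV B" by (simp add: PiE_UNIV_domain)
    then show "y \<in> U" using B(3) T(2) y(1) by blast
  qed
qed

lemma continuous_map_coordinate:
  "continuous_map (limit_product_topology L) (discrete_topology UNIV) (\<lambda>x. x n a)"
proof -
  have "continuous_map (inverse_limit_topology (L n)) (discrete_topology UNIV) (\<lambda>x. x a)"
    unfolding inverse_limit_topology_def
    by (intro continuous_map_from_subtopology continuous_map_product_projection) simp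
  moreover have "continuous_map (limit_product_topology L) (inverse_limit_topology (L n)) (\<lambda>x. x n)"
    unfolding limit_product_topology_def by (intro continuous_map_product_projection) simp
  ultimately show ?thesis
    using continuous_map_compose[of "limit_product_topology L" _ "\<lambda>x. x n" _ "\<lambda>x. x a"] by (simp add: comp_def)
qed

lemma openin_limit_product_topology:
  "openin (limit_product_topology L) U \<longleftrightarrow> U \<subseteq> topspace (limit_product_topology L) \<and>
     (\<forall>x\<in>U. \<exists>F. finite F \<and> (\<forall>y\<in>topspace (limit_product_topology L). agree_on F y x \<longrightarrow> y \<in> U))"
  (is "?L \<longleftrightarrow> ?R")
proof
  assume U: ?L
  have "\<exists>F. finite F \<and> (\<forall>y\<in>topspace (limit_product_topology L). agree_on F y x \<longrightarrow> y \<in> U)"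
    if x: "x \<in> U" for x
  proof -
    from U[unfolded limit_product_topology_def openin_product_topology_alt, rule_format, OF x]
    obtain B where B: "finite {n \<in> UNIV. B n \<noteq> topspace (inverse_limit_topology (L n))}"
      "\<And>n. openin (inverse_limit_topology (L n)) (B n)" "x \<in> Pi\<^sub>E UNIV B" "Pi\<^sub>E UNIV B \<subseteq> U"
      by auto
    have "\<exists>A. finite A \<and> (\<forall>y\<in>L n. (\<forall>a\<in>A. y a = x n a) \<longrightarrow> y \<in> B n)" for n
    proof -
      have "x n \<in> B n" using B(3) by (auto simp: PiE_UNIV_domain)
      then obtain A where "finite A" "\<And>y. y \<in> L n \<Longrightarrow> (\<And>a. a \<in> A \<Longrightarrow> y a = x n a) \<Longrightarrow> y \<in> B n"
        using openin_inverse_limit_agree[OF B(2)] by blast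
      then show ?thesis by (intro exI[of _ A]) blast
    qed
    then have "\<exists>A. \<forall>n. finite (A n) \<and> (\<forall>y\<in>L n. (\<forall>a\<in>A n. y a = x n a) \<longrightarrow> y \<in> B n)"
      by (intro choice) blast
    then obtain A where A: "\<And>n. finite (A n)" "\<And>n y. y \<in> L n \<Longrightarrow> (\<forall>a\<in>A n. y a = x n a) \<Longrightarrow> y \<in> B n"
      by blast
    let ?N = "{n \<in> UNIV. B n \<noteq> topspace (inverse_limit_topology (L n))}"
    show ?thesis
    proof (intro exI conjI ballI impI)
      show "finite (Sigma ?N A)" using B(1) A(1) by (intro finite_SigmaI) auto
      fix y assume y: "y \<in> topspace (limit_product_topology L)" "agree_on (Sigma ?N A) y x"
      have "y n \<in> B n" for n
      proof (cases "n \<in> ?N")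
        case True
        then have "\<forall>a\<in>A n. y n a = x n a" using agree_onD[OF y(2)] by blast
        then show ?thesis using y(1) by (intro A(2)) (auto simp: topspace_limit_product_topology)
      next
        case False
        then show ?thesis using y(1) by (auto simp: topspace_limit_product_topology)
      qed
      then show "y \<in> U" using B(4) by (auto simp: PiE_UNIV_domain)
    qed
  qed
  then show ?R using openin_subset[OF U] by blast
next
  assume R: ?R
  show ?L
    unfolding openin_subopen[of _ U]
  proof
    fix x assume x: "x \<in> U"
    let ?X = "limit_product_topology L"
    obtain F where F: "finite F" "\<And>y. y \<in> topspace ?X \<Longrightarrow> agree_on F y x \<Longrightarrow> y \<in> U"
      using R x by blast
    let ?C = "topspace ?X \<inter> (\<Inter>p\<in>F. {y \<in> topspace ?X. y (fst p) (snd p) \<in> {x (fst p) (snd p)}})"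
    have "openin ?X {y \<in> topspace ?X. y n a \<in> {x n a}}" for n a
      by (rule openin_continuous_map_preimage[OF continuous_map_coordinate]) simp
    then have "openin ?X ?C"
      using F(1) by (cases "F = {}") (auto intro!: openin_Int openin_Inter)
    moreover have "x \<in> ?C" using R x by auto
    moreover have "?C \<subseteq> U"
    proof
      fix y assume y: "y \<in> ?C"
      then have "agree_on F y x" by (simp add: agree_on_def)
      with y show "y \<in> U" by (intro F(2)) auto
    qed
    ultimately show "\<exists>T. openin ?X T \<and> x \<in> T \<and> T \<subseteq> U" by blast
  qed
qed

lemma openin_agree_on:
  assumes "finite F"
  shows "openin (limit_product_topology L) {y \<in> topspace (limit_product_topology L). agree_on F y x}"
  unfolding openin_limit_product_topology
proof (intro conjI ballI)
  fix y assume "y \<in> {y \<in> topspace (limit_product_topology L). agree_on F y x}"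
  with assms show "\<exists>F'. finite F' \<and> (\<forall>z\<in>topspace (limit_product_topology L). agree_on F' z y \<longrightarrow>
      z \<in> {y \<in> topspace (limit_product_topology L). agree_on F y x})"
    by (intro exI[of _ F]) (auto intro: agree_on_trans)
qed auto

lemma closure_of_limit_product_topology:
  "y \<in> limit_product_topology L closure_of S \<longleftrightarrow> y \<in> topspace (limit_product_topology L) \<and>
     (\<forall>F. finite F \<longrightarrow> (\<exists>x\<in>S \<inter> topspace (limit_product_topology L). agree_on F x y))"
  (is "_ \<longleftrightarrow> ?R")
proof
  let ?X = "limit_product_topology L"
  assume y: "y \<in> ?X closure_of S"
  then have yX: "y \<in> topspace ?X" by (simp add: in_closure_of)
  moreover have "\<exists>x\<in>S \<inter> topspace ?X. agree_on F x y" if F: "finite F" for F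
  proof -
    let ?C = "{x \<in> topspace ?X. agree_on F x y}"
    have "openin ?X ?C"
      using openin_agree_on[OF F, of L y] .
    moreover have "y \<in> ?C" using yX by (auto intro: agree_on_refl)
    moreover have "y \<in> ?C \<and> openin ?X ?C \<longrightarrow> (\<exists>x. x \<in> S \<and> x \<in> ?C)"
      using y unfolding in_closure_of by (elim conjE) (erule spec)
    ultimately have "\<exists>x. x \<in> S \<and> x \<in> ?C" by simp
    then show ?thesis by auto
  qed
  ultimately show ?R by blast
next
  let ?X = "limit_product_topology L"
  assume R: ?R
  show "y \<in> ?X closure_of S"
    unfolding in_closure_of
  proof (intro conjI allI impI)
    show "y \<in> topspace ?X" using R by blast
    fix T assume T: "y \<in> T \<and> openin ?X T"
    then obtain F where F: "finite F" "\<And>x. x \<in> topspace ?X \<Longrightarrow> agree_on F x y \<Longrightarrow> x \<in> T"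
      unfolding openin_limit_product_topology by blast
    obtain x where "x \<in> S" "x \<in> topspace ?X" "agree_on F x y"
      using R F(1) by auto
    then show "\<exists>x. x \<in> S \<and> x \<in> T" using F(2)[of x] by auto
  qed
qed

lemma openin_agree_inverse_limit:
  assumes "finite A"
  shows "openin (inverse_limit_topology L) {y \<in> L. \<forall>a\<in>A. y a = x a}"
  using assms
proof (induction A rule: finite_induct)
  case empty
  show ?case using openin_topspace[of "inverse_limit_topology L"] by simp
next
  case (insert a A)
  have "continuous_map (inverse_limit_topology L) (discrete_topology UNIV) (\<lambda>y. y a)"
    unfolding inverse_limit_topology_def
    by (intro continuous_map_from_subtopology continuous_map_product_projection) simp
  then have "openin (inverse_limit_topology L) {y \<in> topspace (inverse_limit_topology L). y a \<in> {x a}}"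
    by (rule openin_continuous_map_preimage) simp
  then have "openin (inverse_limit_topology L) ({y \<in> L. y a = x a} \<inter> {y \<in> L. \<forall>a\<in>A. y a = x a})"
    using insert.IH by (intro openin_Int) simp_all
  also have "{y \<in> L. y a = x a} \<inter> {y \<in> L. \<forall>a\<in>A. y a = x a} = {y \<in> L. \<forall>a\<in>insert a A. y a = x a}" by auto
  finally show ?case .
qed

text \<open>
  The factors are discrete, so continuity means that each coordinate of \<open>f\<close> is locally constant.
\<close>

lemma continuous_map_into_inverse_limit_local:
  assumes "\<And>x. x \<in> topspace X \<Longrightarrow> f x \<in> L"
    and loc: "\<And>a x. x \<in> topspace X \<Longrightarrow> \<exists>U. openin X U \<and> x \<in> U \<and> (\<forall>y\<in>U. f y a = f x a)"
  shows "continuous_map X (inverse_limit_topology L) f"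
  unfolding inverse_limit_topology_def
proof (rule continuous_map_into_subtopology)
  show "f \<in> topspace X \<rightarrow> L" using assms(1) by blast
  show "continuous_map X (product_topology (\<lambda>_. discrete_topology UNIV) UNIV) f"
    unfolding continuous_map_componentwise_UNIV
  proof
    fix a
    show "continuous_map X (discrete_topology UNIV) (\<lambda>x. f x a)"
      unfolding continuous_map_def
    proof (intro conjI allI impI)
      fix V
      show "openin X {x \<in> topspace X. f x a \<in> V}"
        unfolding openin_subopen[of _ "{x \<in> topspace X. f x a \<in> V}"]
      proof
        fix x assume x: "x \<in> {x \<in> topspace X. f x a \<in> V}"
        then have "x \<in> topspace X" by simp
        from loc[OF this, of a] obtain U where U: "openin X U" "x \<in> U" "\<forall>y\<in>U. f y a = f x a" by auto
        have "y \<in> {x \<in> topspace X. f x a \<in> V}" if "y \<in> U" for y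
          using bspec[OF U(3) that] openin_subset[OF U(1)] that x by auto
        then have "U \<subseteq> {x \<in> topspace X. f x a \<in> V}" by (rule subsetI)
        then show "\<exists>T. openin X T \<and> x \<in> T \<and> T \<subseteq> {x \<in> topspace X. f x a \<in> V}"
          by (intro exI[of _ U] conjI U)
      qed
    qed auto
  qed
qed

lemma quotient_topology_topspace: "topspace (quotient_topology X q) = q ` topspace X"
  using quotient_imp_surjective_map[OF quotient_map_quotient_topology[of X q]] by simp

section \<open>Cosets of subspaces\<close>

context vector_space
begin

lemma mem_coset_iff: "(y :: 'b) \<in> x +o H \<longleftrightarrow> y - x \<in> H"
  by (auto simp: elt_set_plus_def intro!: bexI[of _ "y - x"])

lemma coset_eq_iff:
  assumes H: "subspace H" shows "x +o H = y +o H \<longleftrightarrow> x - y \<in> H"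
proof
  assume "x +o H = y +o H"
  moreover have "x \<in> x +o H" using subspace_0[OF H] by (simp add: mem_coset_iff)
  ultimately show "x - y \<in> H" by (simp add: mem_coset_iff)
next
  assume *: "x - y \<in> H"
  have "z - x \<in> H \<longleftrightarrow> z - y \<in> H" for z
    using subspace_add[OF H _ *, of "z - x"] subspace_diff[OF H _ *, of "z - y"] by auto
  then show "x +o H = y +o H" by (auto simp: mem_coset_iff)
qed

lemma coset_plus_coset:
  assumes H: "subspace H" shows "(x +o H) + (y +o H) = (x + y) +o H"
proof -
  have "H + H = H"
  proof
    show "H + H \<subseteq> H" using subspace_add[OF H] by (auto simp: set_plus_def)
    show "H \<subseteq> H + H" using set_plus_intro[OF subspace_0[OF H]] by auto
  qed
  then show ?thesis by (simp add: set_plus_rearrange)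
qed

lemma coset_scale_coset:
  assumes H: "subspace H" shows "coset_scale scale H c (x +o H) = scale c x +o H"
proof (intro set_eqI iffI)
  fix z assume "z \<in> coset_scale scale H c (x +o H)"
  then obtain h h' where "h \<in> H" "h' \<in> H" "z = scale c (x + h) + h'"
    by (auto simp: coset_scale_def set_plus_def elt_set_plus_def)
  then show "z \<in> scale c x +o H"
    using subspace_add[OF H subspace_scale[OF H]] by (simp add: mem_coset_iff scale_right_distrib)
next
  fix z assume "z \<in> scale c x +o H"
  then have "z - scale c x \<in> H" by (simp add: mem_coset_iff)
  moreover have "x \<in> x +o H" using subspace_0[OF H] by (simp add: mem_coset_iff)
  ultimately have "scale c x + (z - scale c x) \<in> scale c ` (x +o H) + H"
    by (intro set_plus_intro imageI)
  then show "z \<in> coset_scale scale H c (x +o H)" by (simp add: coset_scale_def)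
qed

end

section \<open>Completed tensor powers\<close>

context profinite_pronilpotent_lie_algebra
begin

lemma graded_G: "graded_vector_space s (G \<alpha>)"
  using lie[of \<alpha>] by (rule graded_lie_algebra.graded)

sublocale vector_space s
  using graded_G by (simp add: graded_vector_space_def)

lemma subspace_G: "subspace (G \<alpha> i)"
  using graded_G by (simp add: graded_vector_space_def)

text \<open>
  For the empty set this uses that every type is inhabited.
\<close>

lemma upper_bound: "finite (A :: 'a set) \<Longrightarrow> \<exists>\<gamma>. \<forall>\<alpha>\<in>A. \<alpha> \<le> \<gamma>"
proof (induction A rule: finite_induct)
  case (insert \<alpha> A)
  then obtain \<gamma> where "\<forall>\<alpha>\<in>A. \<alpha> \<le> \<gamma>" by blast
  moreover obtain \<delta> where "\<alpha> \<le> \<delta>" "\<gamma> \<le> \<delta>" using directed by blast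
  ultimately have "\<forall>x\<in>insert \<alpha> A. x \<le> \<delta>" by (auto intro: order_trans)
  then show ?case ..
qed simp

lemma below_replicate: "list_all2 (\<le>) \<alpha>s (replicate (length \<alpha>s) \<beta>) \<longleftrightarrow> (\<forall>\<alpha>\<in>set \<alpha>s. \<alpha> \<le> (\<beta> :: 'a))"
  by (auto simp: list_all2_conv_all_nth all_set_conv_all_nth)

abbreviation stage_words :: "'a list \<Rightarrow> ('d, 'v) word set" where
  "stage_words \<alpha>s \<equiv> words (map G \<alpha>s)"

abbreviation stage_space :: "'a list \<Rightarrow> 'd \<Rightarrow> ('d, 'v, 'k) tensor set" where
  "stage_space \<alpha>s \<equiv> tensor_space_deg s (stage_words \<alpha>s)"

lemma stage_words_replicate: "stage_words (replicate n \<beta>) = {w \<in> all_words (G \<beta>). length w = n}"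
  by (simp add: words_replicate)

lemma letters_closed_stage: "letters_closed s (stage_words \<alpha>s)"
  using graded_G by (intro letters_closed_words) auto

lemma letter_map_tr: "\<alpha> \<le> \<beta> \<Longrightarrow> letter_map s s (G \<beta>) (G \<alpha>) (tr \<alpha> \<beta>)"
  by (simp add: letter_map_def tr_closed tr_add tr_scale)

abbreviation tr_word :: "'a list \<Rightarrow> 'a list \<Rightarrow> ('d, 'v) word \<Rightarrow> ('d, 'v) word" where
  "tr_word \<alpha>s \<beta>s w \<equiv> map_word (map2 tr \<alpha>s \<beta>s) w"

lemma tr_word_closed:
  assumes "list_all2 (\<le>) \<alpha>s \<beta>s" "w \<in> stage_words \<beta>s"
  shows "tr_word \<alpha>s \<beta>s w \<in> stage_words \<alpha>s"
proof -
  have l: "length \<alpha>s = length \<beta>s" "length w = length \<beta>s"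
    using assms by (auto simp: list_all2_lengthD words_iff)
  show ?thesis
    using assms(2) l list_all2_nthD[OF assms(1)]
    by (auto simp: words_iff map_word_nth tr_closed)
qed

lemma tr_word_comp:
  assumes ab: "list_all2 (\<le>) \<alpha>s \<beta>s" and bc: "list_all2 (\<le>) \<beta>s \<gamma>s" and w: "w \<in> stage_words \<gamma>s"
  shows "tr_word \<alpha>s \<beta>s (tr_word \<beta>s \<gamma>s w) = tr_word \<alpha>s \<gamma>s w"
proof (rule nth_equalityI)
  have l: "length \<alpha>s = length \<beta>s" "length \<beta>s = length \<gamma>s" "length w = length \<gamma>s"
    using assms by (auto simp: list_all2_lengthD words_iff)
  then show "length (tr_word \<alpha>s \<beta>s (tr_word \<beta>s \<gamma>s w)) = length (tr_word \<alpha>s \<gamma>s w)" by simp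
  fix k assume "k < length (tr_word \<alpha>s \<beta>s (tr_word \<beta>s \<gamma>s w))"
  then have k: "k < length \<gamma>s" using l by simp
  then show "tr_word \<alpha>s \<beta>s (tr_word \<beta>s \<gamma>s w) ! k = tr_word \<alpha>s \<gamma>s w ! k"
    using l w list_all2_nthD2[OF ab, of k] list_all2_nthD2[OF bc, of k]
    by (auto simp: map_word_nth words_iff intro!: tr_comp)
qed

lemma form_pullback:
  fixes \<phi> :: "('d, 'v) word \<Rightarrow> 'k"
  assumes le: "list_all2 (\<le>) \<alpha>s \<beta>s" and \<phi>: "multilinear_form s (stage_words \<alpha>s) \<phi>"
  shows "multilinear_form s (stage_words \<beta>s) (\<lambda>w. \<phi> (tr_word \<alpha>s \<beta>s w))"
proof -
  have l: "length \<alpha>s = length \<beta>s" using le by (rule list_all2_lengthD)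
  let ?fs = "map2 tr \<alpha>s \<beta>s"
  have "multilinear_form s (stage_words \<beta>s) (\<lambda>w. if length w = length ?fs then \<phi> (map_word ?fs w) else 0)"
  proof (rule multilinear_on_map_word)
    show "letter_map s s (map G \<beta>s ! k) (map G \<alpha>s ! k) (?fs ! k)" if "k < length ?fs" for k
      using that l letter_map_tr list_all2_nthD2[OF le] by simp
  qed (use l \<phi> in auto)
  then show ?thesis
    by (rule multilinear_on_cong[OF letters_closed_stage, rotated]) (use l in \<open>simp add: words_iff\<close>)
qed

definition tr_tensor :: "'a list \<Rightarrow> 'a list \<Rightarrow> ('d, 'v, 'k) tensor \<Rightarrow> ('d, 'v, 'k) tensor" where
  "tr_tensor \<alpha>s \<beta>s = dual_map s (stage_words \<alpha>s) (\<lambda>\<phi> w. \<phi> (tr_word \<alpha>s \<beta>s w))"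

lemma tr_tensor_apply:
  "tr_tensor \<alpha>s \<beta>s t \<phi> = (if multilinear_form s (stage_words \<alpha>s) \<phi> then t (\<lambda>w. \<phi> (tr_word \<alpha>s \<beta>s w)) else 0)"
  by (simp add: tr_tensor_def dual_map_def)

lemma stage_space_span:
  "stage_space \<alpha>s d = tensor.span (pure_tensor s (stage_words \<alpha>s) ` {w \<in> stage_words \<alpha>s. word_degree w = d})"
  by (simp add: tensor_space_deg_def)

lemma subspace_stage_space: "tensor.subspace (stage_space \<alpha>s d)"
  by (simp add: stage_space_span)

lemma stage_form_cong:
  assumes "t \<in> stage_space \<alpha>s d" "\<And>w. w \<in> stage_words \<alpha>s \<Longrightarrow> \<phi> w = \<phi>' w"
  shows "t \<phi> = t \<phi>'"
  by (rule tensor_form_cong'[OF letters_closed_stage assms(1)[unfolded stage_space_span]]) (use assms(2) in auto)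

lemma stage_not_multilinear:
  "t \<in> stage_space \<alpha>s d \<Longrightarrow> \<not> multilinear_form s (stage_words \<alpha>s) \<phi> \<Longrightarrow> t \<phi> = 0"
  unfolding stage_space_span by (rule tensor_not_multilinear)

lemma tr_tensor_pure:
  assumes "list_all2 (\<le>) \<alpha>s \<beta>s"
  shows "tr_tensor \<alpha>s \<beta>s (pure_tensor s (stage_words \<beta>s) w) = pure_tensor s (stage_words \<alpha>s) (tr_word \<alpha>s \<beta>s w)"
  using form_pullback[OF assms] by (auto simp: tr_tensor_apply pure_tensor_def fun_eq_iff)

lemma ctensor_power_iff:
  "t \<in> ctensor_power s G tr n d \<longleftrightarrow>
     (\<forall>\<alpha>s. length \<alpha>s = n \<longrightarrow> t \<alpha>s \<in> stage_space \<alpha>s d) \<and> (\<forall>\<alpha>s. length \<alpha>s \<noteq> n \<longrightarrow> t \<alpha>s = 0) \<and>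
     (\<forall>\<alpha>s \<beta>s. list_all2 (\<le>) \<alpha>s \<beta>s \<longrightarrow> tr_tensor \<alpha>s \<beta>s (t \<beta>s) = t \<alpha>s)"
  by (auto simp: ctensor_power_def inverse_limit_def tr_tensor_def)

lemma ctensor_powerD:
  assumes "t \<in> ctensor_power s G tr n d"
  shows "length \<alpha>s = n \<Longrightarrow> t \<alpha>s \<in> stage_space \<alpha>s d"
    and "length \<alpha>s \<noteq> n \<Longrightarrow> t \<alpha>s = 0"
    and "list_all2 (\<le>) \<alpha>s \<beta>s \<Longrightarrow> tr_tensor \<alpha>s \<beta>s (t \<beta>s) = t \<alpha>s"
  using assms unfolding ctensor_power_iff by blast+

lemma tr_tensor_add: "tr_tensor \<alpha>s \<beta>s (t + t') = tr_tensor \<alpha>s \<beta>s t + tr_tensor \<alpha>s \<beta>s t'"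
  and tr_tensor_scale: "tr_tensor \<alpha>s \<beta>s (tensor_scale c t) = tensor_scale c (tr_tensor \<alpha>s \<beta>s t)"
  and tr_tensor_zero: "tr_tensor \<alpha>s \<beta>s 0 = 0"
  unfolding tr_tensor_def by (rule dual_map_add dual_map_scale dual_map_zero)+

lemma cpower_add: "t \<in> ctensor_power s G tr n d \<Longrightarrow> t' \<in> ctensor_power s G tr n d \<Longrightarrow> t + t' \<in> ctensor_power s G tr n d"
  unfolding ctensor_power_iff by (auto simp: tr_tensor_add tensor.subspace_add[OF subspace_stage_space])

lemma cpower_scale: "t \<in> ctensor_power s G tr n d \<Longrightarrow> cpower_scale c t \<in> ctensor_power s G tr n d"
  unfolding ctensor_power_iff
  by (auto simp: pscale_def[of tensor_scale] tr_tensor_scale tensor.subspace_scale[OF subspace_stage_space])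

lemma cpower_zero: "0 \<in> ctensor_power s G tr n d"
  unfolding ctensor_power_iff
  by (auto simp: tr_tensor_zero tensor.subspace_0[OF subspace_stage_space])

lemma cpower_uminus: "t \<in> ctensor_power s G tr n d \<Longrightarrow> - t \<in> ctensor_power s G tr n d"
  using cpower_scale[of t n d "-1"] by (simp add: pscale_def fun_Compl_def)

lemma cpower_diff: "t \<in> ctensor_power s G tr n d \<Longrightarrow> t' \<in> ctensor_power s G tr n d \<Longrightarrow> t - t' \<in> ctensor_power s G tr n d"
  using cpower_add[OF _ cpower_uminus] by fastforce

text \<open>
  Constant lists of indices are cofinal among all lists, by directedness.
\<close>

lemma cpower_eqI:
  assumes "t \<in> ctensor_power s G tr n d" "t' \<in> ctensor_power s G tr n d"
    and eq: "\<And>\<beta>. t (replicate n \<beta>) = t' (replicate n \<beta>)"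
  shows "t = t'"
proof
  fix \<alpha>s
  show "t \<alpha>s = t' \<alpha>s"
  proof (cases "length \<alpha>s = n")
    case True
    obtain \<beta> where "\<forall>\<alpha>\<in>set \<alpha>s. \<alpha> \<le> \<beta>" using upper_bound by blast
    then have "list_all2 (\<le>) \<alpha>s (replicate n \<beta>)" using below_replicate True by blast
    then show ?thesis using ctensor_powerD(3)[OF assms(1)] ctensor_powerD(3)[OF assms(2)] eq by metis
  qed (use assms ctensor_powerD(2) in metis)
qed

lemma perm_act_apply:
  "length \<alpha>s = n \<Longrightarrow> perm_act s G n \<sigma> t \<alpha>s \<phi> = (if multilinear_form s (stage_words \<alpha>s) \<phi>
     then t (permute_list \<sigma> \<alpha>s) (\<lambda>w. koszul_sign \<sigma> (map fst w) * \<phi> (permute_list (inv \<sigma>) w)) else 0)"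
  by (simp add: perm_act_def dual_map_def)

lemma form_permute:
  fixes \<phi> :: "('d, 'v) word \<Rightarrow> 'k"
  assumes \<sigma>: "\<sigma> permutes {..<length \<alpha>s}" and \<phi>: "multilinear_form s (stage_words \<alpha>s) \<phi>"
  shows "multilinear_form s (stage_words (permute_list \<sigma> \<alpha>s)) (\<lambda>w. c (map fst w) * \<phi> (permute_list (inv \<sigma>) w))"
proof (rule multilinear_on_permute_list)
  show "inv \<sigma> permutes {..<length (map G (permute_list \<sigma> \<alpha>s))}" using permutes_inv[OF \<sigma>] by simp
  show "multilinear_form s (words (permute_list (inv \<sigma>) (map G (permute_list \<sigma> \<alpha>s)))) \<phi>"
    using \<phi> permute_list_inv_cancel[OF \<sigma>] permute_list_map[of "inv \<sigma>" "permute_list \<sigma> \<alpha>s" G] permutes_inv[OF \<sigma>]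
    by simp
qed

lemma perm_act_closed:
  assumes \<sigma>: "\<sigma> permutes {..<n}" and t: "t \<in> ctensor_power s G tr n d"
  shows "perm_act s G n \<sigma> t \<in> ctensor_power s G tr n d"
  unfolding ctensor_power_iff
proof (intro conjI allI impI)
  fix \<alpha>s :: "'a list" assume l: "length \<alpha>s = n"
  have \<sigma>': "\<sigma> permutes {..<length \<alpha>s}" using \<sigma> l by simp
  have t': "t (permute_list \<sigma> \<alpha>s) \<in> stage_space (permute_list \<sigma> \<alpha>s) d"
    using ctensor_powerD(1)[OF t] l by simp
  show "perm_act s G n \<sigma> t \<alpha>s \<in> stage_space \<alpha>s d"
    unfolding perm_act_def if_P[OF l] stage_space_span
  proof (rule dual_map_in_span[OF t'[unfolded stage_space_span]])
    show "multilinear_form s (stage_words (permute_list \<sigma> \<alpha>s)) (\<lambda>w. koszul_sign \<sigma> (map fst w) * \<phi> (permute_list (inv \<sigma>) w))"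
      if "multilinear_form s (stage_words \<alpha>s) \<phi>" for \<phi>
      by (rule form_permute[OF \<sigma>' that])
    fix w assume w: "w \<in> {w \<in> stage_words (permute_list \<sigma> \<alpha>s). word_degree w = d}"
    then have lw: "length w = n" using l by (auto simp: words_iff)
    have i: "inv \<sigma> permutes {..<length w}" using permutes_inv[OF \<sigma>] lw by simp
    have "permute_list (inv \<sigma>) w \<in> words (permute_list (inv \<sigma>) (map G (permute_list \<sigma> \<alpha>s)))"
      using w i lw l by (intro words_permute_list) auto
    then have "permute_list (inv \<sigma>) w \<in> {w \<in> stage_words \<alpha>s. word_degree w = d}"
      using w word_degree_permute_list[OF i] permute_list_inv_cancel[OF \<sigma>']
        permute_list_map[of "inv \<sigma>" "permute_list \<sigma> \<alpha>s" G] permutes_inv[OF \<sigma>'] by simp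
    then show "\<exists>c. \<exists>w'\<in>{w \<in> stage_words \<alpha>s. word_degree w = d}. \<forall>\<phi>. multilinear_form s (stage_words \<alpha>s) \<phi> \<longrightarrow>
        koszul_sign \<sigma> (map fst w) * \<phi> (permute_list (inv \<sigma>) w) = c * \<phi> w'"
      by (intro exI[of _ "koszul_sign \<sigma> (map fst w)"] bexI) auto
  qed
next
  fix \<alpha>s :: "'a list" assume "length \<alpha>s \<noteq> n"
  then show "perm_act s G n \<sigma> t \<alpha>s = 0" by (simp add: perm_act_def)
next
  fix \<alpha>s \<beta>s :: "'a list" assume le: "list_all2 (\<le>) \<alpha>s \<beta>s"
  then have l: "length \<alpha>s = length \<beta>s" by (rule list_all2_lengthD)
  show "tr_tensor \<alpha>s \<beta>s (perm_act s G n \<sigma> t \<beta>s) = perm_act s G n \<sigma> t \<alpha>s"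
  proof (cases "length \<alpha>s = n")
    case True
    have \<sigma>a: "\<sigma> permutes {..<length \<alpha>s}" and \<sigma>b: "\<sigma> permutes {..<length \<beta>s}" using \<sigma> True l by simp_all
    have le': "list_all2 (\<le>) (permute_list \<sigma> \<alpha>s) (permute_list \<sigma> \<beta>s)"
      using list_all2_permute_list_iff[OF \<sigma>a] le by blast
    show ?thesis
    proof
      fix \<phi> :: "('d, 'v) word \<Rightarrow> 'k"
      show "tr_tensor \<alpha>s \<beta>s (perm_act s G n \<sigma> t \<beta>s) \<phi> = perm_act s G n \<sigma> t \<alpha>s \<phi>"
      proof (cases "multilinear_form s (stage_words \<alpha>s) \<phi>")
        case mult: True
        let ?\<phi> = "\<lambda>w. koszul_sign \<sigma> (map fst w) * \<phi> (permute_list (inv \<sigma>) w)"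
        have "perm_act s G n \<sigma> t \<alpha>s \<phi> = tr_tensor (permute_list \<sigma> \<alpha>s) (permute_list \<sigma> \<beta>s) (t (permute_list \<sigma> \<beta>s)) ?\<phi>"
          using True mult ctensor_powerD(3)[OF t le'] by (simp add: perm_act_apply)
        also have "\<dots> = t (permute_list \<sigma> \<beta>s) (\<lambda>w. ?\<phi> (tr_word (permute_list \<sigma> \<alpha>s) (permute_list \<sigma> \<beta>s) w))"
          using form_permute[OF \<sigma>a mult] by (simp add: tr_tensor_apply)
        also have "\<dots> = t (permute_list \<sigma> \<beta>s) (\<lambda>w. koszul_sign \<sigma> (map fst w) * \<phi> (tr_word \<alpha>s \<beta>s (permute_list (inv \<sigma>) w)))"
        proof (rule stage_form_cong[OF ctensor_powerD(1)[OF t, of "permute_list \<sigma> \<beta>s"]])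
          show "length (permute_list \<sigma> \<beta>s) = n" using True l by simp
          fix w assume w: "w \<in> stage_words (permute_list \<sigma> \<beta>s)"
          then have lw: "length w = length \<beta>s" by (simp add: words_iff)
          let ?f = "map2 tr (permute_list \<sigma> \<alpha>s) (permute_list \<sigma> \<beta>s)"
          have f: "?f = permute_list \<sigma> (map2 tr \<alpha>s \<beta>s)"
            using permute_list_map[of \<sigma> "zip \<alpha>s \<beta>s" "case_prod tr"] permute_list_zip[OF \<sigma>b, of \<alpha>s \<beta>s] \<sigma>a l by simp
          have "permute_list (inv \<sigma>) (map_word ?f w) = map_word (permute_list (inv \<sigma>) ?f) (permute_list (inv \<sigma>) w)"
            using lw l permutes_inv[OF \<sigma>b] by (intro map_word_permute_list[symmetric]) auto
          also have "permute_list (inv \<sigma>) ?f = map2 tr \<alpha>s \<beta>s"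
            unfolding f using permute_list_inv_cancel[of \<sigma> "map2 tr \<alpha>s \<beta>s"] \<sigma>b l by simp
          finally show "?\<phi> (tr_word (permute_list \<sigma> \<alpha>s) (permute_list \<sigma> \<beta>s) w) =
              koszul_sign \<sigma> (map fst w) * \<phi> (tr_word \<alpha>s \<beta>s (permute_list (inv \<sigma>) w))"
            using lw l by (simp add: map_fst_map_word)
        qed
        also have "\<dots> = perm_act s G n \<sigma> t \<beta>s (\<lambda>w. \<phi> (tr_word \<alpha>s \<beta>s w))"
          using True l form_pullback[OF le mult] by (simp add: perm_act_apply)
        finally show ?thesis using mult by (simp add: tr_tensor_apply)
      qed (use True in \<open>simp add: tr_tensor_apply perm_act_apply\<close>)
    qed
  qed (use l in \<open>simp add: perm_act_def tr_tensor_zero\<close>)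
qed

lemma symmetrize_closed:
  assumes "t \<in> ctensor_power s G tr n d" shows "symmetrize s G n t \<in> ctensor_power s G tr n d"
proof -
  have "(\<Sum>\<sigma>\<in>P. perm_act s G n \<sigma> t) \<in> ctensor_power s G tr n d" if "P \<subseteq> {\<sigma>. \<sigma> permutes {..<n}}" for P
    using that
    by (induction P rule: infinite_finite_induct) (auto intro: cpower_zero cpower_add perm_act_closed assms)
  then show ?thesis by (simp add: symmetrize_def)
qed

lemma perm_act_add: "perm_act s G n \<sigma> (t + t') = perm_act s G n \<sigma> t + perm_act s G n \<sigma> t'"
  by (auto simp: perm_act_def fun_eq_iff dual_map_def)

lemma perm_act_cscale: "perm_act s G n \<sigma> (cpower_scale c t) = cpower_scale c (perm_act s G n \<sigma> t)"
  by (auto simp: perm_act_def fun_eq_iff dual_map_def pscale_def)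

lemma symmetrize_add: "symmetrize s G n (t + t') = symmetrize s G n t + symmetrize s G n t'"
  by (simp add: symmetrize_def perm_act_add sum.distrib)

lemma symmetrize_scale: "symmetrize s G n (cpower_scale c t) = cpower_scale c (symmetrize s G n t)"
  unfolding symmetrize_def perm_act_cscale
  by (auto simp: pscale_def fun_eq_iff sum_fun_apply sum_distrib_left)

lemma form_word_symmetrize:
  assumes \<phi>: "multilinear_form s (stage_words (replicate n \<beta>)) \<phi>"
  shows "multilinear_form s (stage_words (replicate n \<beta>)) (word_symmetrize (*) \<phi>)"
proof -
  have "multilinear_form s (stage_words (replicate n \<beta>)) (\<lambda>w. koszul_sign \<sigma> (map fst w) * \<phi> (permute_list (inv \<sigma>) w))"
    if "\<sigma> permutes {..<n}" for \<sigma>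
    using form_permute[of \<sigma> "replicate n \<beta>" \<phi> "koszul_sign \<sigma>"] that \<phi> by (simp add: permute_list_replicate)
  then have "multilinear_form s (stage_words (replicate n \<beta>))
      (\<lambda>w. \<Sum>\<sigma> | \<sigma> permutes {..<n}. 1 * (koszul_sign \<sigma> (map fst w) * \<phi> (permute_list (inv \<sigma>) w)))"
    by (intro multilinear_form_combination) auto
  then show ?thesis
    by (rule multilinear_on_cong[OF letters_closed_stage, rotated]) (simp add: word_symmetrize_def words_iff)
qed

text \<open>
  At a constant list of indices the permutation of indices disappears, and symmetrization of tensors is dual to symmetrization of
  forms.
\<close>

lemma symmetrize_apply:
  assumes t: "t \<in> ctensor_power s G tr n d" and \<phi>: "multilinear_form s (stage_words (replicate n \<beta>)) \<phi>"
  shows "symmetrize s G n t (replicate n \<beta>) \<phi> = t (replicate n \<beta>) (word_symmetrize (*) \<phi>)"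
proof -
  let ?f = "\<lambda>\<sigma> w. koszul_sign \<sigma> (map fst w) * \<phi> (permute_list (inv \<sigma>) w)"
  have T: "t (replicate n \<beta>) \<in> stage_space (replicate n \<beta>) d"
    by (rule ctensor_powerD(1)[OF t]) simp
  have f: "multilinear_form s (stage_words (replicate n \<beta>)) (?f \<sigma>)" if "\<sigma> permutes {..<n}" for \<sigma>
    using form_permute[of \<sigma> "replicate n \<beta>" \<phi> "koszul_sign \<sigma>"] that \<phi> by (simp add: permute_list_replicate)
  have "symmetrize s G n t (replicate n \<beta>) \<phi> = (\<Sum>\<sigma> | \<sigma> permutes {..<n}. 1 * t (replicate n \<beta>) (?f \<sigma>))"
    unfolding symmetrize_def sum_fun_apply
    using \<phi> by (intro sum.cong refl) (simp add: perm_act_apply permute_list_replicate)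
  also have "\<dots> = t (replicate n \<beta>) (\<lambda>w. \<Sum>\<sigma> | \<sigma> permutes {..<n}. 1 * ?f \<sigma> w)"
    by (rule tensor_form_combination[OF T[unfolded stage_space_span], symmetric]) (rule f, simp)
  also have "\<dots> = t (replicate n \<beta>) (word_symmetrize (*) \<phi>)"
    by (rule stage_form_cong[OF T]) (simp add: word_symmetrize_def words_iff)
  finally show ?thesis .
qed

lemma symmetrize_twice:
  assumes t: "t \<in> ctensor_power s G tr n d"
  shows "symmetrize s G n (symmetrize s G n t) = cpower_scale (of_nat (fact n)) (symmetrize s G n t)"
proof (rule cpower_eqI)
  note St = symmetrize_closed[OF t]
  show "symmetrize s G n (symmetrize s G n t) \<in> ctensor_power s G tr n d" by (rule symmetrize_closed[OF St])
  show "cpower_scale (of_nat (fact n)) (symmetrize s G n t) \<in> ctensor_power s G tr n d" by (rule cpower_scale[OF St])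
  fix \<beta> :: 'a
  let ?b = "replicate n \<beta>"
  have T: "t ?b \<in> stage_space ?b d" by (rule ctensor_powerD(1)[OF t]) simp
  show "symmetrize s G n (symmetrize s G n t) ?b = cpower_scale (of_nat (fact n)) (symmetrize s G n t) ?b"
  proof
    fix \<phi>
    show "symmetrize s G n (symmetrize s G n t) ?b \<phi> = cpower_scale (of_nat (fact n)) (symmetrize s G n t) ?b \<phi>"
    proof (cases "multilinear_form s (stage_words ?b) \<phi>")
      case True
      have "symmetrize s G n (symmetrize s G n t) ?b \<phi> = t ?b (word_symmetrize (*) (word_symmetrize (*) \<phi>))"
        using symmetrize_apply[OF St True] symmetrize_apply[OF t form_word_symmetrize[OF True]] by simp
      also have "\<dots> = t ?b (\<lambda>w. \<Sum>j\<in>{()}. of_nat (fact n) * word_symmetrize (*) \<phi> w)"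
        by (rule stage_form_cong[OF T]) (simp add: vector_space.word_symmetrize_twice[OF vector_space_mult] words_iff)
      also have "\<dots> = of_nat (fact n) * t ?b (word_symmetrize (*) \<phi>)"
          using tensor_form_combination[OF T[unfolded stage_space_span], of "{()}" "\<lambda>_. word_symmetrize (*) \<phi>"
            "\<lambda>_. of_nat (fact n)"] form_word_symmetrize[OF True] by simp
      also have "t ?b (word_symmetrize (*) \<phi>) = symmetrize s G n t ?b \<phi>"
        by (rule symmetrize_apply[OF t True, symmetric])
      finally show ?thesis by (simp add: pscale_def)
    next
      case False
      have "u ?b \<phi> = 0" if "u \<in> ctensor_power s G tr n d" for u
        by (rule stage_not_multilinear[OF ctensor_powerD(1)[OF that] False]) simp
      from this[OF St] this[OF symmetrize_closed[OF St]] show ?thesis by (simp add: pscale_def)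
    qed
  qed
qed

end

section \<open>Density of the uncompleted tensor algebra\<close>

context profinite_pronilpotent_lie_algebra
begin

lemma lie_limit_iff:
  "x \<in> lie_limit G tr i \<longleftrightarrow> (\<forall>\<alpha>. x \<alpha> \<in> G \<alpha> i) \<and> (\<forall>\<alpha> \<beta>. \<alpha> \<le> \<beta> \<longrightarrow> tr \<alpha> \<beta> i (x \<beta>) = x \<alpha>)"
  by (simp add: lie_limit_def inverse_limit_def)

lemma tr_zero: "\<alpha> \<le> \<beta> \<Longrightarrow> tr \<alpha> \<beta> i 0 = 0"
  using tr_scale[of \<alpha> \<beta> 0 i 0] subspace_0[OF subspace_G] by simp

lemma graded_limit: "graded_vector_space (pscale s) (lie_limit G tr)"
  unfolding graded_vector_space_def
proof (intro conjI allI)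
  show "vector_space (pscale s :: 'k \<Rightarrow> ('a \<Rightarrow> 'v) \<Rightarrow> _)" by (rule vector_space_pscale[OF vector_space_axioms])
  then interpret L: vector_space "pscale s :: 'k \<Rightarrow> ('a \<Rightarrow> 'v) \<Rightarrow> _" .
  show "L.subspace (lie_limit G tr i)" for i
    by (rule L.subspaceI)
      (auto simp: lie_limit_iff pscale_def tr_zero tr_add tr_scale
        subspace_0[OF subspace_G] subspace_add[OF subspace_G] subspace_scale[OF subspace_G])
qed

lemma limit_bracket_closed:
  "x \<in> lie_limit G tr i \<Longrightarrow> y \<in> lie_limit G tr j \<Longrightarrow> lie_limit_bracket br i j x y \<in> lie_limit G tr (i + j)"
  by (auto simp: lie_limit_iff lie_limit_bracket_def tr_bracket graded_lie_algebra.br_closed[OF lie])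

sublocale limit: graded_bracket "pscale s" "lie_limit G tr" "lie_limit_bracket br"
  by (intro graded_bracket.intro graded_limit limit_bracket_closed)

abbreviation limit_words :: "('d, 'a \<Rightarrow> 'v) word set" where
  "limit_words \<equiv> all_words (lie_limit G tr)"

abbreviation limit_space :: "'d \<Rightarrow> ('d, 'a \<Rightarrow> 'v, 'k) tensor set" where
  "limit_space \<equiv> tensor_space_deg (pscale s) limit_words"

abbreviation proj_word :: "'a list \<Rightarrow> ('d, 'a \<Rightarrow> 'v) word \<Rightarrow> ('d, 'v) word" where
  "proj_word \<alpha>s w \<equiv> map_word (map (\<lambda>\<alpha> i x. x \<alpha>) \<alpha>s) w"

lemma limit_space_span:
  "limit_space d = tensor.span (limit.pure ` {w \<in> limit_words. word_degree w = d})"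
  by (simp add: tensor_space_deg_def)

lemma subspace_limit_space: "tensor.subspace (limit_space d)"
  by (simp add: limit_space_span)

lemma limit_form_cong:
  assumes "t \<in> limit_space d" "\<And>w. w \<in> limit_words \<Longrightarrow> \<phi> w = \<phi>' w"
  shows "t \<phi> = t \<phi>'"
  by (rule tensor_form_cong'[OF letters_closed_all_words[OF graded_limit] assms(1)[unfolded limit_space_span]])
     (use assms(2) in auto)

lemma proj_word_closed:
  assumes "w \<in> limit_words" "length w = length \<alpha>s"
  shows "proj_word \<alpha>s w \<in> stage_words \<alpha>s"
  using assms by (auto simp: words_iff map_word_nth all_words_eq all_set_conv_all_nth case_prod_beta lie_limit_iff)

lemma tr_proj_word:
  assumes le: "list_all2 (\<le>) \<alpha>s \<beta>s" and w: "w \<in> limit_words" "length w = length \<alpha>s"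
  shows "tr_word \<alpha>s \<beta>s (proj_word \<beta>s w) = proj_word \<alpha>s w"
proof (rule nth_equalityI)
  have l: "length \<alpha>s = length \<beta>s" using le by (rule list_all2_lengthD)
  show "length (tr_word \<alpha>s \<beta>s (proj_word \<beta>s w)) = length (proj_word \<alpha>s w)" using l w by simp
  fix k assume "k < length (tr_word \<alpha>s \<beta>s (proj_word \<beta>s w))"
  then have k: "k < length \<beta>s" using l by simp
  have "snd (w ! k) \<in> lie_limit G tr (fst (w ! k))"
    using w k l by (auto simp: all_words_eq all_set_conv_all_nth case_prod_beta)
  then show "tr_word \<alpha>s \<beta>s (proj_word \<beta>s w) ! k = proj_word \<alpha>s w ! k"
    using k l w list_all2_nthD2[OF le, of k] by (simp add: map_word_nth lie_limit_iff)
qed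

lemma form_proj:
  assumes "multilinear_form s (stage_words \<alpha>s) \<phi>"
  shows "multilinear_form (pscale s) limit_words (\<lambda>w. if length w = length \<alpha>s then \<phi> (proj_word \<alpha>s w) else 0)"
proof -
  let ?fs = "map (\<lambda>\<alpha> i x. x \<alpha>) \<alpha>s :: ('d \<Rightarrow> ('a \<Rightarrow> 'v) \<Rightarrow> 'v) list"
  have "multilinear_form (pscale s) limit_words (\<lambda>w. if length w = length ?fs then \<phi> (map_word ?fs w) else 0)"
  proof (rule multilinear_on_map_word[where Vs' = "map G \<alpha>s" and s' = s])
    show "w \<in> words (replicate (length \<alpha>s) (lie_limit G tr))" if "w \<in> limit_words" "length w = length ?fs" for w
      using that by (simp add: words_replicate)
    show "letter_map (pscale s) s (replicate (length \<alpha>s) (lie_limit G tr) ! k) (map G \<alpha>s ! k) (?fs ! k)"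
      if "k < length ?fs" for k
      using that by (auto simp: letter_map_def lie_limit_iff pscale_def)
  qed (use assms in auto)
  then show ?thesis by simp
qed

lemma incl_apply:
  "length \<alpha>s = n \<Longrightarrow> tensor_incl s G t n \<alpha>s \<phi> = (if multilinear_form s (stage_words \<alpha>s) \<phi>
     then t (\<lambda>w. if length w = n then \<phi> (proj_word \<alpha>s w) else 0) else 0)"
  by (simp add: tensor_incl_def dual_map_def)

lemma incl_other_length: "length \<alpha>s \<noteq> n \<Longrightarrow> tensor_incl s G t n \<alpha>s = 0"
  by (simp add: tensor_incl_def)

lemma incl_add: "tensor_incl s G (t + t') = tensor_incl s G t + tensor_incl s G t'"
  by (auto simp: tensor_incl_def fun_eq_iff dual_map_def)

lemma incl_scale: "tensor_incl s G (tensor_scale c t) = calgebra_scale c (tensor_incl s G t)"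
  by (auto simp: tensor_incl_def fun_eq_iff dual_map_def pscale_def)

lemma incl_zero: "tensor_incl s G 0 = 0"
  by (auto simp: tensor_incl_def fun_eq_iff dual_map_def)

lemma incl_pure:
  assumes "length \<alpha>s = n"
  shows "tensor_incl s G (limit.pure w) n \<alpha>s =
    (if length w = n then pure_tensor s (stage_words \<alpha>s) (proj_word \<alpha>s w) else 0)"
proof
  fix \<phi>
  show "tensor_incl s G (limit.pure w) n \<alpha>s \<phi> =
      (if length w = n then pure_tensor s (stage_words \<alpha>s) (proj_word \<alpha>s w) else 0) \<phi>"
    unfolding incl_apply[OF assms] using form_proj[of \<alpha>s \<phi>] assms by (simp add: pure_tensor_def)
qed

lemma incl_closed:
  assumes t: "t \<in> limit_space d"
  shows "tensor_incl s G t n \<in> ctensor_power s G tr n d"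
  unfolding ctensor_power_iff
proof (intro conjI allI impI)
  fix \<alpha>s :: "'a list" assume l: "length \<alpha>s = n"
  define \<Psi> where "\<Psi> w = tensor_incl s G (limit.pure w) n \<alpha>s" for w
  have \<Psi>: "multilinear_form s (stage_words \<alpha>s) \<phi> \<Longrightarrow> \<Psi> w \<phi> = (if length w = n then \<phi> (proj_word \<alpha>s w) else 0)"
    "\<not> multilinear_form s (stage_words \<alpha>s) \<phi> \<Longrightarrow> \<Psi> w \<phi> = 0" for w \<phi>
    unfolding \<Psi>_def incl_pure[OF l] by (simp_all add: pure_tensor_def)
  have "tensor_incl s G t n \<alpha>s = (\<lambda>\<phi>. t (\<lambda>w. \<Psi> w \<phi>))"
  proof
    fix \<phi>
    show "tensor_incl s G t n \<alpha>s \<phi> = t (\<lambda>w. \<Psi> w \<phi>)"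
      using tensor_zero_form[OF t[unfolded limit_space_span]]
      by (cases "multilinear_form s (stage_words \<alpha>s) \<phi>") (simp_all add: \<Psi> incl_apply[OF l])
  qed
  also have "\<dots> \<in> stage_space \<alpha>s d"
  proof (rule tensor_bind_in_subspace[OF t[unfolded limit_space_span]])
    show "multilinear_form (pscale s) limit_words (\<lambda>w. \<Psi> w \<phi>)" for \<phi>
      using form_proj[of \<alpha>s \<phi>] l by (cases "multilinear_form s (stage_words \<alpha>s) \<phi>") (simp_all add: \<Psi>)
    fix w assume w: "w \<in> {w \<in> limit_words. word_degree w = d}"
    show "\<Psi> w \<in> stage_space \<alpha>s d"
    proof (cases "length w = n")
      case True
      have "proj_word \<alpha>s w \<in> {w \<in> stage_words \<alpha>s. word_degree w = d}"
        using w l True proj_word_closed by (auto simp: word_degree_map_word)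
      then have "pure_tensor s (stage_words \<alpha>s) (proj_word \<alpha>s w) \<in> stage_space \<alpha>s d"
        unfolding stage_space_span by (intro tensor.span_base imageI)
      then show ?thesis using True by (simp add: \<Psi>_def incl_pure[OF l])
    next
      case False
      then show ?thesis
        using tensor.subspace_0[OF subspace_stage_space] by (simp add: \<Psi>_def incl_pure[OF l])
    qed
  qed (rule subspace_stage_space)
  finally show "tensor_incl s G t n \<alpha>s \<in> stage_space \<alpha>s d" .
next
  fix \<alpha>s \<beta>s :: "'a list" assume le: "list_all2 (\<le>) \<alpha>s \<beta>s"
  then have l: "length \<alpha>s = length \<beta>s" by (rule list_all2_lengthD)
  show "tr_tensor \<alpha>s \<beta>s (tensor_incl s G t n \<beta>s) = tensor_incl s G t n \<alpha>s"
  proof (cases "length \<alpha>s = n")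
    case True
    have lb: "length \<beta>s = n" using True l by simp
    show ?thesis
    proof
      fix \<phi> :: "('d, 'v) word \<Rightarrow> 'k"
      show "tr_tensor \<alpha>s \<beta>s (tensor_incl s G t n \<beta>s) \<phi> = tensor_incl s G t n \<alpha>s \<phi>"
      proof (cases "multilinear_form s (stage_words \<alpha>s) \<phi>")
        case mult: True
        have "t (\<lambda>w. if length w = n then \<phi> (tr_word \<alpha>s \<beta>s (proj_word \<beta>s w)) else 0)
            = t (\<lambda>w. if length w = n then \<phi> (proj_word \<alpha>s w) else 0)"
          using tr_proj_word[OF le] True by (intro limit_form_cong[OF t]) auto
        then show ?thesis
          using form_pullback[OF le mult] mult by (simp add: tr_tensor_apply incl_apply[OF True] incl_apply[OF lb])
      qed (simp add: tr_tensor_apply incl_apply[OF True])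
    qed
  qed (use l in \<open>simp add: incl_other_length tr_tensor_zero\<close>)
qed (simp add: incl_other_length)

text \<open>
  Rearranging letters commutes with the projection to a constant list of stages.
\<close>

lemma incl_symmetrize:
  assumes w: "w \<in> limit_words" "word_degree w = d"
  shows "word_symmetrize tensor_scale limit.pure w \<in> limit_space d"
    and "tensor_incl s G (word_symmetrize tensor_scale limit.pure w) n = symmetrize s G n (tensor_incl s G (limit.pure w) n)"
proof -
  have perm: "permute_list (inv \<sigma>) w \<in> limit_words" "word_degree (permute_list (inv \<sigma>) w) = d"
    if "\<sigma> permutes {..<length w}" for \<sigma>
    using that w by (auto intro: all_words_permute_list permutes_inv simp: word_degree_permute_list permutes_inv)
  have pure: "limit.pure w \<in> limit_space d"
    unfolding limit_space_span using w by (intro tensor.span_base) auto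
  show S: "word_symmetrize tensor_scale limit.pure w \<in> limit_space d"
    unfolding word_symmetrize_def limit_space_span using perm
    by (intro tensor.span_sum tensor.span_scale tensor.span_base) auto
  show "tensor_incl s G (word_symmetrize tensor_scale limit.pure w) n = symmetrize s G n (tensor_incl s G (limit.pure w) n)"
  proof (rule cpower_eqI)
    show "tensor_incl s G (word_symmetrize tensor_scale limit.pure w) n \<in> ctensor_power s G tr n d"
      by (rule incl_closed[OF S])
    show Sp: "symmetrize s G n (tensor_incl s G (limit.pure w) n) \<in> ctensor_power s G tr n d"
      by (rule symmetrize_closed[OF incl_closed[OF pure]])
    fix \<beta> :: 'a
    let ?b = "replicate n \<beta>"
    have l: "length ?b = n" by simp
    show "tensor_incl s G (word_symmetrize tensor_scale limit.pure w) n ?b = symmetrize s G n (tensor_incl s G (limit.pure w) n) ?b"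
    proof
      fix \<phi> :: "('d, 'v) word \<Rightarrow> 'k"
      let ?\<phi> = "\<lambda>w. if length w = n then \<phi> (proj_word ?b w) else 0"
      show "tensor_incl s G (word_symmetrize tensor_scale limit.pure w) n ?b \<phi> = symmetrize s G n (tensor_incl s G (limit.pure w) n) ?b \<phi>"
      proof (cases "multilinear_form s (stage_words ?b) \<phi>")
        case True
        have m: "multilinear_form (pscale s) limit_words ?\<phi>" using form_proj[OF True] unfolding l .
        have "tensor_incl s G (word_symmetrize tensor_scale limit.pure w) n ?b \<phi> = word_symmetrize tensor_scale limit.pure w ?\<phi>"
          unfolding incl_apply[OF l] if_P[OF True] ..
        also have "\<dots> = word_symmetrize (*) ?\<phi> w"
          using m by (simp add: word_symmetrize_def sum_fun_apply pscale_def pure_tensor_def)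
        also have "\<dots> = (if length w = n then word_symmetrize (*) \<phi> (proj_word ?b w) else 0)"
        proof (cases "length w = n")
          case True
          have "proj_word ?b (permute_list (inv \<sigma>) w) = permute_list (inv \<sigma>) (proj_word ?b w)"
            if "\<sigma> permutes {..<n}" for \<sigma>
          proof -
            have i: "inv \<sigma> permutes {..<n}" using that by (rule permutes_inv)
            show ?thesis
              using map_word_permute_list[of "inv \<sigma>" w "map (\<lambda>\<alpha> i x. x \<alpha>) ?b"] i True
              by (simp add: permute_list_replicate)
          qed
          then show ?thesis using True
            by (simp add: word_symmetrize_def map_fst_map_word)
        next
          case False
          then show ?thesis by (simp add: word_symmetrize_def)
        qed
        also have "\<dots> = tensor_incl s G (limit.pure w) n ?b (word_symmetrize (*) \<phi>)"
          unfolding incl_pure[OF l] using form_word_symmetrize[OF True] by (simp add: pure_tensor_def)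
        also have "\<dots> = symmetrize s G n (tensor_incl s G (limit.pure w) n) ?b \<phi>"
          by (rule symmetrize_apply[OF incl_closed[OF pure] True, symmetric])
        finally show ?thesis .
      next
        case False
        from stage_not_multilinear[OF ctensor_powerD(1)[OF Sp l] False]
        show ?thesis unfolding incl_apply[OF l] if_not_P[OF False] by simp
      qed
    qed
  qed
qed

text \<open>
  By surjectivity of the projections, each letter lifts to the limit algebra.
\<close>

lemma lift_word:
  assumes "w \<in> stage_words (replicate n \<beta>)"
  obtains w' where "w' \<in> limit_words" "length w' = n" "word_degree w' = word_degree w"
    "proj_word (replicate n \<beta>) w' = w"
proof -
  have "\<exists>y\<in>lie_limit G tr i. y \<beta> = x" if "x \<in> G \<beta> i" for i x
    using that proj_surj[of \<beta> i, symmetric] by auto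
  then have ex: "\<exists>y. y \<in> lie_limit G tr i \<and> y \<beta> = x" if "x \<in> G \<beta> i" for i x
    using that by blast
  define f where "f i x = (SOME y. y \<in> lie_limit G tr i \<and> y \<beta> = x)" for i x
  have f: "f i x \<in> lie_limit G tr i \<and> f i x \<beta> = x" if "x \<in> G \<beta> i" for i x
    unfolding f_def by (rule someI_ex[OF ex[OF that]])
  let ?w = "map (\<lambda>p. (fst p, f (fst p) (snd p))) w"
  have w: "w \<in> all_words (G \<beta>)" "length w = n" using assms by (auto simp: stage_words_replicate simp del: map_replicate)
  show thesis
  proof
    show "?w \<in> limit_words" using w f by (auto simp: all_words_eq)
    show "length ?w = n" using w by simp
    show "word_degree ?w = word_degree w" by (simp add: word_degree_def comp_def)
    show "proj_word (replicate n \<beta>) ?w = w"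
      using w f by (intro nth_equalityI) (auto simp: map_word_nth all_words_eq all_set_conv_all_nth case_prod_beta prod_eq_iff)
  qed
qed

lemma lift_tensor:
  assumes "t \<in> stage_space (replicate n \<beta>) d"
  shows "\<exists>t'\<in>limit_space d. tensor_incl s G t' n (replicate n \<beta>) = t \<and> (\<forall>m. m \<noteq> n \<longrightarrow> tensor_incl s G t' m = 0)"
  using assms unfolding stage_space_span
proof (induction rule: tensor.span_induct_alt)
  case base
  show ?case
    by (intro bexI[OF _ tensor.subspace_0[OF subspace_limit_space]]) (simp add: incl_zero del: zero_fun_apply, simp)
next
  case (step c p t)
  then obtain t' where t': "t' \<in> limit_space d" "tensor_incl s G t' n (replicate n \<beta>) = t"
    "\<And>m. m \<noteq> n \<Longrightarrow> tensor_incl s G t' m = 0" by blast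
  obtain w where w: "w \<in> stage_words (replicate n \<beta>)" "word_degree w = d" "p = pure_tensor s (stage_words (replicate n \<beta>)) w"
    using step by blast
  obtain w' where w': "w' \<in> limit_words" "length w' = n" "word_degree w' = word_degree w" "proj_word (replicate n \<beta>) w' = w"
    using lift_word[OF w(1)] .
  have "limit.pure w' \<in> limit_space d"
    unfolding limit_space_span using w w' by (intro tensor.span_base) auto
  then have "tensor_scale c (limit.pure w') + t' \<in> limit_space d"
    using t'(1) by (intro tensor.subspace_add tensor.subspace_scale subspace_limit_space)
  moreover have "tensor_incl s G (limit.pure w') n (replicate n \<beta>) = p"
    using incl_pure[of "replicate n \<beta>" n w'] w w' by simp
  then have "tensor_incl s G (tensor_scale c (limit.pure w') + t') n (replicate n \<beta>) = tensor_scale c p + t"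
    using t'(2) by (simp add: incl_add incl_scale pscale_def[of cpower_scale] pscale_def[of tensor_scale])
  moreover have "tensor_incl s G (tensor_scale c (limit.pure w') + t') m = 0" if "m \<noteq> n" for m
  proof -
    have "tensor_incl s G (limit.pure w') m = 0"
    proof
      show "tensor_incl s G (limit.pure w') m \<alpha>s = 0 \<alpha>s" for \<alpha>s
        using that w'(2) by (cases "length \<alpha>s = m") (simp_all add: incl_pure incl_other_length)
    qed
    then show ?thesis using t'(3)[OF that]
      unfolding incl_add incl_scale by (simp add: pscale_def fun_eq_iff)
  qed
  ultimately show ?case by blast
qed

text \<open>
  The finitely many coordinates are determined by those at constant lists \<open>[\<beta>, \<dots>, \<beta>]\<close> for one large \<open>\<beta>\<close>, and tensors over
  \<open>\<gg>\<^sub>\<beta>\<close> lift to tensors over the limit algebra.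
\<close>

lemma incl_dense:
  assumes x: "\<And>n. x n \<in> ctensor_power s G tr n d" and F: "finite F"
  shows "\<exists>t\<in>limit_space d. agree_on F (tensor_incl s G t) x"
proof -
  have "finite (\<Union>p\<in>F. set (snd p))" using F by simp
  from upper_bound[OF this] obtain \<beta> where "\<forall>\<alpha>\<in>\<Union>p\<in>F. set (snd p). \<alpha> \<le> \<beta>" ..
  then have \<beta>: "\<And>p \<alpha>. p \<in> F \<Longrightarrow> \<alpha> \<in> set (snd p) \<Longrightarrow> \<alpha> \<le> \<beta>" by blast
  have "\<exists>t\<in>limit_space d. (\<forall>n\<in>N. tensor_incl s G t n (replicate n \<beta>) = x n (replicate n \<beta>)) \<and>
      (\<forall>n. n \<notin> N \<longrightarrow> tensor_incl s G t n = 0)" if "finite N" for N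
    using that
  proof (induction N rule: finite_induct)
    case empty
    show ?case
      by (intro bexI[OF _ tensor.subspace_0[OF subspace_limit_space]]) (simp add: incl_zero del: zero_fun_apply, simp)
  next
    case (insert n N)
    then obtain t where t: "t \<in> limit_space d" "\<And>k. k \<in> N \<Longrightarrow> tensor_incl s G t k (replicate k \<beta>) = x k (replicate k \<beta>)"
      "\<And>k. k \<notin> N \<Longrightarrow> tensor_incl s G t k = 0" by blast
    have "x n (replicate n \<beta>) \<in> stage_space (replicate n \<beta>) d"
      by (rule ctensor_powerD(1)[OF x]) simp
    from lift_tensor[OF this] obtain t' where t': "t' \<in> limit_space d"
      "tensor_incl s G t' n (replicate n \<beta>) = x n (replicate n \<beta>)" "\<And>k. k \<noteq> n \<Longrightarrow> tensor_incl s G t' k = 0"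
      by blast
    have "t' + t \<in> limit_space d" using t t' by (intro tensor.subspace_add subspace_limit_space)
    moreover have "tensor_incl s G (t' + t) k (replicate k \<beta>) = x k (replicate k \<beta>)" if "k \<in> insert n N" for k
      using that t t' insert.hyps(2) by (cases "k = n") (auto simp: incl_add)
    moreover have "tensor_incl s G (t' + t) k = 0" if "k \<notin> insert n N" for k
      using that t t' by (simp add: incl_add)
    ultimately show ?case by blast
  qed
  from this[of "fst ` F"] F obtain t where t: "t \<in> limit_space d"
    "\<And>n. n \<in> fst ` F \<Longrightarrow> tensor_incl s G t n (replicate n \<beta>) = x n (replicate n \<beta>)" by blast
  have "tensor_incl s G t n \<alpha>s = x n \<alpha>s" if p: "(n, \<alpha>s) \<in> F" for n \<alpha>s
  proof (cases "length \<alpha>s = n")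
    case True
    have "\<forall>\<alpha>\<in>set \<alpha>s. \<alpha> \<le> \<beta>" using \<beta>[OF p] by simp
    then have le: "list_all2 (\<le>) \<alpha>s (replicate n \<beta>)" using below_replicate True by blast
    have "n \<in> fst ` F" using p by force
    then show ?thesis
      using ctensor_powerD(3)[OF incl_closed[OF t(1)] le] ctensor_powerD(3)[OF x le] t(2) by metis
  next
    case False
    then show ?thesis by (simp add: incl_other_length ctensor_powerD(2)[OF x False])
  qed
  then show ?thesis using t(1) by (intro bexI[of _ t]) (auto simp: agree_on_def)
qed

end

section \<open>The retraction onto symmetric tensors\<close>

context profinite_pronilpotent_lie_algebra
begin

abbreviation below :: "'a list \<Rightarrow> 'a \<Rightarrow> bool" where
  "below \<alpha>s \<beta> \<equiv> list_all2 (\<le>) \<alpha>s (replicate (length \<alpha>s) \<beta>)"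

lemma tr_word_replicate:
  "length w = n \<Longrightarrow> tr_word (replicate n \<beta>) (replicate n \<gamma>) w = map (\<lambda>p. (fst p, tr \<beta> \<gamma> (fst p) (snd p))) w"
  by (rule nth_equalityI) (auto simp: map_word_nth)

text \<open>
  The projection from words over \<open>\<gg>\<^sub>\<beta>\<close> to \<open>\<gg>\<^bsub>\<alpha>\<^sub>1\<^esub> \<otimes> \<dots> \<otimes> \<gg>\<^bsub>\<alpha>\<^sub>m\<^esub>\<close>, extended by zero to words of other lengths than
  \<open>m\<close>.
\<close>

definition stage_form :: "'a list \<Rightarrow> 'a \<Rightarrow> ('d, 'v) word \<Rightarrow> ('d, 'v, 'k) tensor" where
  "stage_form \<alpha>s \<beta> w = (if length w = length \<alpha>s
     then pure_tensor s (stage_words \<alpha>s) (tr_word \<alpha>s (replicate (length \<alpha>s) \<beta>) w) else 0)"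

lemma stage_form_multilinear:
  assumes "below \<alpha>s \<beta>"
  shows "multilinear_on s tensor_scale (all_words (G \<beta>)) (stage_form \<alpha>s \<beta>)"
proof -
  let ?fs = "map2 tr \<alpha>s (replicate (length \<alpha>s) \<beta>)"
  have "multilinear_on s tensor_scale (all_words (G \<beta>)) (\<lambda>w. if length w = length ?fs
     then pure_tensor s (stage_words \<alpha>s) (map_word ?fs w) else 0)"
  proof (rule multilinear_on_map_word[where Vs' = "map G \<alpha>s" and s' = s])
    show "w \<in> words (replicate (length \<alpha>s) (G \<beta>))" if "w \<in> all_words (G \<beta>)" "length w = length ?fs" for w
      using that by (simp add: words_replicate)
    show "letter_map s s (replicate (length \<alpha>s) (G \<beta>) ! k) (map G \<alpha>s ! k) (?fs ! k)"
      if "k < length ?fs" for k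
      using that letter_map_tr list_all2_nthD[OF assms, of k] by simp
    show "multilinear_on s tensor_scale (words (map G \<alpha>s)) (pure_tensor s (stage_words \<alpha>s))"
      by (rule tensor_valued_multilinear[OF multilinear_form_pure_tensor])
  qed (simp_all add: pscale_def fun_eq_iff)
  then show ?thesis by (simp add: stage_form_def[abs_def])
qed

text \<open>
  For an upper bound \<open>\<beta>\<close> of the list, the unique function on words over \<open>\<gg>\<^sub>\<beta>\<close> that factors through the enveloping
  algebra and agrees with the projection after symmetrization.
\<close>

definition stage_env :: "'a list \<Rightarrow> 'a \<Rightarrow> ('d, 'v) word \<Rightarrow> ('d, 'v, 'k) tensor" where
  "stage_env \<alpha>s \<beta> = (SOME \<psi>. multilinear_on s tensor_scale (all_words (G \<beta>)) \<psi> \<and>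
     enveloping_relation tensor_scale (br \<beta>) (all_words (G \<beta>)) \<psi> \<and>
     (\<forall>w \<in> all_words (G \<beta>). word_symmetrize tensor_scale \<psi> w = word_symmetrize tensor_scale (stage_form \<alpha>s \<beta>) w))"

lemma stage_env:
  assumes "below \<alpha>s \<beta>"
  shows "multilinear_on s tensor_scale (all_words (G \<beta>)) (stage_env \<alpha>s \<beta>)"
    and "enveloping_relation tensor_scale (br \<beta>) (all_words (G \<beta>)) (stage_env \<alpha>s \<beta>)"
    and "w \<in> all_words (G \<beta>) \<Longrightarrow>
      word_symmetrize tensor_scale (stage_env \<alpha>s \<beta>) w = word_symmetrize tensor_scale (stage_form \<alpha>s \<beta>) w"
  using someI_ex[OF graded_lie_algebra.enveloping_form_exists[OF lie tensor.vector_space_axioms stage_form_multilinear[OF assms]]]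
  unfolding stage_env_def[symmetric] by blast+

lemma stage_env_form:
  assumes "below \<alpha>s \<beta>"
  shows "multilinear_form s (stage_words (replicate n \<beta>)) (\<lambda>w. stage_env \<alpha>s \<beta> w \<phi>)"
  using stage_env(1)[OF assms] unfolding stage_words_replicate multilinear_on_def by (auto simp: pscale_def)

lemma stage_form_form:
  assumes "below \<alpha>s \<beta>"
  shows "multilinear_form s (stage_words (replicate n \<beta>)) (\<lambda>w. stage_form \<alpha>s \<beta> w \<phi>)"
  using stage_form_multilinear[OF assms] unfolding stage_words_replicate multilinear_on_def by (auto simp: pscale_def)

lemma stage_form_in_space:
  assumes "below \<alpha>s \<beta>" "w \<in> all_words (G \<beta>)"
  shows "stage_form \<alpha>s \<beta> w \<in> stage_space \<alpha>s (word_degree w)"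
proof (cases "length w = length \<alpha>s")
  case True
  have "tr_word \<alpha>s (replicate (length \<alpha>s) \<beta>) w \<in> stage_words \<alpha>s"
    by (rule tr_word_closed[OF assms(1)]) (use assms(2) True in \<open>simp add: words_replicate\<close>)
  then have "stage_form \<alpha>s \<beta> w \<in> pure_tensor s (stage_words \<alpha>s) ` {v \<in> stage_words \<alpha>s. word_degree v = word_degree w}"
    using True by (auto simp: stage_form_def word_degree_map_word intro!: imageI)
  then show ?thesis unfolding stage_space_span by (rule tensor.span_base)
next
  case False
  then show ?thesis using tensor.subspace_0[OF subspace_stage_space] by (simp add: stage_form_def)
qed

lemma stage_env_in_space:
  assumes le: "below \<alpha>s \<beta>" and w: "w \<in> all_words (G \<beta>)"
  shows "stage_env \<alpha>s \<beta> w \<in> stage_space \<alpha>s (word_degree w)"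
proof (rule enveloping_form_in_subspace[where \<psi> = "stage_env \<alpha>s \<beta>" and br = "br \<beta>"
      and D = "{v \<in> all_words (G \<beta>). word_degree v = word_degree w}", OF tensor.vector_space_axioms subspace_stage_space])
  fix u i x j y v assume *: "u @ (i, x) # (j, y) # v \<in> {v \<in> all_words (G \<beta>). word_degree v = word_degree w}"
  then show "u @ (j, y) # (i, x) # v \<in> {v \<in> all_words (G \<beta>). word_degree v = word_degree w}"
    and "u @ (i + j, br \<beta> i j x y) # v \<in> {v \<in> all_words (G \<beta>). word_degree v = word_degree w}"
    by (auto simp: word_degree_def add_ac graded_lie_algebra.br_closed[OF lie])
  from * have "u @ (i, x) # (j, y) # v \<in> all_words (G \<beta>)" by blast
  from enveloping_relationD[OF stage_env(2)[OF le] this]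
  show "stage_env \<alpha>s \<beta> (u @ (i, x) # (j, y) # v) -
      (tensor_scale (ksign i j) (stage_env \<alpha>s \<beta> (u @ (j, y) # (i, x) # v)) +
       stage_env \<alpha>s \<beta> (u @ (i + j, br \<beta> i j x y) # v)) \<in> stage_space \<alpha>s (word_degree w)"
    using tensor.subspace_0[OF subspace_stage_space] by simp
next
  fix v assume v: "v \<in> {v \<in> all_words (G \<beta>). word_degree v = word_degree w}"
  have "stage_form \<alpha>s \<beta> (permute_list (inv \<sigma>) v) \<in> stage_space \<alpha>s (word_degree w)"
    if "\<sigma> permutes {..<length v}" for \<sigma>
    using stage_form_in_space[OF le, of "permute_list (inv \<sigma>) v"] v that
      all_words_permute_list[OF permutes_inv[OF that]] word_degree_permute_list[OF permutes_inv[OF that]] by auto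
  then have "word_symmetrize tensor_scale (stage_form \<alpha>s \<beta>) v \<in> stage_space \<alpha>s (word_degree w)"
    unfolding word_symmetrize_def
    by (intro tensor.subspace_sum tensor.subspace_scale subspace_stage_space) auto
  then show "word_symmetrize tensor_scale (stage_env \<alpha>s \<beta>) v \<in> stage_space \<alpha>s (word_degree w)"
    using stage_env(3)[OF le] v by simp
qed (use w in simp)

text \<open>
  Composing with a linear map of the values and with a homomorphism of Lie algebras preserves the enveloping relation
  and commutes with symmetrization. So both sides are the function that belongs to the same projection, by uniqueness. This
  covers at once the change of \<open>\<beta>\<close> and the transition maps in the list of indices.
\<close>

lemma stage_env_natural:
  assumes aa: "list_all2 (\<le>) \<alpha>s \<alpha>s'" and a'c: "below \<alpha>s' \<gamma>" and ab: "below \<alpha>s \<beta>" and bc: "\<beta> \<le> \<gamma>"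
    and w: "w \<in> all_words (G \<gamma>)"
  shows "tr_tensor \<alpha>s \<alpha>s' (stage_env \<alpha>s' \<gamma> w)
    = stage_env \<alpha>s \<beta> (map (\<lambda>p. (fst p, tr \<beta> \<gamma> (fst p) (snd p))) w)"
proof -
  let ?f = "\<lambda>p. (fst p, tr \<beta> \<gamma> (fst p) (snd p))"
  have f_words: "map ?f v \<in> all_words (G \<beta>)" if "v \<in> all_words (G \<gamma>)" for v
    using that bc by (auto simp: all_words_eq tr_closed)
  have l: "length \<alpha>s = length \<alpha>s'" using aa by (rule list_all2_lengthD)
  have form: "tr_tensor \<alpha>s \<alpha>s' (stage_form \<alpha>s' \<gamma> v) = stage_form \<alpha>s \<beta> (map ?f v)"
    if v: "v \<in> all_words (G \<gamma>)" for v
  proof (cases "length v = length \<alpha>s'")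
    case True
    have vw: "v \<in> stage_words (replicate (length \<alpha>s') \<gamma>)"
      using v True by (simp add: words_replicate)
    have bc': "list_all2 (\<le>) (replicate (length \<alpha>s') \<beta>) (replicate (length \<alpha>s') \<gamma>)"
      using bc by (simp add: list_all2_conv_all_nth)
    have "tr_tensor \<alpha>s \<alpha>s' (stage_form \<alpha>s' \<gamma> v)
        = pure_tensor s (stage_words \<alpha>s) (tr_word \<alpha>s \<alpha>s' (tr_word \<alpha>s' (replicate (length \<alpha>s') \<gamma>) v))"
      using True by (simp add: stage_form_def tr_tensor_pure[OF aa])
    also have "tr_word \<alpha>s \<alpha>s' (tr_word \<alpha>s' (replicate (length \<alpha>s') \<gamma>) v)
        = tr_word \<alpha>s (replicate (length \<alpha>s') \<beta>) (tr_word (replicate (length \<alpha>s') \<beta>) (replicate (length \<alpha>s') \<gamma>) v)"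
      using tr_word_comp[OF aa a'c vw] tr_word_comp[OF ab[unfolded l] bc' vw] by simp
    also have "tr_word (replicate (length \<alpha>s') \<beta>) (replicate (length \<alpha>s') \<gamma>) v = map ?f v"
      by (rule tr_word_replicate[OF True])
    finally show ?thesis using True l by (simp add: stage_form_def)
  qed (use l in \<open>simp add: stage_form_def tr_tensor_zero\<close>)
  have tr_sym: "word_symmetrize tensor_scale (\<lambda>w. tr_tensor \<alpha>s \<alpha>s' (h w)) v = tr_tensor \<alpha>s \<alpha>s' (word_symmetrize tensor_scale h v)" for h v
  proof -
    have "tr_tensor \<alpha>s \<alpha>s' (\<Sum>\<sigma>\<in>P. g \<sigma>) = (\<Sum>\<sigma>\<in>P. tr_tensor \<alpha>s \<alpha>s' (g \<sigma>))" for P and g :: "(nat \<Rightarrow> nat) \<Rightarrow> _"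
      by (induction P rule: infinite_finite_induct) (simp_all only: sum.infinite sum.empty sum.insert tr_tensor_zero tr_tensor_add simp_thms)
    then show ?thesis by (simp only: word_symmetrize_def tr_tensor_scale)
  qed
  have map_sym: "word_symmetrize tensor_scale (\<lambda>w. h (map ?f w)) v = word_symmetrize tensor_scale h (map ?f v)"
    for h :: "('d, 'v) word \<Rightarrow> ('d, 'v, 'k) tensor" and v
    unfolding word_symmetrize_def
    by (intro sum.cong) (simp_all add: permute_list_map permutes_inv comp_def)
  show ?thesis
  proof (rule graded_lie_algebra.enveloping_form_unique[OF lie tensor.vector_space_axioms _ _ _ w,
        where \<psi> = "\<lambda>w. tr_tensor \<alpha>s \<alpha>s' (stage_env \<alpha>s' \<gamma> w)" and \<psi>' = "\<lambda>w. stage_env \<alpha>s \<beta> (map ?f w)"])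
    show "enveloping_relation tensor_scale (br \<gamma>) (all_words (G \<gamma>)) (\<lambda>w. tr_tensor \<alpha>s \<alpha>s' (stage_env \<alpha>s' \<gamma> w))"
      unfolding enveloping_relation_def
    proof (intro allI impI)
      fix u i x j y v assume "u @ (i, x) # (j, y) # v \<in> all_words (G \<gamma>)"
      from enveloping_relationD[OF stage_env(2)[OF a'c] this]
      show "tr_tensor \<alpha>s \<alpha>s' (stage_env \<alpha>s' \<gamma> (u @ (i, x) # (j, y) # v)) =
          tensor_scale (ksign i j) (tr_tensor \<alpha>s \<alpha>s' (stage_env \<alpha>s' \<gamma> (u @ (j, y) # (i, x) # v))) +
          tr_tensor \<alpha>s \<alpha>s' (stage_env \<alpha>s' \<gamma> (u @ (i + j, br \<gamma> i j x y) # v))"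
        by (simp only: tr_tensor_add tr_tensor_scale)
    qed
    show "enveloping_relation tensor_scale (br \<gamma>) (all_words (G \<gamma>)) (\<lambda>w. stage_env \<alpha>s \<beta> (map ?f w))"
      unfolding enveloping_relation_def
    proof (intro allI impI)
      fix u i x j y v assume *: "u @ (i, x) # (j, y) # v \<in> all_words (G \<gamma>)"
      then have xy: "x \<in> G \<gamma> i" "y \<in> G \<gamma> j" by auto
      have "map ?f u @ (i, tr \<beta> \<gamma> i x) # (j, tr \<beta> \<gamma> j y) # map ?f v \<in> all_words (G \<beta>)"
        using f_words[OF *] by simp
      from enveloping_relationD[OF stage_env(2)[OF ab] this]
      show "stage_env \<alpha>s \<beta> (map ?f (u @ (i, x) # (j, y) # v)) =
          tensor_scale (ksign i j) (stage_env \<alpha>s \<beta> (map ?f (u @ (j, y) # (i, x) # v))) +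
          stage_env \<alpha>s \<beta> (map ?f (u @ (i + j, br \<gamma> i j x y) # v))"
        by (simp only: map_append list.map fst_conv snd_conv tr_bracket[OF bc xy])
    qed
    fix v assume v: "v \<in> all_words (G \<gamma>)"
    have "word_symmetrize tensor_scale (\<lambda>w. tr_tensor \<alpha>s \<alpha>s' (stage_env \<alpha>s' \<gamma> w)) v
        = word_symmetrize tensor_scale (\<lambda>w. tr_tensor \<alpha>s \<alpha>s' (stage_form \<alpha>s' \<gamma> w)) v"
      unfolding tr_sym stage_env(3)[OF a'c v] ..
    also have "\<dots> = word_symmetrize tensor_scale (\<lambda>w. stage_form \<alpha>s \<beta> (map ?f w)) v"
      by (rule tensor.word_symmetrize_cong) (intro form all_words_permute_list permutes_inv v)
    also have "\<dots> = word_symmetrize tensor_scale (\<lambda>w. stage_env \<alpha>s \<beta> (map ?f w)) v"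
      unfolding map_sym stage_env(3)[OF ab f_words[OF v]] ..
    finally show "word_symmetrize tensor_scale (\<lambda>w. tr_tensor \<alpha>s \<alpha>s' (stage_env \<alpha>s' \<gamma> w)) v
        = word_symmetrize tensor_scale (\<lambda>w. stage_env \<alpha>s \<beta> (map ?f w)) v" .
  qed
qed

definition stage_support :: "'a list \<Rightarrow> 'a \<Rightarrow> nat set" where
  "stage_support \<alpha>s \<beta> = length ` {w \<in> all_words (G \<beta>). stage_env \<alpha>s \<beta> w \<noteq> 0}"

lemma finite_stage_support:
  assumes "below \<alpha>s \<beta>" shows "finite (stage_support \<alpha>s \<beta>)"
proof -
  have "\<exists>N. \<forall>w \<in> all_words (G \<beta>). N \<le> length w \<longrightarrow> stage_env \<alpha>s \<beta> w = 0"
    by (rule graded_lie_algebra.enveloping_form_vanishes[OF lie nilpotent tensor.vector_space_axioms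
          stage_form_multilinear[OF assms] _ stage_env(2)[OF assms] stage_env(3)[OF assms], of "length \<alpha>s"])
       (simp add: stage_form_def)
  then obtain N where "\<And>w. w \<in> all_words (G \<beta>) \<Longrightarrow> N \<le> length w \<Longrightarrow> stage_env \<alpha>s \<beta> w = 0" by blast
  then have "stage_support \<alpha>s \<beta> \<subseteq> {..<N}" by (auto simp: stage_support_def not_le[symmetric])
  then show ?thesis by (rule finite_subset) simp
qed

text \<open>
  The linear extension of \<open>stage_env\<close>, applied to the \<open>n\<close>-fold part of \<open>x\<close>.
\<close>

definition retract_term :: "'a list \<Rightarrow> 'a \<Rightarrow> (nat \<Rightarrow> 'a list \<Rightarrow> ('d, 'v, 'k) tensor) \<Rightarrow> nat \<Rightarrow> ('d, 'v, 'k) tensor" where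
  "retract_term \<alpha>s \<beta> x n = (\<lambda>\<phi>. x n (replicate n \<beta>) (\<lambda>w. stage_env \<alpha>s \<beta> w \<phi>))"

definition retract_at :: "'a list \<Rightarrow> 'a \<Rightarrow> (nat \<Rightarrow> 'a list \<Rightarrow> ('d, 'v, 'k) tensor) \<Rightarrow> ('d, 'v, 'k) tensor" where
  "retract_at \<alpha>s \<beta> x = (\<Sum>n\<in>stage_support \<alpha>s \<beta>. retract_term \<alpha>s \<beta> x n)"

lemma retract_at_add: "retract_at \<alpha>s \<beta> (x + y) = retract_at \<alpha>s \<beta> x + retract_at \<alpha>s \<beta> y"
proof -
  have "retract_term \<alpha>s \<beta> (x + y) n = retract_term \<alpha>s \<beta> x n + retract_term \<alpha>s \<beta> y n" for n
    by (simp add: retract_term_def fun_eq_iff)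
  then show ?thesis by (simp only: retract_at_def sum.distrib)
qed

lemma retract_at_scale: "retract_at \<alpha>s \<beta> (calgebra_scale c x) = tensor_scale c (retract_at \<alpha>s \<beta> x)"
proof -
  have "retract_term \<alpha>s \<beta> (calgebra_scale c x) n = tensor_scale c (retract_term \<alpha>s \<beta> x n)" for n
    by (simp add: retract_term_def fun_eq_iff pscale_def)
  then show ?thesis by (simp only: retract_at_def tensor.scale_sum_right)
qed

lemma ctensor_power_replicate: "t \<in> ctensor_power s G tr n d \<Longrightarrow> t (replicate n \<beta>) \<in> stage_space (replicate n \<beta>) d"
  by (rule ctensor_powerD(1)) simp_all

lemma retract_term_closed:
  assumes le: "below \<alpha>s \<beta>" and x: "x n \<in> ctensor_power s G tr n d"
  shows "retract_term \<alpha>s \<beta> x n \<in> stage_space \<alpha>s d"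
  unfolding retract_term_def
proof (rule tensor_bind_in_subspace[OF ctensor_power_replicate[OF x, unfolded stage_space_span]])
  show "multilinear_form s (stage_words (replicate n \<beta>)) (\<lambda>w. stage_env \<alpha>s \<beta> w \<phi>)" for \<phi>
    by (rule stage_env_form[OF le])
  show "stage_env \<alpha>s \<beta> w \<in> stage_space \<alpha>s d" if "w \<in> {w \<in> stage_words (replicate n \<beta>). word_degree w = d}" for w
    using that stage_env_in_space[OF le, of w] by (auto simp: words_replicate)
qed (rule subspace_stage_space)

lemma retract_at_closed:
  assumes "below \<alpha>s \<beta>" "\<And>n. x n \<in> ctensor_power s G tr n d"
  shows "retract_at \<alpha>s \<beta> x \<in> stage_space \<alpha>s d"
  unfolding retract_at_def by (intro tensor.subspace_sum subspace_stage_space retract_term_closed assms)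

lemma retract_term_outside_support:
  assumes x: "x n \<in> ctensor_power s G tr n d" and n: "n \<notin> stage_support \<alpha>s \<beta>"
  shows "retract_term \<alpha>s \<beta> x n = 0"
proof
  fix \<phi>
  have "x n (replicate n \<beta>) (\<lambda>w. stage_env \<alpha>s \<beta> w \<phi>) = x n (replicate n \<beta>) (\<lambda>w. 0)"
    using n by (intro stage_form_cong[OF ctensor_power_replicate[OF x]]) (auto simp: words_replicate stage_support_def)
  then show "retract_term \<alpha>s \<beta> x n \<phi> = 0 \<phi>"
    using tensor_zero_form[OF ctensor_power_replicate[OF x, unfolded stage_space_span]] by (simp add: retract_term_def)
qed

lemma retract_at_superset:
  assumes "\<And>n. x n \<in> ctensor_power s G tr n d" "finite S" "stage_support \<alpha>s \<beta> \<subseteq> S"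
  shows "retract_at \<alpha>s \<beta> x = (\<Sum>n\<in>S. retract_term \<alpha>s \<beta> x n)"
  unfolding retract_at_def
  by (rule sum.mono_neutral_left[OF assms(2,3)]) (use retract_term_outside_support[where x = x, OF assms(1)] in blast)

lemma retract_at_natural:
  assumes aa: "list_all2 (\<le>) \<alpha>s \<alpha>s'" and a'c: "below \<alpha>s' \<gamma>" and ab: "below \<alpha>s \<beta>" and bc: "\<beta> \<le> \<gamma>"
    and x: "\<And>n. x n \<in> ctensor_power s G tr n d"
  shows "tr_tensor \<alpha>s \<alpha>s' (retract_at \<alpha>s' \<gamma> x) = retract_at \<alpha>s \<beta> x"
proof -
  have each: "tr_tensor \<alpha>s \<alpha>s' (retract_term \<alpha>s' \<gamma> x n) = retract_term \<alpha>s \<beta> x n" for n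
  proof
    fix \<phi> :: "('d, 'v) word \<Rightarrow> 'k"
    have bc': "list_all2 (\<le>) (replicate n \<beta>) (replicate n \<gamma>)"
      using bc by (simp add: list_all2_conv_all_nth)
    show "tr_tensor \<alpha>s \<alpha>s' (retract_term \<alpha>s' \<gamma> x n) \<phi> = retract_term \<alpha>s \<beta> x n \<phi>"
    proof (cases "multilinear_form s (stage_words \<alpha>s) \<phi>")
      case True
      have "tr_tensor \<alpha>s \<alpha>s' (retract_term \<alpha>s' \<gamma> x n) \<phi> = x n (replicate n \<gamma>) (\<lambda>w. tr_tensor \<alpha>s \<alpha>s' (stage_env \<alpha>s' \<gamma> w) \<phi>)"
        using True by (simp add: tr_tensor_apply retract_term_def)
      also have "\<dots> = x n (replicate n \<gamma>) (\<lambda>w. stage_env \<alpha>s \<beta> (tr_word (replicate n \<beta>) (replicate n \<gamma>) w) \<phi>)"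
      proof (rule stage_form_cong[OF ctensor_power_replicate[OF x]])
        fix w assume "w \<in> stage_words (replicate n \<gamma>)"
        then have w: "w \<in> all_words (G \<gamma>)" "length w = n" by (simp_all add: words_replicate)
        show "tr_tensor \<alpha>s \<alpha>s' (stage_env \<alpha>s' \<gamma> w) \<phi> = stage_env \<alpha>s \<beta> (tr_word (replicate n \<beta>) (replicate n \<gamma>) w) \<phi>"
          unfolding tr_word_replicate[OF w(2)] stage_env_natural[OF aa a'c ab bc w(1)] ..
      qed
      also have "\<dots> = tr_tensor (replicate n \<beta>) (replicate n \<gamma>) (x n (replicate n \<gamma>)) (\<lambda>w. stage_env \<alpha>s \<beta> w \<phi>)"
        using stage_env_form[OF ab, of n \<phi>] by (simp add: tr_tensor_apply)
      also have "\<dots> = retract_term \<alpha>s \<beta> x n \<phi>"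
        by (simp only: ctensor_powerD(3)[OF x bc'] retract_term_def)
      finally show ?thesis .
    next
      case False
      then show ?thesis
        using stage_not_multilinear[OF retract_term_closed[where x = x and n = n, OF ab x] False] by (simp add: tr_tensor_apply)
    qed
  qed
  \<comment> \<open>The two sums run over different lengths; both may be taken over the union.\<close>
  let ?S = "stage_support \<alpha>s' \<gamma> \<union> stage_support \<alpha>s \<beta>"
  have S: "finite ?S" using finite_stage_support[OF a'c] finite_stage_support[OF ab] by simp
  have "tr_tensor \<alpha>s \<alpha>s' (\<Sum>n\<in>P. g n) = (\<Sum>n\<in>P. tr_tensor \<alpha>s \<alpha>s' (g n))" for P and g :: "nat \<Rightarrow> _"
    by (induction P rule: infinite_finite_induct) (simp_all only: sum.infinite sum.empty sum.insert tr_tensor_zero tr_tensor_add simp_thms)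
  then show ?thesis
    using retract_at_superset[where x = x and S = ?S, OF x S] each by simp
qed

definition stage_bound :: "'a list \<Rightarrow> 'a" where
  "stage_bound \<alpha>s = (SOME \<beta>. below \<alpha>s \<beta>)"

lemma below_stage_bound: "below \<alpha>s (stage_bound \<alpha>s)"
proof -
  obtain \<beta> where "\<forall>\<alpha>\<in>set \<alpha>s. \<alpha> \<le> \<beta>" using upper_bound[of "set \<alpha>s"] by auto
  then show ?thesis unfolding stage_bound_def below_replicate by (rule someI)
qed

definition retract :: "(nat \<Rightarrow> 'a list \<Rightarrow> ('d, 'v, 'k) tensor) \<Rightarrow> nat \<Rightarrow> 'a list \<Rightarrow> ('d, 'v, 'k) tensor" where
  "retract x n \<alpha>s = (if length \<alpha>s = n then retract_at \<alpha>s (stage_bound \<alpha>s) x else 0)"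

text \<open>
  Two upper bounds of the list are compared with a third one above both.
\<close>

lemma retract_eq:
  assumes x: "\<And>n. x n \<in> ctensor_power s G tr n d" and le: "below \<alpha>s \<beta>" "length \<alpha>s = n"
  shows "retract x n \<alpha>s = retract_at \<alpha>s \<beta> x"
proof -
  obtain \<gamma> where \<gamma>: "\<beta> \<le> \<gamma>" "stage_bound \<alpha>s \<le> \<gamma>" using directed by blast
  have r: "list_all2 (\<le>) \<alpha>s \<alpha>s" by (simp add: list_all2_conv_all_nth)
  have "below \<alpha>s \<gamma>" using le(1) \<gamma>(1) unfolding below_replicate by (auto intro: order_trans)
  from retract_at_natural[OF r this below_stage_bound \<gamma>(2) x] retract_at_natural[OF r this le(1) \<gamma>(1) x]
  show ?thesis using le(2) by (simp add: retract_def)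
qed

lemma retract_closed:
  assumes x: "\<And>n. x n \<in> ctensor_power s G tr n d"
  shows "retract x n \<in> ctensor_power s G tr n d"
  unfolding ctensor_power_iff
proof (intro conjI allI impI)
  show "retract x n \<alpha>s \<in> stage_space \<alpha>s d" if "length \<alpha>s = n" for \<alpha>s
    using that retract_at_closed[OF below_stage_bound x] by (simp add: retract_def)
  show "retract x n \<alpha>s = 0" if "length \<alpha>s \<noteq> n" for \<alpha>s
    using that by (simp add: retract_def)
  fix \<alpha>s \<beta>s :: "'a list" assume le: "list_all2 (\<le>) \<alpha>s \<beta>s"
  then have l: "length \<alpha>s = length \<beta>s" by (rule list_all2_lengthD)
  show "tr_tensor \<alpha>s \<beta>s (retract x n \<beta>s) = retract x n \<alpha>s"
  proof (cases "length \<alpha>s = n")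
    case True
    have b: "below \<beta>s (stage_bound \<beta>s)" by (rule below_stage_bound)
    have a: "below \<alpha>s (stage_bound \<beta>s)"
      using list_all2_trans[OF order_trans le b] l by simp
    from retract_at_natural[OF le b a order_refl x] show ?thesis
      using retract_eq[OF x a True] True l by (simp add: retract_def)
  qed (use l in \<open>simp add: retract_def tr_tensor_zero\<close>)
qed

lemma retract_add: "retract (x + y) n = retract x n + retract y n"
  by (rule ext) (simp add: retract_def retract_at_add)

lemma retract_scale: "retract (calgebra_scale c x) n = cpower_scale c (retract x n)"
  by (rule ext) (auto simp: retract_def retract_at_scale pscale_def[of tensor_scale])

lemma retract_finite_dependence:
  "\<exists>F. finite F \<and> (\<forall>x y. agree_on F x y \<longrightarrow> retract x n \<alpha>s = retract y n \<alpha>s)"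
proof -
  let ?b = "stage_bound \<alpha>s"
  let ?F = "(\<lambda>k. (k, replicate k ?b)) ` stage_support \<alpha>s ?b"
  have "retract x n \<alpha>s = retract y n \<alpha>s" if "agree_on ?F x y" for x y
  proof -
    have "retract_at \<alpha>s ?b x = retract_at \<alpha>s ?b y"
      unfolding retract_at_def
    proof (rule sum.cong[OF refl])
      fix k assume "k \<in> stage_support \<alpha>s ?b"
      then have "x k (replicate k ?b) = y k (replicate k ?b)" by (intro agree_onD[OF that]) auto
      then show "retract_term \<alpha>s ?b x k = retract_term \<alpha>s ?b y k" by (simp add: retract_term_def)
    qed
    then show ?thesis by (simp add: retract_def)
  qed
  then show ?thesis using finite_stage_support[OF below_stage_bound[of \<alpha>s]] by (intro exI[of _ ?F]) auto
qed

text \<open>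
  On symmetrized tensors \<open>stage_env\<close> may be replaced by the projection, since both have the same symmetrization.
\<close>

lemma retract_symmetrize:
  assumes x: "\<And>n. x n \<in> ctensor_power s G tr n d"
  shows "retract (\<lambda>n. symmetrize s G n (x n)) m = symmetrize s G m (x m)"
proof
  fix \<alpha>s
  let ?S = "\<lambda>n. symmetrize s G n (x n)"
  have S: "?S n \<in> ctensor_power s G tr n d" for n by (rule symmetrize_closed[OF x])
  show "retract ?S m \<alpha>s = ?S m \<alpha>s"
  proof (cases "length \<alpha>s = m")
    case True
    let ?b = "stage_bound \<alpha>s"
    note le = below_stage_bound[of \<alpha>s]
    let ?N = "insert m (stage_support \<alpha>s ?b)"
    have each: "retract_term \<alpha>s ?b ?S n = (if n = m then ?S m \<alpha>s else 0)" for n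
    proof
      fix \<phi> :: "('d, 'v) word \<Rightarrow> 'k"
      let ?r = "replicate n ?b"
      have eval: "word_symmetrize (*) (\<lambda>v. h v \<phi>) w = word_symmetrize tensor_scale h w \<phi>"
        for h :: "('d, 'v) word \<Rightarrow> ('d, 'v, 'k) tensor" and w
        by (simp add: word_symmetrize_def sum_fun_apply pscale_def)
      have "retract_term \<alpha>s ?b ?S n \<phi> = x n ?r (word_symmetrize (*) (\<lambda>w. stage_env \<alpha>s ?b w \<phi>))"
        unfolding retract_term_def by (rule symmetrize_apply[OF x stage_env_form[OF le]])
      also have "\<dots> = x n ?r (word_symmetrize (*) (\<lambda>w. stage_form \<alpha>s ?b w \<phi>))"
        by (rule stage_form_cong[OF ctensor_power_replicate[OF x]])
           (simp add: eval stage_env(3)[OF le] words_replicate)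
      also have "\<dots> = ?S n ?r (\<lambda>w. stage_form \<alpha>s ?b w \<phi>)"
        by (rule symmetrize_apply[OF x stage_form_form[OF le], symmetric])
      also have "\<dots> = (if n = m then ?S m \<alpha>s else 0) \<phi>"
      proof (cases "n = m")
        case nm: True
        have "?S n ?r (\<lambda>w. stage_form \<alpha>s ?b w \<phi>) = tr_tensor \<alpha>s ?r (?S n ?r) \<phi>"
        proof (cases "multilinear_form s (stage_words \<alpha>s) \<phi>")
          case True
          then show ?thesis
            using nm \<open>length \<alpha>s = m\<close>
            by (simp add: tr_tensor_apply, intro stage_form_cong[OF ctensor_power_replicate[OF S]])
               (auto simp: stage_form_def pure_tensor_def words_replicate)
        next
          case False
          then have "(\<lambda>w. stage_form \<alpha>s ?b w \<phi>) = (\<lambda>w. 0)"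
            by (auto simp: stage_form_def pure_tensor_def)
          then show ?thesis
            using False tensor_zero_form[OF ctensor_power_replicate[OF S, unfolded stage_space_span]]
            by (simp add: tr_tensor_apply)
        qed
        also have "tr_tensor \<alpha>s ?r (?S n ?r) = ?S n \<alpha>s"
          using le nm True by (intro ctensor_powerD(3)[OF S]) simp
        finally show ?thesis using nm by simp
      next
        case False
        have "?S n ?r (\<lambda>w. stage_form \<alpha>s ?b w \<phi>) = ?S n ?r (\<lambda>w. 0)"
          using False True
          by (intro stage_form_cong[OF ctensor_power_replicate[OF S]]) (auto simp: stage_form_def words_replicate)
        then show ?thesis
          using False tensor_zero_form[OF ctensor_power_replicate[OF S, unfolded stage_space_span]] by simp
      qed
      finally show "retract_term \<alpha>s ?b ?S n \<phi> = (if n = m then ?S m \<alpha>s else 0) \<phi>" .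
    qed
    have "retract ?S m \<alpha>s = (\<Sum>n\<in>?N. retract_term \<alpha>s ?b ?S n)"
      using retract_at_superset[where x = ?S and S = ?N, OF S] finite_stage_support[OF le] True
      by (simp add: retract_def subset_insertI)
    also have "\<dots> = ?S m \<alpha>s"
      using finite_stage_support[OF le] unfolding each by (simp add: sum.delta del: sum.insert)
    finally show ?thesis .
  qed (simp add: retract_def ctensor_powerD(2)[OF S])
qed

lemma retract_at_incl_pure:
  assumes le: "below \<alpha>s \<beta>" and w: "w \<in> limit_words"
  shows "retract_at \<alpha>s \<beta> (tensor_incl s G (limit.pure w)) = stage_env \<alpha>s \<beta> (map (\<lambda>p. (fst p, snd p \<beta>)) w)"
proof -
  let ?w = "map (\<lambda>p. (fst p, snd p \<beta>)) w"
  let ?N = "insert (length w) (stage_support \<alpha>s \<beta>)"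
  have proj: "proj_word (replicate (length w) \<beta>) w = ?w"
    by (rule nth_equalityI) (auto simp: map_word_nth)
  have pure: "limit.pure w \<in> limit_space (word_degree w)"
    unfolding limit_space_span using w by (intro tensor.span_base) auto
  have "retract_term \<alpha>s \<beta> (tensor_incl s G (limit.pure w)) n = (if n = length w then stage_env \<alpha>s \<beta> ?w else 0)" for n
  proof
    fix \<phi>
    show "retract_term \<alpha>s \<beta> (tensor_incl s G (limit.pure w)) n \<phi> = (if n = length w then stage_env \<alpha>s \<beta> ?w else 0) \<phi>"
      unfolding retract_term_def incl_pure[OF length_replicate]
      using proj stage_env_form[OF le, of n \<phi>] by (auto simp: pure_tensor_def)
  qed
  then show ?thesis
    using retract_at_superset[where S = ?N, OF incl_closed[OF pure]] finite_stage_support[OF le]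
    by (simp add: sum.delta subset_insertI del: sum.insert)
qed

lemma proj_letters: "w \<in> limit_words \<Longrightarrow> map (\<lambda>p. (fst p, snd p \<beta>)) w \<in> all_words (G \<beta>)"
  by (induction w) (auto simp: lie_limit_iff)

text \<open>
  On a relator of the tensor algebra of the limit, the enveloping relation at stage \<open>\<beta>\<close> gives zero, because the projection to
  \<open>\<gg>\<^sub>\<beta>\<close> respects brackets.
\<close>

lemma retract_incl_env_ideal:
  assumes "t \<in> env_ideal (pscale s) (lie_limit G tr) (lie_limit_bracket br)"
  shows "retract (tensor_incl s G t) n = 0"
proof
  fix \<alpha>s
  let ?b = "stage_bound \<alpha>s"
  note le = below_stage_bound[of \<alpha>s]
  have rel: "retract_at \<alpha>s ?b (tensor_incl s G r) = 0" if r: "r \<in> limit.word_relators" for r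
  proof -
    obtain u i x j y v where r': "r = limit.word_relator u i x j y v" and uv: "u @ (i, x) # (j, y) # v \<in> limit_words"
      using r unfolding limit.word_relators_def by blast
    let ?f = "map (\<lambda>p. (fst p, snd p ?b)) :: ('d, 'a \<Rightarrow> 'v) word \<Rightarrow> ('d, 'v) word"
    have W: "u @ (j, y) # (i, x) # v \<in> limit_words" "u @ (i + j, lie_limit_bracket br i j x y) # v \<in> limit_words"
      using uv by (auto intro: limit_bracket_closed)
    have "?f (u @ (i, x) # (j, y) # v) \<in> all_words (G ?b)"
      using uv by (rule proj_letters)
    then have fW: "?f u @ (i, x ?b) # (j, y ?b) # ?f v \<in> all_words (G ?b)" by simp
    have "r = limit.pure (u @ (i, x) # (j, y) # v) + (tensor_scale (- ksign i j) (limit.pure (u @ (j, y) # (i, x) # v))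
        + tensor_scale (- 1) (limit.pure (u @ (i + j, lie_limit_bracket br i j x y) # v)))"
      by (simp add: r' limit.word_relator_def)
    then have "retract_at \<alpha>s ?b (tensor_incl s G r) = stage_env \<alpha>s ?b (?f (u @ (i, x) # (j, y) # v)) +
        (tensor_scale (- ksign i j) (stage_env \<alpha>s ?b (?f (u @ (j, y) # (i, x) # v)))
        + tensor_scale (- 1) (stage_env \<alpha>s ?b (?f (u @ (i + j, lie_limit_bracket br i j x y) # v))))"
      by (simp only: incl_add incl_scale retract_at_add retract_at_scale
          retract_at_incl_pure[OF le uv] retract_at_incl_pure[OF le W(1)] retract_at_incl_pure[OF le W(2)])
    also have "\<dots> = 0"
      using enveloping_relationD[OF stage_env(2)[OF le] fW]
      by (simp add: lie_limit_bracket_def)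
    finally show ?thesis .
  qed
  have "t \<in> tensor.span limit.word_relators" using assms limit.env_ideal_subset by blast
  then have "retract_at \<alpha>s ?b (tensor_incl s G t) = 0"
  proof (induction rule: tensor.span_induct_alt)
    case base
    show ?case unfolding incl_zero retract_at_def retract_term_def by (simp add: sum_fun_apply fun_eq_iff)
  next
    case (step c r t)
    then show ?case unfolding incl_add incl_scale retract_at_add retract_at_scale rel[OF step(1)] by simp
  qed
  then show "retract (tensor_incl s G t) n \<alpha>s = 0 \<alpha>s" by (simp add: retract_def)
qed

end

section \<open>Decomposition of the completed tensor algebra\<close>

interpretation cpower: vector_space
  "cpower_scale :: 'k::field \<Rightarrow> ('a list \<Rightarrow> ('d, 'v, 'k) tensor) \<Rightarrow> ('a list \<Rightarrow> ('d, 'v, 'k) tensor)"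
  by (rule vector_space_pscale[OF tensor.vector_space_axioms])

interpretation calgebra: vector_space
  "calgebra_scale :: 'k::field \<Rightarrow> (nat \<Rightarrow> 'a list \<Rightarrow> ('d, 'v, 'k) tensor) \<Rightarrow> (nat \<Rightarrow> 'a list \<Rightarrow> ('d, 'v, 'k) tensor)"
  by (rule vector_space_pscale[OF cpower.vector_space_axioms])

context profinite_pronilpotent_lie_algebra
begin

lemma ctensor_algebra_iff: "x \<in> ctensor_algebra s G tr d \<longleftrightarrow> (\<forall>n. x n \<in> ctensor_power s G tr n d)"
  by (auto simp: ctensor_algebra_def PiE_UNIV_domain)

lemma ctensor_algebra_topology_eq:
  "ctensor_algebra_topology s G tr d = limit_product_topology (\<lambda>n. ctensor_power s G tr n d)"
  by (simp add: ctensor_algebra_topology_def ctensor_power_topology_def limit_product_topology_def)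

lemma topspace_ctensor_algebra [simp]:
  "topspace (ctensor_algebra_topology s G tr d) = ctensor_algebra s G tr d"
  by (auto simp: ctensor_algebra_topology_eq topspace_limit_product_topology ctensor_algebra_iff)

abbreviation env_closure :: "'d \<Rightarrow> (nat \<Rightarrow> 'a list \<Rightarrow> ('d, 'v, 'k) tensor) set" where
  "env_closure \<equiv> env_ideal_closure s G br tr"

abbreviation limit_ideal :: "'d \<Rightarrow> ('d, 'a \<Rightarrow> 'v, 'k) tensor set" where
  "limit_ideal d \<equiv> env_ideal (pscale s) (lie_limit G tr) (lie_limit_bracket br) \<inter> limit_space d"

text \<open>
  Closure membership by finite approximation; this is how the closed ideal is shown to be a subspace and to be
  annihilated by maps that depend on finitely many coordinates.
\<close>

lemma env_closure_iff:
  "y \<in> env_closure d \<longleftrightarrow> y \<in> ctensor_algebra s G tr d \<and>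
     (\<forall>F. finite F \<longrightarrow> (\<exists>t\<in>limit_ideal d. agree_on F (tensor_incl s G t) y))"
proof -
  have top: "topspace (limit_product_topology (\<lambda>n. ctensor_power s G tr n d)) = ctensor_algebra s G tr d"
    using topspace_ctensor_algebra[of d] by (simp only: ctensor_algebra_topology_eq)
  have "tensor_incl s G ` limit_ideal d \<inter> ctensor_algebra s G tr d = tensor_incl s G ` limit_ideal d"
    using incl_closed by (auto simp: ctensor_algebra_iff)
  then show ?thesis
    unfolding env_ideal_closure_def ctensor_algebra_topology_eq closure_of_limit_product_topology top
    by (simp only: bex_simps)
qed

lemma subspace_limit_ideal: "tensor.subspace (limit_ideal d)"
  by (rule tensor.subspace_inter[OF limit.subspace_env_ideal subspace_limit_space])

lemma subspace_ctensor_algebra: "calgebra.subspace (ctensor_algebra s G tr d)"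
  by (rule calgebra.subspaceI)
     (auto simp: ctensor_algebra_iff cpower_zero cpower_add pscale_def[of cpower_scale] cpower_scale)

lemma incl_in_ctensor_algebra: "t \<in> limit_space d \<Longrightarrow> tensor_incl s G t \<in> ctensor_algebra s G tr d"
  by (simp add: ctensor_algebra_iff incl_closed)

lemma subspace_env_closure: "calgebra.subspace (env_closure d)"
proof (rule calgebra.subspaceI)
  show "0 \<in> env_closure d"
    unfolding env_closure_iff
  proof (intro conjI allI impI)
    show "0 \<in> ctensor_algebra s G tr d" by (rule calgebra.subspace_0[OF subspace_ctensor_algebra])
    show "\<exists>t\<in>limit_ideal d. agree_on F (tensor_incl s G t) 0" for F
      by (rule bexI[OF _ tensor.subspace_0[OF subspace_limit_ideal]]) (unfold incl_zero, rule agree_on_refl)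
  qed
  fix x y assume x: "x \<in> env_closure d" and y: "y \<in> env_closure d"
  show "x + y \<in> env_closure d"
    unfolding env_closure_iff
  proof (intro conjI allI impI)
    show "x + y \<in> ctensor_algebra s G tr d"
      using x y by (intro calgebra.subspace_add[OF subspace_ctensor_algebra]) (simp_all add: env_closure_iff)
    fix F :: "(nat \<times> 'a list) set" assume F: "finite F"
    obtain t where t: "t \<in> limit_ideal d" "agree_on F (tensor_incl s G t) x"
      using x F unfolding env_closure_iff by blast
    obtain t' where t': "t' \<in> limit_ideal d" "agree_on F (tensor_incl s G t') y"
      using y F unfolding env_closure_iff by blast
    have "t + t' \<in> limit_ideal d" using t t' by (intro tensor.subspace_add[OF subspace_limit_ideal])
    moreover have "agree_on F (tensor_incl s G (t + t')) (x + y)"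
      unfolding incl_add using t t' by (simp add: agree_on_def)
    ultimately show "\<exists>t\<in>limit_ideal d. agree_on F (tensor_incl s G t) (x + y)" by blast
  qed
next
  fix c x assume x: "x \<in> env_closure d"
  show "calgebra_scale c x \<in> env_closure d"
    unfolding env_closure_iff
  proof (intro conjI allI impI)
    show "calgebra_scale c x \<in> ctensor_algebra s G tr d"
      using x by (intro calgebra.subspace_scale[OF subspace_ctensor_algebra]) (simp add: env_closure_iff)
    fix F :: "(nat \<times> 'a list) set" assume F: "finite F"
    obtain t where t: "t \<in> limit_ideal d" "agree_on F (tensor_incl s G t) x"
      using x F unfolding env_closure_iff by blast
    have "tensor_scale c t \<in> limit_ideal d" using t by (intro tensor.subspace_scale[OF subspace_limit_ideal])
    moreover have "agree_on F (tensor_incl s G (tensor_scale c t)) (calgebra_scale c x)"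
      unfolding incl_scale using t by (simp add: agree_on_def pscale_def)
    ultimately show "\<exists>t\<in>limit_ideal d. agree_on F (tensor_incl s G t) (calgebra_scale c x)" by blast
  qed
qed

lemma incl_in_env_closure: "t \<in> limit_ideal d \<Longrightarrow> tensor_incl s G t \<in> env_closure d"
  unfolding env_closure_iff by (intro conjI allI impI bexI[of _ t] incl_in_ctensor_algebra agree_on_refl) auto

lemma retract_env_closure:
  assumes "y \<in> env_closure d" shows "retract y n = 0"
proof
  fix \<alpha>s
  obtain F where F: "finite F" "\<And>x y. agree_on F x y \<Longrightarrow> retract x n \<alpha>s = retract y n \<alpha>s"
    using retract_finite_dependence by blast
  obtain t where t: "t \<in> limit_ideal d" "agree_on F (tensor_incl s G t) y"
    using assms F(1) unfolding env_closure_iff by blast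
  then have "t \<in> env_ideal (pscale s) (lie_limit G tr) (lie_limit_bracket br)" by blast
  from retract_incl_env_ideal[OF this] F(2)[OF t(2)] show "retract y n \<alpha>s = 0 \<alpha>s" by metis
qed

text \<open>
  The factor \<open>1 / n!\<close> compensates that symmetrizing twice multiplies by \<open>n!\<close>.
\<close>

definition sym_rep :: "(nat \<Rightarrow> 'a list \<Rightarrow> ('d, 'v, 'k) tensor) \<Rightarrow> nat \<Rightarrow> 'a list \<Rightarrow> ('d, 'v, 'k) tensor" where
  "sym_rep x n = cpower_scale (inverse (of_nat (fact n))) (retract x n)"

definition sym_part :: "(nat \<Rightarrow> 'a list \<Rightarrow> ('d, 'v, 'k) tensor) \<Rightarrow> nat \<Rightarrow> 'a list \<Rightarrow> ('d, 'v, 'k) tensor" where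
  "sym_part x n = symmetrize s G n (sym_rep x n)"

lemma sym_rep_closed: "x \<in> ctensor_algebra s G tr d \<Longrightarrow> sym_rep x n \<in> ctensor_power s G tr n d"
  by (simp add: sym_rep_def ctensor_algebra_iff cpower_scale retract_closed)

lemma symmetrize_zero: "symmetrize s G n 0 = 0"
  using symmetrize_scale[of n 0 0] by simp

lemma sym_part_add: "sym_part (x + y) = sym_part x + sym_part y"
  by (rule ext) (simp add: sym_part_def sym_rep_def retract_add cpower.scale_right_distrib symmetrize_add)

lemma sym_part_scale: "sym_part (calgebra_scale c x) = calgebra_scale c (sym_part x)"
proof
  fix n
  have "sym_part (calgebra_scale c x) n = cpower_scale c (sym_part x n)"
    unfolding sym_part_def sym_rep_def retract_scale symmetrize_scale[symmetric]
    by (simp only: cpower.scale_left_commute)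
  then show "sym_part (calgebra_scale c x) n = calgebra_scale c (sym_part x) n"
    by (simp add: pscale_def[of cpower_scale])
qed

lemma sym_part_symmetrize:
  assumes x: "x \<in> ctensor_algebra s G tr d"
  shows "sym_part (\<lambda>n. symmetrize s G n (x n)) = (\<lambda>n. symmetrize s G n (x n))"
proof
  fix n
  have x': "x n \<in> ctensor_power s G tr n d" for n using x by (simp add: ctensor_algebra_iff)
  have "sym_part (\<lambda>n. symmetrize s G n (x n)) n
      = cpower_scale (inverse (of_nat (fact n))) (symmetrize s G n (symmetrize s G n (x n)))"
    by (simp only: sym_part_def sym_rep_def retract_symmetrize[where x = x, OF x'] symmetrize_scale)
  also have "\<dots> = symmetrize s G n (x n)"
    unfolding symmetrize_twice[OF x'] by simp
  finally show "sym_part (\<lambda>n. symmetrize s G n (x n)) n = symmetrize s G n (x n)" .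
qed

lemma sym_part_finite_dependence:
  "\<exists>F. finite F \<and> (\<forall>x y. agree_on F x y \<longrightarrow> sym_part x n \<alpha>s = sym_part y n \<alpha>s)"
proof -
  have "\<exists>F. finite F \<and> (\<forall>x y. agree_on F x y \<longrightarrow> retract x n \<beta>s = retract y n \<beta>s)" for \<beta>s
    by (rule retract_finite_dependence)
  then obtain F where F: "\<And>\<beta>s. finite (F \<beta>s)" "\<And>\<beta>s x y. agree_on (F \<beta>s) x y \<Longrightarrow> retract x n \<beta>s = retract y n \<beta>s"
    by metis
  let ?F = "\<Union>\<sigma>\<in>{\<sigma>. \<sigma> permutes {..<n}}. F (permute_list \<sigma> \<alpha>s)"
  have "sym_part x n \<alpha>s = sym_part y n \<alpha>s" if xy: "agree_on ?F x y" for x y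
  proof -
    have "sym_rep x n (permute_list \<sigma> \<alpha>s) = sym_rep y n (permute_list \<sigma> \<alpha>s)" if "\<sigma> permutes {..<n}" for \<sigma>
    proof -
      have "agree_on (F (permute_list \<sigma> \<alpha>s)) x y" using xy that unfolding agree_on_def by blast
      from F(2)[OF this] show ?thesis by (simp add: sym_rep_def pscale_def[of tensor_scale])
    qed
    then have "perm_act s G n \<sigma> (sym_rep x n) \<alpha>s = perm_act s G n \<sigma> (sym_rep y n) \<alpha>s" if "\<sigma> permutes {..<n}" for \<sigma>
      using that by (simp add: perm_act_def)
    then show ?thesis by (simp add: sym_part_def symmetrize_def sum_fun_apply)
  qed
  moreover have "finite ?F" using F(1) by (intro finite_UN_I finite_permutations) auto
  ultimately show ?thesis by blast
qed

text \<open>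
  By the decomposition of the uncompleted tensor algebra, it is enough to consider a symmetrized word, for which the difference
  is zero, and an element of \<open>J\<close>, whose symmetric part is zero.
\<close>

lemma diff_sym_part_in_env_closure_incl:
  assumes t: "t \<in> limit_space d"
  shows "tensor_incl s G t - sym_part (tensor_incl s G t) \<in> env_closure d"
proof -
  have "t \<in> tensor.span (word_symmetrize tensor_scale limit.pure ` {w \<in> limit_words. word_degree w = d} \<union> limit_ideal d)"
    using t limit.tensor_space_deg_decomposition by blast
  then show ?thesis
  proof (induction rule: tensor.span_induct_alt)
    case base
    have zero: "sym_part 0 = 0" using sym_part_scale[of 0 0] by simp
    show ?case unfolding incl_zero zero diff_self by (rule calgebra.subspace_0[OF subspace_env_closure])
  next
    case (step c p t)
    have "tensor_incl s G p - sym_part (tensor_incl s G p) \<in> env_closure d"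
      using step(1)
    proof
      assume "p \<in> word_symmetrize tensor_scale limit.pure ` {w \<in> limit_words. word_degree w = d}"
      then obtain w where w: "w \<in> limit_words" "word_degree w = d" and p: "p = word_symmetrize tensor_scale limit.pure w" by blast
      have "limit.pure w \<in> limit_space d"
        unfolding limit_space_span using w by (intro tensor.span_base) auto
      then have x: "tensor_incl s G (limit.pure w) \<in> ctensor_algebra s G tr d" by (rule incl_in_ctensor_algebra)
      have "tensor_incl s G p = (\<lambda>n. symmetrize s G n (tensor_incl s G (limit.pure w) n))"
        unfolding p by (rule ext) (rule incl_symmetrize(2)[OF w])
      then have eq: "sym_part (tensor_incl s G p) = tensor_incl s G p" using sym_part_symmetrize[OF x] by simp
      show ?thesis unfolding eq diff_self by (rule calgebra.subspace_0[OF subspace_env_closure])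
    next
      assume p: "p \<in> limit_ideal d"
      have "sym_part (tensor_incl s G p) n = 0" for n
        unfolding sym_part_def sym_rep_def retract_env_closure[OF incl_in_env_closure[OF p]]
          cpower.scale_zero_right by (rule symmetrize_zero)
      then have eq: "sym_part (tensor_incl s G p) = 0" by (intro ext) simp
      show ?thesis unfolding eq diff_zero by (rule incl_in_env_closure[OF p])
    qed
    then have "calgebra_scale c (tensor_incl s G p - sym_part (tensor_incl s G p))
        + (tensor_incl s G t - sym_part (tensor_incl s G t)) \<in> env_closure d"
      using step(2) by (intro calgebra.subspace_add calgebra.subspace_scale subspace_env_closure)
    also have "calgebra_scale c (tensor_incl s G p - sym_part (tensor_incl s G p))
        + (tensor_incl s G t - sym_part (tensor_incl s G t))
        = tensor_incl s G (tensor_scale c p + t) - sym_part (tensor_incl s G (tensor_scale c p + t))"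
      unfolding incl_add incl_scale sym_part_add sym_part_scale calgebra.scale_right_diff_distrib
      by (rule add_diff_add[symmetric])
    finally show ?case .
  qed
qed

text \<open>
  Density: every finite set of coordinates of the difference depends on finitely many coordinates of \<open>x\<close>, which are
  those of an element of the uncompleted tensor algebra.
\<close>

lemma diff_sym_part_in_env_closure:
  assumes x: "x \<in> ctensor_algebra s G tr d"
  shows "x - sym_part x \<in> env_closure d"
  unfolding env_closure_iff
proof (intro conjI allI impI)
  have "sym_part x \<in> ctensor_algebra s G tr d"
    using sym_rep_closed[OF x] by (simp add: ctensor_algebra_iff sym_part_def symmetrize_closed)
  then show "x - sym_part x \<in> ctensor_algebra s G tr d"
    using x by (intro calgebra.subspace_diff[OF subspace_ctensor_algebra])
  fix F :: "(nat \<times> 'a list) set" assume F: "finite F"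
  have "\<exists>H. finite H \<and> (\<forall>x y. agree_on H x y \<longrightarrow> sym_part x (fst p) (snd p) = sym_part y (fst p) (snd p))" for p
    by (rule sym_part_finite_dependence)
  then obtain H where H: "\<And>p. finite (H p)"
    "\<And>p x y. agree_on (H p) x y \<Longrightarrow> sym_part x (fst p) (snd p) = sym_part y (fst p) (snd p)" by metis
  let ?F = "F \<union> (\<Union>p\<in>F. H p)"
  have "finite ?F" using F H(1) by auto
  moreover have "x n \<in> ctensor_power s G tr n d" for n using x by (simp add: ctensor_algebra_iff)
  ultimately obtain t where t: "t \<in> limit_space d" "agree_on ?F (tensor_incl s G t) x"
    using incl_dense[of x d ?F] by blast
  obtain t' where t': "t' \<in> limit_ideal d" "agree_on F (tensor_incl s G t') (tensor_incl s G t - sym_part (tensor_incl s G t))"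
    using diff_sym_part_in_env_closure_incl[OF t(1)] F unfolding env_closure_iff by blast
  have "agree_on F (tensor_incl s G t - sym_part (tensor_incl s G t)) (x - sym_part x)"
    unfolding agree_on_def
  proof
    fix p assume p: "p \<in> F"
    have "agree_on (H p) (tensor_incl s G t) x" using t(2) p unfolding agree_on_def by blast
    from H(2)[OF this] have "sym_part (tensor_incl s G t) (fst p) (snd p) = sym_part x (fst p) (snd p)" .
    moreover have "tensor_incl s G t (fst p) (snd p) = x (fst p) (snd p)" using t(2) p unfolding agree_on_def by blast
    ultimately show "(tensor_incl s G t - sym_part (tensor_incl s G t)) (fst p) (snd p) = (x - sym_part x) (fst p) (snd p)" by simp
  qed
  with t' show "\<exists>t\<in>limit_ideal d. agree_on F (tensor_incl s G t) (x - sym_part x)"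
    using agree_on_trans by blast
qed

end

section \<open>The homeomorphism\<close>

context profinite_pronilpotent_lie_algebra
begin

lemma subspace_sym_kernel: "cpower.subspace (sym_kernel s G tr n d)"
  by (rule cpower.subspaceI)
     (auto simp: sym_kernel_def cpower_zero symmetrize_zero cpower_add symmetrize_add cpower_scale symmetrize_scale)

abbreviation sym_class :: "'d \<Rightarrow> nat \<Rightarrow> ('a list \<Rightarrow> ('d, 'v, 'k) tensor) \<Rightarrow> ('a list \<Rightarrow> ('d, 'v, 'k) tensor) set" where
  "sym_class d n t \<equiv> t +o sym_kernel s G tr n d"

text \<open>
  The representative chosen by the definition of \<open>Phi_Sigma\<close> does not matter, as the kernel of symmetrization is divided out.
\<close>

lemma symmetrize_choice: "symmetrize s G n (SOME w. w \<in> sym_class d n t) = symmetrize s G n t"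
proof -
  have "t \<in> sym_class d n t"
    using cpower.subspace_0[OF subspace_sym_kernel] by (simp add: cpower.mem_coset_iff)
  then have "(SOME w. w \<in> sym_class d n t) \<in> sym_class d n t"
    by (rule someI[of "\<lambda>w. w \<in> sym_class d n t"])
  then have "symmetrize s G n ((SOME w. w \<in> sym_class d n t) - t) = 0"
    by (simp add: cpower.mem_coset_iff sym_kernel_def)
  moreover have "symmetrize s G n (SOME w. w \<in> sym_class d n t)
      = symmetrize s G n ((SOME w. w \<in> sym_class d n t) - t) + symmetrize s G n t"
    by (simp add: symmetrize_add[symmetric])
  ultimately show ?thesis by simp
qed

lemma Phi_Sigma_class:
  "Phi_Sigma s G br tr d (\<lambda>n. sym_class d n (w n)) = (\<lambda>n. symmetrize s G n (w n)) +o env_closure d"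
  by (simp only: Phi_Sigma_def symmetrize_choice)

lemma csym_algebra_class:
  assumes "A \<in> csym_algebra s G tr d"
  obtains w where "w \<in> ctensor_algebra s G tr d" "A = (\<lambda>n. sym_class d n (w n))"
proof -
  have "\<exists>t. t \<in> ctensor_power s G tr n d \<and> A n = sym_class d n t" for n
    using assms by (auto simp: csym_algebra_def csym_power_def PiE_UNIV_domain)
  then obtain w where "\<And>n. w n \<in> ctensor_power s G tr n d \<and> A n = sym_class d n (w n)" by metis
  then show thesis by (intro that[of w]) (auto simp: ctensor_algebra_iff fun_eq_iff)
qed

lemma topspace_csym_algebra: "topspace (csym_algebra_topology s G tr d) = csym_algebra s G tr d"
  by (simp add: csym_algebra_topology_def csym_algebra_def csym_power_topology_def csym_power_def
      quotient_topology_topspace ctensor_power_topology_def)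

lemma topspace_cenv: "topspace (cenv_topology s G br tr d) = (\<lambda>t. t +o env_closure d) ` ctensor_algebra s G tr d"
  by (simp add: cenv_topology_def quotient_topology_topspace)

lemma continuous_map_symmetrize:
  "continuous_map (ctensor_power_topology s G tr n d) (ctensor_power_topology s G tr n d) (symmetrize s G n)"
  unfolding ctensor_power_topology_def
proof (rule continuous_map_into_inverse_limit_local)
  let ?L = "ctensor_power s G tr n d"
  show "symmetrize s G n t \<in> ?L" if "t \<in> topspace (inverse_limit_topology ?L)" for t
    using that by (simp add: symmetrize_closed)
  fix \<alpha>s :: "'a list" and t assume t: "t \<in> topspace (inverse_limit_topology ?L)"
  let ?A = "(\<lambda>\<sigma>. permute_list \<sigma> \<alpha>s) ` {\<sigma>. \<sigma> permutes {..<n}}"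
  let ?U = "{u \<in> ?L. \<forall>a\<in>?A. u a = t a}"
  have "openin (inverse_limit_topology ?L) ?U"
    by (rule openin_agree_inverse_limit) (simp add: finite_permutations)
  moreover have "t \<in> ?U" using t by simp
  moreover have "symmetrize s G n u \<alpha>s = symmetrize s G n t \<alpha>s" if "u \<in> ?U" for u
  proof -
    have "(\<Sum>\<sigma> | \<sigma> permutes {..<n}. perm_act s G n \<sigma> u \<alpha>s) = (\<Sum>\<sigma> | \<sigma> permutes {..<n}. perm_act s G n \<sigma> t \<alpha>s)"
      by (intro sum.cong refl) (use that in \<open>simp add: perm_act_def\<close>)
    then show ?thesis by (simp add: symmetrize_def sum_fun_apply)
  qed
  ultimately show "\<exists>U. openin (inverse_limit_topology ?L) U \<and> t \<in> U \<and>
      (\<forall>u\<in>U. symmetrize s G n u \<alpha>s = symmetrize s G n t \<alpha>s)" by blast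
qed

lemma continuous_map_sym_rep:
  "continuous_map (ctensor_algebra_topology s G tr d) (ctensor_power_topology s G tr n d) (\<lambda>x. sym_rep x n)"
  unfolding ctensor_power_topology_def
proof (rule continuous_map_into_inverse_limit_local)
  let ?X = "ctensor_algebra_topology s G tr d"
  show "sym_rep x n \<in> ctensor_power s G tr n d" if "x \<in> topspace ?X" for x
    using that by (simp add: sym_rep_closed)
  fix \<alpha>s x assume x: "x \<in> topspace ?X"
  obtain F where F: "finite F" "\<And>x y. agree_on F x y \<Longrightarrow> retract x n \<alpha>s = retract y n \<alpha>s"
    using retract_finite_dependence by blast
  let ?U = "{y \<in> topspace ?X. agree_on F y x}"
  have "openin ?X ?U" unfolding ctensor_algebra_topology_eq by (rule openin_agree_on[OF F(1)])
  moreover have "x \<in> ?U" using x agree_on_refl by blast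
  moreover have "sym_rep y n \<alpha>s = sym_rep x n \<alpha>s" if "y \<in> ?U" for y
    using F(2)[of y x] that by (simp add: sym_rep_def pscale_def[of tensor_scale])
  ultimately show "\<exists>U. openin ?X U \<and> x \<in> U \<and> (\<forall>y\<in>U. sym_rep y n \<alpha>s = sym_rep x n \<alpha>s)" by blast
qed

lemma continuous_map_Phi_Sigma:
  "continuous_map (csym_algebra_topology s G tr d) (cenv_topology s G br tr d) (Phi_Sigma s G br tr d)"
proof -
  let ?S = "\<lambda>A n. symmetrize s G n (SOME w. w \<in> A n)"
  have component: "continuous_map (csym_power_topology s G tr n d) (ctensor_power_topology s G tr n d)
      (\<lambda>C. symmetrize s G n (SOME w. w \<in> C))" for n
    unfolding csym_power_topology_def
    by (rule continuous_compose_quotient_map[OF quotient_map_quotient_topology])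
       (simp only: comp_def symmetrize_choice continuous_map_symmetrize)
  have "continuous_map (csym_algebra_topology s G tr d) (ctensor_algebra_topology s G tr d) ?S"
    unfolding ctensor_algebra_topology_def continuous_map_componentwise_UNIV
  proof
    fix n
    have "continuous_map (csym_algebra_topology s G tr d) (csym_power_topology s G tr n d) (\<lambda>A. A n)"
      unfolding csym_algebra_topology_def by (rule continuous_map_product_projection) simp
    from continuous_map_compose[OF this component]
    show "continuous_map (csym_algebra_topology s G tr d) (ctensor_power_topology s G tr n d) (\<lambda>A. ?S A n)"
      by (simp add: comp_def)
  qed
  moreover have "continuous_map (ctensor_algebra_topology s G tr d) (cenv_topology s G br tr d) (\<lambda>t. t +o env_closure d)"
    unfolding cenv_topology_def by (rule quotient_imp_continuous_map[OF quotient_map_quotient_topology])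
  ultimately have "continuous_map (csym_algebra_topology s G tr d) (cenv_topology s G br tr d)
      ((\<lambda>t. t +o env_closure d) \<circ> ?S)"
    by (rule continuous_map_compose)
  then show ?thesis by (simp add: comp_def Phi_Sigma_def[abs_def])
qed

definition Phi_Sigma_inverse :: "'d \<Rightarrow> (nat \<Rightarrow> 'a list \<Rightarrow> ('d, 'v, 'k) tensor) set \<Rightarrow> nat \<Rightarrow> ('a list \<Rightarrow> ('d, 'v, 'k) tensor) set" where
  "Phi_Sigma_inverse d C n = sym_class d n (sym_rep (SOME x. x \<in> C) n)"

lemma Phi_Sigma_inverse_class: "Phi_Sigma_inverse d (x +o env_closure d) n = sym_class d n (sym_rep x n)"
proof -
  let ?y = "SOME y. y \<in> x +o env_closure d"
  have "x \<in> x +o env_closure d"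
    using calgebra.subspace_0[OF subspace_env_closure] by (simp add: calgebra.mem_coset_iff)
  then have "?y \<in> x +o env_closure d"
    by (rule someI[of "\<lambda>y. y \<in> x +o env_closure d"])
  then have "retract (?y - x) n = 0" by (simp add: calgebra.mem_coset_iff retract_env_closure)
  moreover have "retract ?y n = retract (?y - x) n + retract x n"
    by (simp only: retract_add[symmetric] diff_add_cancel)
  ultimately have "retract ?y n = retract x n" by simp
  then show ?thesis by (simp only: Phi_Sigma_inverse_def sym_rep_def)
qed

lemma continuous_map_Phi_Sigma_inverse:
  "continuous_map (cenv_topology s G br tr d) (csym_algebra_topology s G tr d) (Phi_Sigma_inverse d)"
  unfolding cenv_topology_def
proof (rule continuous_compose_quotient_map[OF quotient_map_quotient_topology])
  have "continuous_map (ctensor_algebra_topology s G tr d) (csym_power_topology s G tr n d)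
      (\<lambda>x. sym_class d n (sym_rep x n))" for n
    using continuous_map_compose[OF continuous_map_sym_rep
        quotient_imp_continuous_map[OF quotient_map_quotient_topology], of d n "\<lambda>t. t +o sym_kernel s G tr n d"]
    by (simp add: comp_def csym_power_topology_def)
  then show "continuous_map (ctensor_algebra_topology s G tr d) (csym_algebra_topology s G tr d)
      (Phi_Sigma_inverse d \<circ> (\<lambda>t. t +o env_closure d))"
    unfolding csym_algebra_topology_def continuous_map_componentwise_UNIV by (simp add: Phi_Sigma_inverse_class)
qed

lemma homeomorphic_maps_Phi_Sigma:
  "homeomorphic_maps (csym_algebra_topology s G tr d) (cenv_topology s G br tr d) (Phi_Sigma s G br tr d) (Phi_Sigma_inverse d)"
  unfolding homeomorphic_maps_def
proof (intro conjI ballI continuous_map_Phi_Sigma continuous_map_Phi_Sigma_inverse)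
  fix A assume "A \<in> topspace (csym_algebra_topology s G tr d)"
  then obtain w where w: "w \<in> ctensor_algebra s G tr d" and A: "A = (\<lambda>n. sym_class d n (w n))"
    unfolding topspace_csym_algebra by (rule csym_algebra_class)
  let ?S = "\<lambda>n. symmetrize s G n (w n)"
  show "Phi_Sigma_inverse d (Phi_Sigma s G br tr d A) = A"
    unfolding A Phi_Sigma_class
  proof
    fix n
    have wn: "w n \<in> ctensor_power s G tr n d" using w by (simp add: ctensor_algebra_iff)
    have S: "?S \<in> ctensor_algebra s G tr d" using w by (simp add: ctensor_algebra_iff symmetrize_closed)
    have "symmetrize s G n (sym_rep ?S n - w n) = symmetrize s G n (sym_rep ?S n) - symmetrize s G n (w n)"
      using symmetrize_add[of n "sym_rep ?S n - w n" "w n"] by simp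
    also have "\<dots> = 0"
      using fun_cong[OF sym_part_symmetrize[OF w], of n] by (simp add: sym_part_def)
    finally have "sym_rep ?S n - w n \<in> sym_kernel s G tr n d"
      unfolding sym_kernel_def using cpower_diff[OF sym_rep_closed[OF S] wn] by simp
    then show "Phi_Sigma_inverse d (?S +o env_closure d) n = sym_class d n (w n)"
      unfolding Phi_Sigma_inverse_class cpower.coset_eq_iff[OF subspace_sym_kernel] .
  qed
next
  fix C assume "C \<in> topspace (cenv_topology s G br tr d)"
  then obtain x where x: "x \<in> ctensor_algebra s G tr d" and C: "C = x +o env_closure d"
    unfolding topspace_cenv by blast
  have "Phi_Sigma_inverse d C = (\<lambda>n. sym_class d n (sym_rep x n))" by (rule ext) (simp only: C Phi_Sigma_inverse_class)
  then have "Phi_Sigma s G br tr d (Phi_Sigma_inverse d C) = sym_part x +o env_closure d"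
    by (simp only: Phi_Sigma_class sym_part_def[abs_def])
  also have "\<dots> = C"
    unfolding C using calgebra.subspace_neg[OF subspace_env_closure diff_sym_part_in_env_closure[OF x]]
    by (simp only: calgebra.coset_eq_iff[OF subspace_env_closure] minus_diff_eq)
  finally show "Phi_Sigma s G br tr d (Phi_Sigma_inverse d C) = C" .
qed

end

theorem theorem3p1:
  fixes s :: "'k::field_char_0 \<Rightarrow> 'v::ab_group_add \<Rightarrow> 'v"
    and G :: "'a::preorder \<Rightarrow> 'd::grading_index \<Rightarrow> 'v set"
    and br :: "'a \<Rightarrow> 'd \<Rightarrow> 'd \<Rightarrow> 'v \<Rightarrow> 'v \<Rightarrow> 'v"
    and tr :: "'a \<Rightarrow> 'a \<Rightarrow> 'd \<Rightarrow> 'v \<Rightarrow> 'v"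
    and d :: 'd
  assumes "profinite_pronilpotent_lie_algebra s G br tr"
  shows "(\<forall>w \<in> ctensor_algebra s G tr d.
            Phi_Sigma s G br tr d (\<lambda>n. w n +o sym_kernel s G tr n d) =
              (\<lambda>n. symmetrize s G n (w n)) +o env_ideal_closure s G br tr d) \<and>
         (\<forall>A \<in> csym_algebra s G tr d. \<forall>B \<in> csym_algebra s G tr d.
            Phi_Sigma s G br tr d (\<lambda>n. A n + B n) =
              Phi_Sigma s G br tr d A + Phi_Sigma s G br tr d B) \<and>
         (\<forall>c. \<forall>A \<in> csym_algebra s G tr d.
            Phi_Sigma s G br tr d (\<lambda>n. coset_scale cpower_scale (sym_kernel s G tr n d) c (A n)) =
              coset_scale calgebra_scale (env_ideal_closure s G br tr d) c
                (Phi_Sigma s G br tr d A)) \<and>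
         homeomorphic_map (csym_algebra_topology s G tr d) (cenv_topology s G br tr d)
           (Phi_Sigma s G br tr d)"
proof (intro conjI ballI allI)
  interpret profinite_pronilpotent_lie_algebra s G br tr by fact
  show "Phi_Sigma s G br tr d (\<lambda>n. sym_class d n (w n)) = (\<lambda>n. symmetrize s G n (w n)) +o env_closure d" for w
    by (rule Phi_Sigma_class)
  show "homeomorphic_map (csym_algebra_topology s G tr d) (cenv_topology s G br tr d) (Phi_Sigma s G br tr d)"
    by (rule homeomorphic_maps_imp_map[OF homeomorphic_maps_Phi_Sigma])
  fix A assume "A \<in> csym_algebra s G tr d"
  then obtain a where A: "A = (\<lambda>n. sym_class d n (a n))" by (rule csym_algebra_class)
  show "Phi_Sigma s G br tr d (\<lambda>n. coset_scale cpower_scale (sym_kernel s G tr n d) c (A n)) =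
      coset_scale calgebra_scale (env_closure d) c (Phi_Sigma s G br tr d A)" for c
  proof -
    have "(\<lambda>n. symmetrize s G n (cpower_scale c (a n))) = calgebra_scale c (\<lambda>n. symmetrize s G n (a n))"
      by (rule ext) (simp only: symmetrize_scale pscale_def[of cpower_scale])
    then show ?thesis
      unfolding A cpower.coset_scale_coset[OF subspace_sym_kernel] Phi_Sigma_class
        calgebra.coset_scale_coset[OF subspace_env_closure] by (simp only:)
  qed
  fix B assume "B \<in> csym_algebra s G tr d"
  then obtain b where B: "B = (\<lambda>n. sym_class d n (b n))" by (rule csym_algebra_class)
  have "(\<lambda>n. symmetrize s G n (a n + b n)) = (\<lambda>n. symmetrize s G n (a n)) + (\<lambda>n. symmetrize s G n (b n))"
    by (rule ext) (simp add: symmetrize_add)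
  then show "Phi_Sigma s G br tr d (\<lambda>n. A n + B n) = Phi_Sigma s G br tr d A + Phi_Sigma s G br tr d B"
    unfolding A B cpower.coset_plus_coset[OF subspace_sym_kernel] Phi_Sigma_class
      calgebra.coset_plus_coset[OF subspace_env_closure] by (simp only:)
qed

end
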